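(* Let $F$ be Thompson's group with standard generating set $\{x_0^{\pm1},x_1^{\pm1}\}$. Algorithm B (described in the context) computes the number of elements of $F$ in the spheres of radius up to $n$ in time $O(n^3)$ and space $O(n^2)$.
   Context: Thompson's group $F$ is given by the presentation $\langle x_0,x_1 \mid [x_0x_1^{-1},x_0^{-1}x_1x_0],\ [x_0x_1^{-1},x_0^{-2}x_1x_0^2]\rangle$. The sphere of radius $k$ is the set of elements whose geodesic length (minimal length of a word in $x_0^{\pm1},x_1^{\pm1}$ representing the element) is exactly $k$. Time is measured by the number of operations (including arithmetic operations on integer coefficients), and space by the number of stored coefficients. States. A state of a (half-)diagram is a triple (label, side, excess), with label in $\{L,N,X,R,I\}$, side in $\{\mathrm{left},\mathrm{right}\}$ and excess a nonnegative integer. The allowed transitions from a state are: - from $(L,\mathrm{left},0)$: to $(L,\mathrm{left},0)$, $(N,\mathrm{left},1)$, $(I,\mathrm{left},0)$, $(N,\mathrm{right},1)$, $(I,\mathrm{right},0)$, $(R,\mathrm{right},0)$, $(X,\mathrm{right},0)$; - from $(R,\mathrm{right},0)$: to $(R,\mathrm{right},0)$, $(X,\mathrm{right},0)$; - from $(X,\mathrm{right},0)$: to $(N,\mathrm{right},1)$, $(I,\mathrm{right},0)$; - from $(I,\mathrm{left},0)$: to $(N,\mathrm{left},1)$, $(I,\mathrm{left},0)$, $(L,\mathrm{left},0)$; - from $(I,\mathrm{right},0)$: to $(N,\mathrm{right},1)$, $(I,\mathrm{right},0)$, $(R,\mathrm{right},0)$, $(X,\mathrm{right},0)$; - from $(N,p,h)$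 or $(I,p,h)$ with $h>0$ and $p\in\{\mathrm{left},\mathrm{right}\}$: to $(N,p,h+1)$, $(N,p,h)$, $(I,p,h)$, $(I,p,h-1)$. Weights. The symmetric weight function $W$ on pairs of labels is: $W(I,I)=2$, $W(I,N)=4$, $W(I,L)=2$, $W(I,R)=1$, $W(I,X)=3$, $W(N,N)=4$, $W(N,L)=2$, $W(N,R)=3$, $W(N,X)=3$, $W(L,L)=2$, $W(L,R)=1$, $W(L,X)=1$, $W(R,R)=2$, $W(R,X)=2$, $W(X,X)=2$. Algorithm B. Maintain counters $\mathrm{totals}(\ell,\sigma,\tau)$, where $\ell$ is a weight and $\sigma,\tau$ are states (of the upper and lower forests), all zero initially except $\mathrm{totals}(2,(L,\mathrm{left},0),(L,\mathrm{left},0))=1$. For $\ell=2,3,\ldots$ in turn, for every pair $(\sigma,\tau)$ with $c=\mathrm{totals}(\ell,\sigma,\tau)\neq0$, and for every allowed transition $\sigma\to\sigma'$ and every allowed transition $\tau\to\tau'$, reject the pair $(\sigma',\tau')$ if both $\sigma'$ and $\tau'$ have label $I$ while neither $\sigma$ nor $\tau$ has label $I$ (this would create a common caret); otherwise increase $\mathrm{totals}(\ell+W(\mathrm{label}(\sigma'),\mathrm{label}(\tau')),\sigma',\tau')$ by $c$. Counters of weight $\ell$ can be discarded once all of them have been processed. Output $h_\ell=\mathrm{totals}(\ell,(R,\mathrm{right},0),(R,\mathrm{right},0))$ for each $\ell$. The process is iterated until the weight needed to determine the desired radius is reached. Finally, with $H(q)=\sum_{\ell\ge4}h_\ell q^\ell$,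 the numbers $f_0,f_1,\ldots$ returned as sphere sizes ($f_k$ for radius $k$) are the coefficients of $F(q)=\sum_k f_kq^k=\left(\frac{1-q^2}{q^2}\right)^2H(q)$. *)

theory Defs
  imports
    "HOL-Algebra.Group"
    "HOL-Computational_Algebra.Formal_Laurent_Series"
    "HOL-Library.AList"
    "HOL-Library.Landau_Symbols"
    "HOL-Library.State_Monad"
begin

section \<open>Groups given by a presentation\<close>

text \<open>
  A letter \<open>(x, True)\<close> stands for the generator \<open>x\<close> and \<open>(x, False)\<close> for its inverse.
  All elements of the type \<open>'g\<close> are generators.
\<close>

type_synonym 'g word = "('g \<times> bool) list"

definition inv_word :: "'g word \<Rightarrow> 'g word" where
  "inv_word w = rev (map (\<lambda>(x, e). (x, \<not> e)) w)"

inductive word_eq :: "'g word set \<Rightarrow> 'g word \<Rightarrow> 'g word \<Rightarrow> bool"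
  for rels :: "'g word set" where
  refl: "word_eq rels w w"
| sym: "word_eq rels u v \<Longrightarrow> word_eq rels v u"
| trans: "word_eq rels u v \<Longrightarrow> word_eq rels v w \<Longrightarrow> word_eq rels u w"
| cancel: "word_eq rels (u @ [(x, e), (x, \<not> e)] @ v) (u @ v)"
| relator: "r \<in> rels \<Longrightarrow> word_eq rels (u @ r @ v) (u @ v)"

definition word_class :: "'g word set \<Rightarrow> 'g word \<Rightarrow> 'g word set" where
  "word_class rels w = {v. word_eq rels w v}"

definition presented_group :: "'g word set \<Rightarrow> 'g word set monoid" where
  "presented_group rels =
     \<lparr> carrier = range (word_class rels),
       monoid.mult = (\<lambda>A B. \<Union>u\<in>A. \<Union>v\<in>B. word_class rels (u @ v)),
       one = word_class rels [] \<rparr>"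

lemma word_class_eq_iff: "word_class rels u = word_class rels v \<longleftrightarrow> word_eq rels u v"
  unfolding word_class_def by (blast intro: word_eq.intros)

lemma word_eq_append_left: "word_eq rels u v \<Longrightarrow> word_eq rels (p @ u) (p @ v)"
proof (induction rule: word_eq.induct)
  case (cancel u x e v)
  then show ?case using word_eq.cancel[of rels "p @ u" x e v] by simp
next
  case (relator r u v)
  then show ?case using word_eq.relator[of r rels "p @ u" v] by simp
qed (blast intro: word_eq.intros)+

lemma word_eq_append_right: "word_eq rels u v \<Longrightarrow> word_eq rels (u @ p) (v @ p)"
proof (induction rule: word_eq.induct)
  case (cancel u x e v)
  then show ?case using word_eq.cancel[of rels u x e "v @ p"] by simp
next
  case (relator r u v)
  then show ?case using word_eq.relator[of r rels u "v @ p"] by simp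
qed (blast intro: word_eq.intros)+

lemma word_eq_append:
  "word_eq rels u u' \<Longrightarrow> word_eq rels v v' \<Longrightarrow> word_eq rels (u @ v) (u' @ v')"
  by (blast intro: word_eq.trans word_eq_append_left word_eq_append_right)

lemma presented_group_mult:
  "word_class rels u \<otimes>\<^bsub>presented_group rels\<^esub> word_class rels v = word_class rels (u @ v)"
proof -
  have "word_class rels (u' @ v') = word_class rels (u @ v)"
    if "u' \<in> word_class rels u" "v' \<in> word_class rels v" for u' v'
    using that word_eq_append[of rels u u' v v']
    by (simp add: word_class_eq_iff) (simp add: word_class_def word_eq.sym)
  moreover have "u \<in> word_class rels u" "v \<in> word_class rels v"
    by (simp_all add: word_class_def word_eq.refl)
  ultimately have "(\<Union>u'\<in>word_class rels u. \<Union>v'\<in>word_class rels v. word_class rels (u' @ v'))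
      = word_class rels (u @ v)"
    by blast
  then show ?thesis by (simp add: presented_group_def)
qed

lemma word_eq_inv_word: "word_eq rels (inv_word w @ w) []"
proof (induction w)
  case Nil
  then show ?case by (simp add: inv_word_def word_eq.refl)
next
  case (Cons a w)
  obtain x e where a: "a = (x, e)" by (cases a)
  have "word_eq rels (inv_word (a # w) @ a # w) (inv_word w @ w)"
    using word_eq.cancel[of rels "inv_word w" x "\<not> e" w] by (simp add: a inv_word_def)
  then show ?case using Cons by (blast intro: word_eq.trans)
qed

lemma carrier_presented_group: "carrier (presented_group rels) = range (word_class rels)"
  by (simp add: presented_group_def)

lemma one_presented_group: "\<one>\<^bsub>presented_group rels\<^esub> = word_class rels []"
  by (simp add: presented_group_def)

lemma group_presented_group: "group (presented_group rels)"
proof (rule groupI)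
  fix A assume "A \<in> carrier (presented_group rels)"
  then obtain w where w: "A = word_class rels w" by (auto simp: carrier_presented_group)
  have "word_class rels (inv_word w) \<otimes>\<^bsub>presented_group rels\<^esub> A = \<one>\<^bsub>presented_group rels\<^esub>"
    using word_eq_inv_word[of rels w]
    by (simp add: w presented_group_mult one_presented_group word_class_eq_iff)
  then show "\<exists>B\<in>carrier (presented_group rels).
      B \<otimes>\<^bsub>presented_group rels\<^esub> A = \<one>\<^bsub>presented_group rels\<^esub>"
    by (auto simp: carrier_presented_group)
qed (auto simp: carrier_presented_group one_presented_group presented_group_mult)


section \<open>Thompson's group \<open>F\<close> and its spheres\<close>

datatype generator = x0 | x1

abbreviation x0_word :: "generator word" where "x0_word \<equiv> [(x0, True)]"
abbreviation x1_word :: "generator word" where "x1_word \<equiv> [(x1, True)]"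

definition commutator_word :: "'g word \<Rightarrow> 'g word \<Rightarrow> 'g word" where
  "commutator_word u v = u @ v @ inv_word u @ inv_word v"

definition thompson_relators :: "generator word set" where
  "thompson_relators =
     (let a = x0_word @ inv_word x1_word;
          x0_sq = x0_word @ x0_word
      in {commutator_word a (inv_word x0_word @ x1_word @ x0_word),
          commutator_word a (inv_word x0_sq @ x1_word @ x0_sq)})"

definition thompson_F :: "generator word set monoid" where
  "thompson_F = presented_group thompson_relators"

definition represents :: "generator word \<Rightarrow> generator word set \<Rightarrow> bool" where
  "represents w g \<longleftrightarrow> g = word_class thompson_relators w"

definition geodesic_length :: "generator word set \<Rightarrow> nat" where
  "geodesic_length g = (LEAST k. \<exists>w. length w = k \<and> represents w g)"

definition sphere_F :: "nat \<Rightarrow> generator word set set" where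
  "sphere_F k = {g \<in> carrier thompson_F. geodesic_length g = k}"

text \<open>Spheres are finite, so their cardinalities are meaningful.\<close>

lemma finite_sphere_F: "finite (sphere_F k)"
proof (rule finite_subset)
  have fin: "finite (UNIV :: (generator \<times> bool) set)"
  proof -
    have "(UNIV :: generator set) = {x0, x1}"
      using generator.exhaust by auto
    then have "finite (UNIV :: generator set)" by (metis finite.emptyI finite.insertI)
    then show ?thesis by (simp add: finite_prod)
  qed
  show "finite (word_class thompson_relators ` {w. set w \<subseteq> UNIV \<and> length w = k})"
    using finite_lists_length_eq[OF fin, of k] by simp
  show "sphere_F k \<subseteq> word_class thompson_relators ` {w. set w \<subseteq> UNIV \<and> length w = k}"
  proof
    fix g assume "g \<in> sphere_F k"
    then obtain w where "represents w g" and k: "geodesic_length g = k"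
      by (auto simp: sphere_F_def thompson_F_def presented_group_def represents_def)
    then have "\<exists>k v. length v = k \<and> represents v g" by blast
    then have "\<exists>v. length v = geodesic_length g \<and> represents v g"
      unfolding geodesic_length_def by (rule LeastI_ex)
    then obtain v where "length v = k" "g = word_class thompson_relators v"
      using k by (auto simp: represents_def)
    then show "g \<in> word_class thompson_relators ` {w. set w \<subseteq> UNIV \<and> length w = k}"
      by (intro image_eqI[of _ _ v]) simp_all
  qed
qed


section \<open>States, transitions and weights\<close>

datatype label = LabL | LabN | LabX | LabR | LabI
datatype side = LeftSide | RightSide

type_synonym forest_state = "label \<times> side \<times> nat"

abbreviation label_of :: "forest_state \<Rightarrow> label" where "label_of \<equiv> fst"

fun transitions :: "forest_state \<Rightarrow> forest_state list" where
  "transitions (LabL, LeftSide, 0) =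
     [(LabL, LeftSide, 0), (LabN, LeftSide, 1), (LabI, LeftSide, 0), (LabN, RightSide, 1),
      (LabI, RightSide, 0), (LabR, RightSide, 0), (LabX, RightSide, 0)]"
| "transitions (LabR, RightSide, 0) = [(LabR, RightSide, 0), (LabX, RightSide, 0)]"
| "transitions (LabX, RightSide, 0) = [(LabN, RightSide, 1), (LabI, RightSide, 0)]"
| "transitions (LabI, LeftSide, 0) =
     [(LabN, LeftSide, 1), (LabI, LeftSide, 0), (LabL, LeftSide, 0)]"
| "transitions (LabI, RightSide, 0) =
     [(LabN, RightSide, 1), (LabI, RightSide, 0), (LabR, RightSide, 0), (LabX, RightSide, 0)]"
| "transitions (LabN, p, Suc h) =
     [(LabN, p, Suc (Suc h)), (LabN, p, Suc h), (LabI, p, Suc h), (LabI, p, h)]"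
| "transitions (LabI, p, Suc h) =
     [(LabN, p, Suc (Suc h)), (LabN, p, Suc h), (LabI, p, Suc h), (LabI, p, h)]"
| "transitions _ = []"

fun weight :: "label \<Rightarrow> label \<Rightarrow> nat" where
  "weight LabI LabI = 2"
| "weight LabI LabN = 4" | "weight LabN LabI = 4"
| "weight LabI LabL = 2" | "weight LabL LabI = 2"
| "weight LabI LabR = 1" | "weight LabR LabI = 1"
| "weight LabI LabX = 3" | "weight LabX LabI = 3"
| "weight LabN LabN = 4"
| "weight LabN LabL = 2" | "weight LabL LabN = 2"
| "weight LabN LabR = 3" | "weight LabR LabN = 3"
| "weight LabN LabX = 3" | "weight LabX LabN = 3"
| "weight LabL LabL = 2"
| "weight LabL LabR = 1" | "weight LabR LabL = 1"
| "weight LabL LabX = 1" | "weight LabX LabL = 1"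
| "weight LabR LabR = 2"
| "weight LabR LabX = 2" | "weight LabX LabR = 2"
| "weight LabX LabX = 2"

abbreviation start_state :: forest_state where "start_state \<equiv> (LabL, LeftSide, 0)"
abbreviation end_state :: forest_state where "end_state \<equiv> (LabR, RightSide, 0)"


section \<open>A machine that counts operations and stored coefficients\<close>

text \<open>
  The memory is a finite partial map from addresses to integer coefficients, kept as an
  association list with distinct keys in order of creation; an address that is not stored has
  the value zero. Besides the counters there are three one-dimensional arrays: \<open>H\<close> for the
  numbers \<open>h\<^sub>\<ell>\<close>, \<open>G\<close> for an intermediate series and \<open>F\<close> for the result.

  Each access to a single address, each arithmetic operation and each test costs one operation,
  independently of the size of the integers involved. The field \<open>peak\<close> is the largest number
  of coefficients that have been stored at the same time.
\<close>

datatype address = Totals nat forest_state forest_state | H nat | G nat | F nat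

record machine =
  memory :: "(address \<times> int) list"
  operations :: nat
  peak :: nat

type_synonym 'a prog = "(machine, 'a) state"

definition initial_machine :: machine where
  "initial_machine = \<lparr>memory = [], operations = 0, peak = 0\<rparr>"

definition charge :: "nat \<Rightarrow> unit prog" where
  "charge k = State_Monad.update (\<lambda>m. m\<lparr>operations := operations m + k\<rparr>)"

definition op1 :: "'a \<Rightarrow> 'a prog" where
  "op1 v = do { charge 1; State_Monad.return v }"

definition stored_value :: "machine \<Rightarrow> address \<Rightarrow> int" where
  "stored_value m a = (case map_of (memory m) a of None \<Rightarrow> 0 | Some v \<Rightarrow> v)"

definition load :: "address \<Rightarrow> int prog" where
  "load a = do {
     charge 1;
     m \<leftarrow> State_Monad.get;
     State_Monad.return (stored_value m a) }"

definition store :: "address \<Rightarrow> int \<Rightarrow> unit prog" where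
  "store a v = do {
     charge 1;
     State_Monad.update (\<lambda>m.
       let mem = AList.update a v (memory m)
       in m\<lparr>memory := mem, peak := max (peak m) (length mem)\<rparr>) }"

definition discard :: "address \<Rightarrow> unit prog" where
  "discard a = do {
     charge 1;
     State_Monad.update (\<lambda>m. m\<lparr>memory := AList.delete a (memory m)\<rparr>) }"

text \<open>
  Listing the pairs of states that have a stored counter of weight \<open>wt\<close> is charged for
  inspecting every coefficient in memory.
\<close>

definition stored_pairs :: "nat \<Rightarrow> (forest_state \<times> forest_state) list prog" where
  "stored_pairs wt = do {
     m \<leftarrow> State_Monad.get;
     charge (length (memory m));
     State_Monad.return
       (List.map_filter
         (\<lambda>a. case a of Totals wt' \<sigma> \<tau> \<Rightarrow> if wt' = wt then Some (\<sigma>, \<tau>) else None | _ \<Rightarrow> None)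
         (map fst (memory m))) }"

primrec for_each :: "'b list \<Rightarrow> ('b \<Rightarrow> unit prog) \<Rightarrow> unit prog" where
  "for_each [] body = State_Monad.return ()"
| "for_each (x # xs) body = do { body x; for_each xs body }"


section \<open>Algorithm B\<close>

definition common_caret :: "forest_state \<Rightarrow> forest_state \<Rightarrow> forest_state \<Rightarrow> forest_state \<Rightarrow> bool" where
  "common_caret \<sigma> \<tau> \<sigma>' \<tau>' \<longleftrightarrow>
     label_of \<sigma>' = LabI \<and> label_of \<tau>' = LabI \<and> label_of \<sigma> \<noteq> LabI \<and> label_of \<tau> \<noteq> LabI"

definition process_transition ::
    "nat \<Rightarrow> forest_state \<times> forest_state \<Rightarrow> int \<Rightarrow> forest_state \<times> forest_state \<Rightarrow> unit prog" where
  "process_transition wt = (\<lambda>(\<sigma>, \<tau>) c (\<sigma>', \<tau>'). do {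
     reject \<leftarrow> op1 (common_caret \<sigma> \<tau> \<sigma>' \<tau>');
     if reject then State_Monad.return ()
     else do {
       w \<leftarrow> op1 (weight (label_of \<sigma>') (label_of \<tau>'));
       wt' \<leftarrow> op1 (wt + w);
       t \<leftarrow> load (Totals wt' \<sigma>' \<tau>');
       t' \<leftarrow> op1 (t + c);
       store (Totals wt' \<sigma>' \<tau>') t' } })"

definition process_pair :: "nat \<Rightarrow> forest_state \<times> forest_state \<Rightarrow> unit prog" where
  "process_pair wt = (\<lambda>(\<sigma>, \<tau>). do {
     c \<leftarrow> load (Totals wt \<sigma> \<tau>);
     nonzero \<leftarrow> op1 (c \<noteq> 0);
     if nonzero
     then for_each (List.product (transitions \<sigma>) (transitions \<tau>))
            (process_transition wt (\<sigma>, \<tau>) c)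
     else State_Monad.return () })"

definition process_weight :: "nat \<Rightarrow> unit prog" where
  "process_weight wt = do {
     pairs \<leftarrow> stored_pairs wt;
     for_each pairs (process_pair wt);
     h \<leftarrow> load (Totals wt end_state end_state);
     store (H wt) h;
     for_each pairs (\<lambda>(\<sigma>, \<tau>). discard (Totals wt \<sigma> \<tau>)) }"

text \<open>
  The \<open>m\<close>-th coefficient of \<open>(1 - q\<^sup>2) A(q)\<close>, where \<open>A(q) = \<Sum>\<^sub>\<ell>\<^sub>\<ge>\<^sub>4 a\<^sub>\<ell> q\<^sup>\<ell>\<close> is stored at the
  addresses \<open>arr \<ell>\<close>, for \<open>m \<ge> 4\<close>.
\<close>

definition times_one_minus_q2 :: "(nat \<Rightarrow> address) \<Rightarrow> nat \<Rightarrow> int prog" where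
  "times_one_minus_q2 arr m = do {
     a \<leftarrow> load (arr m);
     short \<leftarrow> op1 (m < 4 + 2);
     if short then State_Monad.return a
     else do { b \<leftarrow> load (arr (m - 2)); op1 (a - b) } }"

text \<open>
  All the series start at \<open>q\<^sup>4\<close>, so the final division by \<open>q\<^sup>4\<close> is a shift of indices, and
  \<open>f\<^sub>0, \<dots>, f\<^sub>n\<close> need the weights up to \<open>n + 4\<close>.
\<close>

definition sphere_series :: "nat \<Rightarrow> int list prog" where
  "sphere_series n = do {
     for_each [4..<n + 5] (\<lambda>m. do { g \<leftarrow> times_one_minus_q2 H m; store (G m) g });
     for_each [0..<n + 1] (\<lambda>k. do { f \<leftarrow> times_one_minus_q2 G (k + 4); store (F k) f });
     State_Monad.traverse_list (\<lambda>k. load (F k)) [0..<n + 1] }"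

lemma run_op1: "run_state (op1 v) m = (v, m\<lparr>operations := operations m + 1\<rparr>)"
  by (simp add: op1_def charge_def State_Monad.update_def)

lemma stored_value_charge [simp]: "stored_value (m\<lparr>operations := k\<rparr>) a = stored_value m a"
  by (simp add: stored_value_def)

lemma run_load: "run_state (load a) m = (stored_value m a, m\<lparr>operations := operations m + 1\<rparr>)"
  by (simp add: load_def charge_def State_Monad.update_def)

lemma stored_value_store:
  "stored_value (snd (run_state (store a v) m)) b = (if b = a then v else stored_value m b)"
  by (simp add: store_def charge_def State_Monad.update_def stored_value_def update_conv' Let_def)

lemma run_times_one_minus_q2:
  "fst (run_state (times_one_minus_q2 arr i) m)
     = stored_value m (arr i) - (if i < 6 then 0 else stored_value m (arr (i - 2)))"
  "stored_value (snd (run_state (times_one_minus_q2 arr i) m)) b = stored_value m b"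
  by (auto simp: times_one_minus_q2_def run_op1 run_load)

lemma run_series_loop:
  fixes arr B :: "nat \<Rightarrow> address" and d :: nat
  defines "loop \<equiv> \<lambda>is. for_each is (\<lambda>i. do { v \<leftarrow> times_one_minus_q2 arr (i + d); store (B i) v })"
  assumes B: "inj B" and disj: "\<And>i j. B i \<noteq> arr j"
  shows "a \<notin> B ` set is \<Longrightarrow> stored_value (snd (run_state (loop is) m)) a = stored_value m a"
    and "i \<in> set is \<Longrightarrow> stored_value (snd (run_state (loop is) m)) (B i)
           = fst (run_state (times_one_minus_q2 arr (i + d)) m)"
proof (induction "is" arbitrary: a m)
  case (Cons j "is")
  define step where "step = (\<lambda>m. snd (run_state
      (do { v \<leftarrow> times_one_minus_q2 arr (j + d); store (B j) v }) m))"
  have loop: "snd (run_state (loop (j # is)) m) = snd (run_state (loop is) (step m))" for m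
    by (simp add: loop_def step_def case_prod_unfold)
  have step: "stored_value (step m) b =
      (if b = B j then fst (run_state (times_one_minus_q2 arr (j + d)) m) else stored_value m b)"
    for m b
    by (simp add: step_def stored_value_store run_times_one_minus_q2(2) case_prod_unfold)
  {
    case (1 a m)
    then show ?case using Cons.IH(1)[of _ "step m"] by (simp add: loop step)
  next
    case (2 m)
    show ?case
    proof (cases "i \<in> set is")
      case True
      then show ?thesis
        using Cons.IH(2)[of "step m"] disj
        by (simp add: loop run_times_one_minus_q2 step disj[symmetric])
    next
      case False
      then have "i = j" "B i \<notin> B ` set is" using 2 B by (auto dest: injD)
      then show ?thesis using Cons.IH(1)[of "B i" "step m"] by (simp add: loop step)
    qed
  }
qed (simp_all add: loop_def)

lemma run_traverse_load:
  "fst (run_state (State_Monad.traverse_list (\<lambda>k. load (B k)) ks) m)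
     = map (\<lambda>k. stored_value m (B k)) ks"
proof (induction ks arbitrary: m)
  case (Cons k ks)
  show ?case
    using Cons.IH[of "m\<lparr>operations := operations m + 1\<rparr>"]
    by (simp add: run_load case_prod_unfold)
qed simp

text \<open>The list returned is the list of the coefficients of \<open>((1 - q\<^sup>2) / q\<^sup>2)\<^sup>2 H(q)\<close>.\<close>

lemma sphere_series_eq:
  fixes m :: machine
  defines "Hq \<equiv> Abs_fps (\<lambda>i. if 4 \<le> i then rat_of_int (stored_value m (H i)) else 0)"
  shows "map rat_of_int (fst (run_state (sphere_series n) m))
    = map (\<lambda>k. fls_nth (((1 - fls_X ^ 2) / fls_X ^ 2) ^ 2 * fps_to_fls Hq) (int k)) [0..<n + 1]"
proof -
  have fls: "fls_nth (((1 - fls_X ^ 2) / fls_X ^ 2) ^ 2 * fps_to_fls A) (int k)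
    = A $ (k + 4) - 2 * A $ (k + 2) + A $ k" for A :: "rat fps" and k
  proof -
    define Y where "Y = fps_to_fls A"
    define Z where "Z = ((1 - fls_X ^ 2) / fls_X ^ 2) ^ 2 * Y"
    have "u * u * (((1 - u) / u) ^ 2 * y) = y - u * y - u * y + u * u * y"
      if "u \<noteq> 0" for u y :: "rat fls"
      using that by (simp add: field_simps power2_eq_square)
    from this[of "fls_X ^ 2" Y]
    have "fls_X ^ 4 * Z = Y - fls_X ^ 2 * Y - fls_X ^ 2 * Y + fls_X ^ 4 * Y"
      by (simp add: Z_def flip: power_add)
    then have "fls_nth (fls_X ^ 4 * Z) (int k + 4)
        = fls_nth (Y - fls_X ^ 2 * Y - fls_X ^ 2 * Y + fls_X ^ 4 * Y) (int k + 4)"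
      by simp
    then have "fls_nth Z (int k) = A $ (k + 4) - 2 * A $ (k + 2) + A $ k"
      by (simp add: fls_X_power_times_conv_shift Y_def nat_add_distrib)
    then show ?thesis unfolding Z_def Y_def .
  qed
  define m1 where "m1 = snd (run_state (for_each [4..<n + 5] (\<lambda>i. do {
      v \<leftarrow> times_one_minus_q2 H (i + 0); store (G i) v })) m)"
  define m2 where "m2 = snd (run_state (for_each [0..<n + 1] (\<lambda>i. do {
      v \<leftarrow> times_one_minus_q2 G (i + 4); store (F i) v })) m1)"
  have "fst (run_state (sphere_series n) m) = map (\<lambda>k. stored_value m2 (F k)) [0..<n + 1]"
    unfolding m1_def m2_def sphere_series_def
    by (simp add: run_traverse_load[symmetric] del: upt_Suc split: prod.splits)
  moreover have "rat_of_int (stored_value m2 (F k)) = Hq $ (k + 4) - 2 * Hq $ (k + 2) + Hq $ k"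
    if "k \<in> set [0..<n + 1]" for k
  proof -
    have 2: "stored_value m2 (F k) = stored_value m1 (G (k + 4))
        - (if k < 2 then 0 else stored_value m1 (G (k + 2)))"
      using run_series_loop(2)[of F G k "[0..<n + 1]" 4 m1] that
      by (simp add: m2_def run_times_one_minus_q2 inj_def del: upt_Suc)
    have 1: "stored_value m1 (G i) = stored_value m (H i)
        - (if i < 6 then 0 else stored_value m (H (i - 2)))" if "i \<in> set [4..<n + 5]" for i
      using run_series_loop(2)[of G H i "[4..<n + 5]" 0 m] that
      by (simp add: m1_def run_times_one_minus_q2 inj_def del: upt_Suc)
    show ?thesis using that
      by (auto simp: 2 1 Hq_def)
  qed
  ultimately show ?thesis unfolding fls by (simp del: upt_Suc)
qed

definition algorithm_B :: "nat \<Rightarrow> int list prog" where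
  "algorithm_B n = do {
     store (Totals 2 start_state start_state) 1;
     for_each [2..<n + 5] process_weight;
     sphere_series n }"

definition output_B :: "nat \<Rightarrow> int list" where
  "output_B n = fst (run_state (algorithm_B n) initial_machine)"

definition time_B :: "nat \<Rightarrow> nat" where
  "time_B n = operations (snd (run_state (algorithm_B n) initial_machine))"

definition space_B :: "nat \<Rightarrow> nat" where
  "space_B n = peak (snd (run_state (algorithm_B n) initial_machine))"

end

theory Submission
  imports Defs "HOL-Library.Stream"
begin

text \<open>
  The elements of \<open>F\<close> are drawn as pairs of pointed forests of binary trees with the same number of
  leaves (the forest diagrams of Belk and Brown). A forest stands for a two-sided infinite row of
  trees of which all but finitely many are trivial. The generator \<open>x\<^sub>0\<close> moves the pointer of the
  upper forest one tree to the right; \<open>x\<^sub>1\<close> joins the current tree with its right neighbour by a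
  caret. A caret with two leaves that is present at the same place in both forests can be removed;
  a pair without such carets is called reduced. Every gap between adjacent leaves carries one label
  from the upper and one from the lower forest, a column, and a column has a weight. The theorem
  rests on three facts.

  \<^item> Up to padding with trivial trees, every element is given by exactly one reduced pair. All
  elements are reached because the two relators imply the relations \<open>x\<^sub>j x\<^sub>i = x\<^sub>i x\<^sub>j\<^sub>+\<^sub>1\<close> for \<open>i < j\<close>
  (\<open>xgen_relation\<close>), which make the generators act on pairs as described. The pair is unique because
  \<open>F\<close> acts on a row of Cantor sets, and the pair can be read off from the action
  (\<open>reduced_pair_unique\<close>).

  \<^item> The geodesic length of an element is the sum of the weights of the columns of its reduced pair
  without the padding (\<open>geodesic_length_pair\<close>). This follows from Fordham's criterion: no generator
  raises this sum by more than one (\<open>letter_step\<close>), and for every element but the identity some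
  generator lowers it (\<open>decreasing_letter\<close>). Each generator or its inverse changes the upper label of
  a single gap or cancels a single column, so both claims are inspections of the table of weights.

  \<^item> A forest is the same as a walk through the states from the start state to the end state
  (\<open>bij_walk_of\<close>): the labels of the walk are the labels of the gaps, and the excess counts the
  nontrivial trees that have to be read before the rest of the current tree. Reducedness says that
  the two walks never create a common caret. Hence the counters of the algorithm count reduced pairs:
  the stored counters, each multiplied by the number of ways to complete its pair of walks to weight
  \<open>\<ell>\<close>, always add up to \<open>h\<^sub>\<ell>\<close> (\<open>process_weight_step\<close>).

  A padding column weighs 2 and may be repeated at either end, and the walks contain at least one
  such column at each end. So \<open>H(q) = (q\<^sup>2 / (1 - q\<^sup>2))\<^sup>2 F(q)\<close>, where \<open>F(q)\<close> counts the pairs without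
  padding and thus the elements by length; the algorithm ends by undoing this factor.

  As to the cost, a transition raises the weight by 1 to 4 and the excess by at most 1. At any time
  only counters of five consecutive weights are stored, and for weights up to \<open>n + 4\<close> their states have
  excess \<open>O(n)\<close>. So \<open>O(n\<^sup>2)\<close> coefficients are stored, and each weight takes a bounded number of
  operations for each of them.
\<close>

section \<open>Words modulo the relators\<close>

lemma word_eq_inv_word_right: "word_eq rels (w @ inv_word w) []"
proof -
  have "inv_word (inv_word w) = w" by (induction w) (auto simp: inv_word_def)
  then show ?thesis using word_eq_inv_word[of rels "inv_word w"] by simp
qed

lemma word_eq_inv_word_cong:
  assumes "word_eq rels u v"
  shows "word_eq rels (inv_word u) (inv_word v)"
proof -
  have "word_eq rels (inv_word u) (inv_word u @ v @ inv_word v)"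
    using word_eq.sym[OF word_eq_append_left[OF word_eq_inv_word_right[of rels v], of "inv_word u"]]
    by simp
  moreover have "word_eq rels (inv_word u @ v @ inv_word v) (inv_word u @ u @ inv_word v)"
    by (rule word_eq_append_left[OF word_eq_append_right[OF word_eq.sym[OF assms]]])
  moreover have "word_eq rels (inv_word u @ u @ inv_word v) (inv_word v)"
    using word_eq_append_right[OF word_eq_inv_word[of rels u], of "inv_word v"] by simp
  ultimately show ?thesis by (blast intro: word_eq.trans)
qed

text \<open>
  The group is written additively, although it is not commutative, to have the type class of
  groups and its rewrite rules at hand.
\<close>

quotient_type thompson = "generator word" / "word_eq thompson_relators"
  by (intro equivpI reflpI sympI transpI) (blast intro: word_eq.intros)+

instantiation thompson :: group_add
begin

lift_definition zero_thompson :: thompson is "[]" .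
lift_definition plus_thompson :: "thompson \<Rightarrow> thompson \<Rightarrow> thompson" is "(@)"
  by (rule word_eq_append)
lift_definition uminus_thompson :: "thompson \<Rightarrow> thompson" is inv_word
  by (rule word_eq_inv_word_cong)
definition minus_thompson :: "thompson \<Rightarrow> thompson \<Rightarrow> thompson" where
  "minus_thompson a b = a + - b"

instance
proof
  fix a b c :: thompson
  show "a + b + c = a + (b + c)" by transfer (simp add: word_eq.refl)
  show "0 + a = a" by transfer (simp add: word_eq.refl)
  show "a + 0 = a" by transfer (simp add: word_eq.refl)
  show "- a + a = 0" by transfer (rule word_eq_inv_word)
  show "a + - b = a - b" by (simp add: minus_thompson_def)
qed

end

lift_definition gen0 :: thompson is x0_word .
lift_definition gen1 :: thompson is x1_word .

text \<open>
  The generators of the infinite presentation of \<open>F\<close>; \<open>xgen n\<close> is usually called \<open>x\<^sub>n\<^sub>+\<^sub>1\<close>. If the trees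
  of a forest are numbered such that the current one is number 0, then \<open>xgen n\<close> joins the trees
  number \<open>n\<close> and \<open>n + 1\<close>.
\<close>

primrec xgen :: "nat \<Rightarrow> thompson" where
  "xgen 0 = gen1"
| "xgen (Suc n) = - gen0 + xgen n + gen0"

lemma relators_mem:
  "commutator_word (x0_word @ inv_word x1_word) (inv_word x0_word @ x1_word @ x0_word)
     \<in> thompson_relators"
  "commutator_word (x0_word @ inv_word x1_word)
     (inv_word (x0_word @ x0_word) @ x1_word @ x0_word @ x0_word) \<in> thompson_relators"
  by (simp_all add: thompson_relators_def Let_def)

lemma conjugate_eq: "a + b = b + c \<Longrightarrow> c = - b + a + b" for a :: "'a::group_add"
  by (simp add: add.assoc)

lemma commute_uminus: "a + b = b + a \<Longrightarrow> a + - b = - b + a" for a :: "'a::group_add"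
proof -
  assume "a + b = b + a"
  then have "- b + (a + b) + - b = - b + (b + a) + - b" by (rule arg_cong)
  then show ?thesis
    by (simp only: add.assoc minus_add_cancel add.right_inverse add_0_right)
qed

lemma commutator_relators:
  "(gen0 - gen1) + xgen 1 = xgen 1 + (gen0 - gen1)" "(gen0 - gen1) + xgen 2 = xgen 2 + (gen0 - gen1)"
proof -
  have eq: "a + b = b + a" if "a + b + - a + - b = 0" for a b :: thompson
  proof -
    have "a + b = (a + b + - a + - b) + (b + a)"
      by (simp only: add.assoc minus_add_cancel add.left_inverse add_0_right)
    with that show ?thesis by simp
  qed
  have "a + b + - a + - b = 0" if "a = gen0 - gen1" "b = xgen 1" for a b
    unfolding that diff_conv_add_uminus One_nat_def xgen.simps
    by transfer (use word_eq.relator[OF relators_mem(1), of "[]" "[]"] in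
        \<open>simp add: commutator_word_def inv_word_def\<close>)
  then show "(gen0 - gen1) + xgen 1 = xgen 1 + (gen0 - gen1)" using eq by blast
  have "a + b + - a + - b = 0" if "a = gen0 - gen1" "b = xgen 2" for a b
    unfolding that diff_conv_add_uminus numeral_2_eq_2 xgen.simps
    by transfer (use word_eq.relator[OF relators_mem(2), of "[]" "[]"] in
        \<open>simp add: commutator_word_def inv_word_def\<close>)
  then show "(gen0 - gen1) + xgen 2 = xgen 2 + (gen0 - gen1)" using eq by blast
qed

lemma xgen_gen1_iff: "xgen j + gen1 = gen1 + xgen (Suc j) \<longleftrightarrow> (gen0 - gen1) + xgen j = xgen j + (gen0 - gen1)"
proof -
  have "(gen0 - gen1) + xgen j = xgen j + (gen0 - gen1) \<longleftrightarrow> (gen1 - gen0) + ((gen0 - gen1) + xgen j) + gen1 = (gen1 - gen0) + (xgen j + (gen0 - gen1)) + gen1"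
    by simp
  also have "\<dots> \<longleftrightarrow> xgen j + gen1 = gen1 + xgen (Suc j)"
    by (simp add: add.assoc diff_conv_add_uminus del: add_uminus_conv_diff)
  finally show ?thesis ..
qed

lemma xgen_commute_step: "xgen i + xgen j = xgen j + xgen k \<Longrightarrow> xgen (Suc i) + xgen (Suc j) = xgen (Suc j) + xgen (Suc k)"
proof -
  assume "xgen i + xgen j = xgen j + xgen k"
  then have "- gen0 + (xgen i + xgen j) + gen0 = - gen0 + (xgen j + xgen k) + gen0" by simp
  then show ?thesis by (simp add: add.assoc diff_conv_add_uminus del: add_uminus_conv_diff)
qed

text \<open>
  For \<open>j = 1\<close> and \<open>j = 2\<close> these are the two relators. For larger \<open>j\<close> the relation for \<open>j - 2\<close>,
  conjugated by \<open>x\<^sub>0\<close>, exhibits \<open>xgen j\<close> as a conjugate of \<open>xgen (j - 1)\<close> by \<open>xgen 1\<close>, and both of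
  these commute with \<open>x\<^sub>0 x\<^sub>1\<^sup>-\<^sup>1\<close> by induction.
\<close>

lemma xgen_commutes: "1 \<le> j \<Longrightarrow> (gen0 - gen1) + xgen j = xgen j + (gen0 - gen1)"
proof (induction j rule: less_induct)
  case (less j)
  define A where "A = gen0 - gen1"
  consider "j = 1" | "j = 2" | k where "j = Suc (Suc k)" "1 \<le> k"
    using less.prems by (metis One_nat_def Suc_1 less_eq_Suc_le not0_implies_Suc not_less_eq_eq zero_less_iff_neq_zero le_zero_eq)
  then show ?case
  proof cases
    case 3
    have "xgen k + gen1 = gen1 + xgen (Suc k)" using less.IH[of k] 3 by (simp add: xgen_gen1_iff del: xgen.simps)
    then have "xgen k + xgen 0 = xgen 0 + xgen (Suc k)" by simp
    from xgen_commute_step[OF this] have "xgen (Suc k) + xgen 1 = xgen 1 + xgen j" using 3 by simp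
    then have Xj: "xgen j = - xgen 1 + xgen (Suc k) + xgen 1" by (rule conjugate_eq)
    have A1: "A + xgen 1 = xgen 1 + A" and Ak: "A + xgen (Suc k) = xgen (Suc k) + A"
      using commutator_relators(1) less.IH[of "Suc k"] 3 by (simp_all add: A_def)
    have A1': "A + - xgen 1 = - xgen 1 + A" using A1 by (rule commute_uminus)
    have "A + xgen j = (A + - xgen 1) + xgen (Suc k) + xgen 1" unfolding Xj by (simp only: add.assoc)
    also have "\<dots> = - xgen 1 + (A + xgen (Suc k)) + xgen 1" unfolding A1' by (simp only: add.assoc)
    also have "\<dots> = - xgen 1 + xgen (Suc k) + (A + xgen 1)" unfolding Ak by (simp only: add.assoc)
    also have "\<dots> = xgen j + A" unfolding A1 Xj by (simp only: add.assoc)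
    finally show ?thesis by (simp add: A_def)
  qed (use commutator_relators in simp_all)
qed

lemma xgen_relation: "i < j \<Longrightarrow> xgen j + xgen i = xgen i + xgen (Suc j)"
proof (induction i arbitrary: j)
  case 0
  then show ?case using xgen_gen1_iff[of j] xgen_commutes[of j] by (simp del: xgen.simps(2))
next
  case (Suc i)
  then obtain j' where "j = Suc j'" "i < j'" by (cases j) auto
  then show ?case using xgen_commute_step[OF Suc.IH[of j']] by (simp del: xgen.simps)
qed

section \<open>Forests and the elements that build them\<close>

datatype tree = Lf | Nd tree tree

text \<open>
  The gaps between the leaves of a tree correspond to its carets in symmetric order. The label says
  whether the right child of the caret is a leaf. The left child is a leaf unless the preceding
  gap belongs to it, and then that gap has the label \<open>I\<close>.
\<close>

fun gaps :: "tree \<Rightarrow> label list" where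
  "gaps Lf = []"
| "gaps (Nd a b) = gaps a @ (if b = Lf then LabI else LabN) # gaps b"

abbreviation leaves :: "tree \<Rightarrow> nat" where "leaves t \<equiv> Suc (length (gaps t))"

text \<open>
  The trees to the left of the pointer, the current tree, and the trees to its right, the lists in
  the order from left to right.
\<close>

type_synonym forest = "tree list \<times> tree \<times> tree list"

primrec left_gaps :: "tree list \<Rightarrow> label list" where
  "left_gaps [] = []"
| "left_gaps (t # ts) = gaps t @ LabL # left_gaps ts"

primrec right_gaps :: "tree list \<Rightarrow> label list" where
  "right_gaps [] = []"
| "right_gaps (t # ts) = (if t = Lf then LabR else LabX) # gaps t @ right_gaps ts"

fun gap_labels :: "forest \<Rightarrow> label list" where
  "gap_labels (ls, t, rs) = left_gaps ls @ gaps t @ right_gaps rs"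

lemma length_right_gaps: "length (right_gaps ts) = length (left_gaps ts)"
  by (induction ts) auto

lemma left_gaps_append: "left_gaps (xs @ ys) = left_gaps xs @ left_gaps ys"
  by (induction xs) auto

lemma right_gaps_append: "right_gaps (xs @ ys) = right_gaps xs @ right_gaps ys"
  by (induction xs) auto

text \<open>
  A product acts on forests factor by factor from right to left. The element \<open>tree_elt n t\<close> builds
  \<open>t\<close> from trivial trees, the first of which is number \<open>n\<close>. The left subtree is built first and is
  then a single tree, so the right subtree is built at number \<open>Suc n\<close>.
\<close>

fun tree_elt :: "nat \<Rightarrow> tree \<Rightarrow> thompson" where
  "tree_elt n Lf = 0"
| "tree_elt n (Nd a b) = xgen n + tree_elt (Suc n) b + tree_elt n a"

fun trees_elt :: "nat \<Rightarrow> tree list \<Rightarrow> thompson" where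
  "trees_elt n [] = 0"
| "trees_elt n (t # ts) = trees_elt (Suc n) ts + tree_elt n t"

primrec gen0_pow :: "nat \<Rightarrow> thompson" where
  "gen0_pow 0 = 0"
| "gen0_pow (Suc n) = gen0 + gen0_pow n"

fun forest_elt :: "forest \<Rightarrow> thompson" where
  "forest_elt (ls, t, rs) = gen0_pow (length ls) + trees_elt 0 (ls @ t # rs)"

text \<open>
  The lower forest is taken down to a trivial one, from which the upper forest is built.
\<close>

fun pair_elt :: "forest \<times> forest \<Rightarrow> thompson" where
  "pair_elt (P, Q) = forest_elt P - forest_elt Q"

lemma gen0_pow_commute: "gen0_pow n + gen0 = gen0 + gen0_pow n"
  by (induction n) (simp_all add: add.assoc)

lemma conj_add: "- g + (a + b) + g = (- g + a + g) + (- g + b + g)" for g :: "'a::group_add"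
  by (simp add: add.assoc)

lemma tree_elt_Suc: "tree_elt (Suc n) t = - gen0 + tree_elt n t + gen0"
  by (induction n t rule: tree_elt.induct) (simp_all add: conj_add)

lemma trees_elt_Suc: "trees_elt (Suc n) ts = - gen0 + trees_elt n ts + gen0"
  by (induction n ts rule: trees_elt.induct) (simp_all add: conj_add tree_elt_Suc)

lemma tree_elt_xgen: "i < n \<Longrightarrow> tree_elt n t + xgen i = xgen i + tree_elt (Suc n) t"
proof (induction n t rule: tree_elt.induct)
  case (2 n a b)
  have a: "tree_elt n a + xgen i = xgen i + tree_elt (Suc n) a"
    and b: "tree_elt (Suc n) b + xgen i = xgen i + tree_elt (Suc (Suc n)) b"
    using 2 by auto
  have "tree_elt n (Nd a b) + xgen i = xgen n + tree_elt (Suc n) b + (tree_elt n a + xgen i)"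
    by (simp only: tree_elt.simps add.assoc)
  also have "\<dots> = xgen n + (tree_elt (Suc n) b + xgen i) + tree_elt (Suc n) a"
    unfolding a by (simp only: add.assoc)
  also have "\<dots> = (xgen n + xgen i) + tree_elt (Suc (Suc n)) b + tree_elt (Suc n) a"
    unfolding b by (simp only: add.assoc)
  also have "\<dots> = xgen i + tree_elt (Suc n) (Nd a b)"
    unfolding xgen_relation[OF "2.prems"] by (simp only: add.assoc tree_elt.simps)
  finally show ?case .
qed simp

lemma trees_elt_xgen: "i < n \<Longrightarrow> trees_elt n ts + xgen i = xgen i + trees_elt (Suc n) ts"
proof (induction n ts rule: trees_elt.induct)
  case (2 n t ts)
  then show ?case using tree_elt_xgen[OF "2.prems"]
    by (simp del: xgen.simps add: add.assoc) (simp del: xgen.simps add: add.assoc[symmetric])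
qed simp

text \<open>
  By the time that \<open>t\<close> is built it has turned \<open>leaves t\<close> trees into one, so that the tree now at
  number \<open>m\<close> used to be at number \<open>m + length (gaps t)\<close>.
\<close>

lemma xgen_tree_elt: "n < m \<Longrightarrow> xgen m + tree_elt n t = tree_elt n t + xgen (m + length (gaps t))"
proof (induction n t arbitrary: m rule: tree_elt.induct)
  case (2 n a b)
  have b: "xgen (Suc m) + tree_elt (Suc n) b = tree_elt (Suc n) b + xgen (Suc m + length (gaps b))"
    by (rule "2.IH"(1)) (use "2.prems" in simp)
  have a: "xgen (Suc m + length (gaps b)) + tree_elt n a
      = tree_elt n a + xgen (Suc m + length (gaps b) + length (gaps a))"
    by (rule "2.IH"(2)) (use "2.prems" in simp)
  have "xgen m + tree_elt n (Nd a b) = (xgen m + xgen n) + tree_elt (Suc n) b + tree_elt n a"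
    by (simp only: tree_elt.simps add.assoc)
  also have "\<dots> = xgen n + (xgen (Suc m) + tree_elt (Suc n) b) + tree_elt n a"
    unfolding xgen_relation[OF "2.prems"] by (simp only: add.assoc)
  also have "\<dots> = xgen n + tree_elt (Suc n) b + (xgen (Suc m + length (gaps b)) + tree_elt n a)"
    unfolding b by (simp only: add.assoc)
  also have "\<dots> = tree_elt n (Nd a b) + xgen (Suc m + length (gaps b) + length (gaps a))"
    unfolding a by (simp only: add.assoc tree_elt.simps)
  finally show ?case by (simp add: ac_simps del: xgen.simps)
qed simp

section \<open>Splitting a leaf\<close>

fun split_leaf :: "nat \<Rightarrow> tree \<Rightarrow> tree" where
  "split_leaf i Lf = Nd Lf Lf"
| "split_leaf i (Nd a b) = (if i < leaves a then Nd (split_leaf i a) b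
     else Nd a (split_leaf (i - leaves a) b))"

fun split_trees :: "nat \<Rightarrow> tree list \<Rightarrow> tree list" where
  "split_trees i [] = []"
| "split_trees i (t # ts) = (if i < leaves t then split_leaf i t # ts
     else t # split_trees (i - leaves t) ts)"

fun split_forest :: "nat \<Rightarrow> forest \<Rightarrow> forest" where
  "split_forest i (ls, t, rs) =
     (if i < length (left_gaps ls) then (split_trees i ls, t, rs)
      else let j = i - length (left_gaps ls)
           in if j < leaves t then (ls, split_leaf j t, rs)
              else (ls, t, split_trees (j - leaves t) rs))"

lemma tree_elt_split:
  "i < leaves t \<Longrightarrow> tree_elt n (split_leaf i t) = tree_elt n t + xgen (n + i)"
proof (induction n t arbitrary: i rule: tree_elt.induct)
  case (2 n a b)
  show ?case
  proof (cases "i < leaves a")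
    case True
    then show ?thesis using "2.IH"(2)[of i] by (simp add: add.assoc del: xgen.simps)
  next
    case False
    define m where "m = Suc n + (i - leaves a)"
    have b: "tree_elt (Suc n) (split_leaf (i - leaves a) b) = tree_elt (Suc n) b + xgen m"
      using "2.IH"(1)[of "i - leaves a"] 2(3) False by (simp add: m_def del: xgen.simps)
    have "n < m" "m + length (gaps a) = n + i" using False by (auto simp: m_def)
    then have "xgen m + tree_elt n a = tree_elt n a + xgen (n + i)" using xgen_tree_elt by metis
    then have "xgen n + (tree_elt (Suc n) b + xgen m) + tree_elt n a = tree_elt n (Nd a b) + xgen (n + i)"
      by (simp only: add.assoc tree_elt.simps)
    with b False show ?thesis by simp
  qed
qed simp

lemma trees_elt_split:
  "i < length (left_gaps ts) \<Longrightarrow> trees_elt n (split_trees i ts) = trees_elt n ts + xgen (n + i)"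
proof (induction n ts arbitrary: i rule: trees_elt.induct)
  case (2 n t ts)
  show ?case
  proof (cases "i < leaves t")
    case True
    then show ?thesis by (simp add: add.assoc tree_elt_split del: xgen.simps)
  next
    case False
    define m where "m = Suc n + (i - leaves t)"
    have b: "trees_elt (Suc n) (split_trees (i - leaves t) ts) = trees_elt (Suc n) ts + xgen m"
      using "2.IH"[of "i - leaves t"] 2(2) False by (simp add: m_def del: xgen.simps)
    have "n < m" "m + length (gaps t) = n + i" using False by (auto simp: m_def)
    then have "xgen m + tree_elt n t = tree_elt n t + xgen (n + i)" using xgen_tree_elt by metis
    then have "(trees_elt (Suc n) ts + xgen m) + tree_elt n t = trees_elt n (t # ts) + xgen (n + i)"
      by (simp only: add.assoc trees_elt.simps)
    with b False show ?thesis by simp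
  qed
qed simp

lemma split_trees_append:
  "split_trees i (xs @ ys) = (if i < length (left_gaps xs) then split_trees i xs @ ys
     else xs @ split_trees (i - length (left_gaps xs)) ys)"
  by (induction xs arbitrary: i) auto

text \<open>
  The new caret is built before all others. In particular splitting the same leaf of both forests
  does not change the element of a pair.
\<close>

lemma forest_elt_split:
  assumes "i \<le> length (gap_labels P)"
  shows "forest_elt (split_forest i P) = forest_elt P + xgen i"
proof -
  obtain ls t rs where P: "P = (ls, t, rs)" by (cases P)
  obtain ls' t' rs' where P': "split_forest i P = (ls', t', rs')" by (cases "split_forest i P")
  have len: "length (split_trees j ts) = length ts" for j ts
    by (induction ts arbitrary: j) auto
  have *: "length ls' = length ls" "ls' @ t' # rs' = split_trees i (ls @ t # rs)"
    using P' by (auto simp: P split_trees_append Let_def len split: if_splits)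
  have "trees_elt 0 (split_trees i (ls @ t # rs)) = trees_elt 0 (ls @ t # rs) + xgen i"
    using assms trees_elt_split[of i "ls @ t # rs" 0]
    by (simp add: P left_gaps_append length_right_gaps)
  then show ?thesis using P' * by (simp add: P add.assoc)
qed

text \<open>
  How the label of a gap changes when the tree immediately to its right, so far a leaf, gets a caret.
\<close>

definition promote :: "label \<Rightarrow> label" where
  "promote l = (case l of LabI \<Rightarrow> LabN | LabR \<Rightarrow> LabX | _ \<Rightarrow> l)"

definition promote_last :: "label list \<Rightarrow> label list" where
  "promote_last u = (if u = [] then [] else butlast u @ [promote (last u)])"

definition insert_caret :: "nat \<Rightarrow> label list \<Rightarrow> label list" where
  "insert_caret i u = promote_last (take i u) @ LabI # drop i u"

lemma promote_last_append [simp]: "v \<noteq> [] \<Longrightarrow> promote_last (u @ v) = u @ promote_last v"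
  by (simp add: promote_last_def butlast_append)

lemma promote_last_single [simp]: "promote_last [x] = [promote x]" "promote_last [] = []"
  by (simp_all add: promote_last_def)

lemma promote_last_Cons [simp]: "v \<noteq> [] \<Longrightarrow> promote_last (x # v) = x # promote_last v"
  using promote_last_append[of v "[x]"] by simp

lemma promote_simps [simp]:
  "promote LabI = LabN" "promote LabN = LabN" "promote LabL = LabL" "promote LabR = LabX"
  "promote LabX = LabX"
  by (simp_all add: promote_def)

lemma insert_caret_append1: "i \<le> length u \<Longrightarrow> insert_caret i (u @ v) = insert_caret i u @ v"
  by (simp add: insert_caret_def)

lemma insert_caret_append2:
  "length u < i \<Longrightarrow> i \<le> length u + length v \<Longrightarrow> insert_caret i (u @ v) = u @ insert_caret (i - length u) v"
  by (cases "take (i - length u) v = []") (auto simp: insert_caret_def)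

lemma length_insert_caret [simp]: "length (insert_caret i u) = Suc (length u)"
  by (auto simp: insert_caret_def promote_last_def min_def)

lemma split_leaf_neq_Lf [simp]: "split_leaf i t \<noteq> Lf" "Lf \<noteq> split_leaf i t"
  by (cases t; simp)+

lemma gaps_split_leaf: "i < leaves t \<Longrightarrow> gaps (split_leaf i t) = insert_caret i (gaps t)"
proof (induction t arbitrary: i)
  case Lf
  then show ?case by (simp add: insert_caret_def)
next
  case (Nd a b)
  show ?case
  proof (cases "i < leaves a")
    case True
    then show ?thesis using Nd by (simp add: insert_caret_append1)
  next
    case False
    then obtain j where j: "i = leaves a + j" using le_Suc_ex linorder_not_less by blast
    have b: "gaps (split_leaf j b) = insert_caret j (gaps b)" using Nd j by simp
    have "insert_caret i (gaps (Nd a b)) = gaps a @ insert_caret (Suc j) ((if b = Lf then LabI else LabN) # gaps b)"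
      using Nd.prems j by (simp add: insert_caret_append2)
    also have "insert_caret (Suc j) ((if b = Lf then LabI else LabN) # gaps b) = LabN # insert_caret j (gaps b)"
      by (cases "take j (gaps b) = []") (auto simp: insert_caret_def)
    finally show ?thesis using b j by simp
  qed
qed

lemma left_gaps_split:
  "i < length (left_gaps ts) \<Longrightarrow> left_gaps (split_trees i ts) = insert_caret i (left_gaps ts)"
proof (induction ts arbitrary: i)
  case (Cons t ts)
  show ?case
  proof (cases "i < leaves t")
    case True
    then show ?thesis by (simp add: gaps_split_leaf insert_caret_append1)
  next
    case False
    then obtain j where j: "i = leaves t + j" using le_Suc_ex linorder_not_less by blast
    then have b: "left_gaps (split_trees j ts) = insert_caret j (left_gaps ts)" using Cons by simp
    have "insert_caret i (left_gaps (t # ts)) = gaps t @ insert_caret (Suc j) (LabL # left_gaps ts)"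
      using Cons.prems j by (simp add: insert_caret_append2)
    also have "insert_caret (Suc j) (LabL # left_gaps ts) = LabL # insert_caret j (left_gaps ts)"
      by (cases "take j (left_gaps ts) = []") (auto simp: insert_caret_def)
    finally show ?thesis using b j by simp
  qed
qed simp

lemma right_gaps_split:
  "i < length (right_gaps ts) \<Longrightarrow> right_gaps (split_trees i ts) = insert_caret (Suc i) (right_gaps ts)"
proof (induction ts arbitrary: i)
  case (Cons t ts)
  show ?case
  proof (cases "i < leaves t")
    case True
    have "insert_caret (Suc i) (right_gaps (t # ts)) = insert_caret (Suc i) ((if t = Lf then LabR else LabX) # gaps t) @ right_gaps ts"
      using True insert_caret_append1[of "Suc i" "(if t = Lf then LabR else LabX) # gaps t" "right_gaps ts"]
      by simp
    also have "insert_caret (Suc i) ((if t = Lf then LabR else LabX) # gaps t) = LabX # insert_caret i (gaps t)"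
      by (cases "take i (gaps t) = []") (auto simp: insert_caret_def)
    finally show ?thesis using True by (simp add: gaps_split_leaf)
  next
    case False
    then obtain j where j: "i = leaves t + j" using le_Suc_ex linorder_not_less by blast
    then have b: "right_gaps (split_trees j ts) = insert_caret (Suc j) (right_gaps ts)"
      using Cons by simp
    have "insert_caret (Suc i) (right_gaps (t # ts))
        = ((if t = Lf then LabR else LabX) # gaps t) @ insert_caret (Suc j) (right_gaps ts)"
      using Cons.prems j insert_caret_append2[of "(if t = Lf then LabR else LabX) # gaps t" "Suc i" "right_gaps ts"]
      by simp
    then show ?thesis using b j by simp
  qed
qed simp

lemma left_gaps_eq_Nil [simp]: "left_gaps ls = [] \<longleftrightarrow> ls = []"
  by (cases ls) auto

lemma last_left_gaps: "ls \<noteq> [] \<Longrightarrow> last (left_gaps ls) = LabL"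
proof (induction ls)
  case (Cons t ls)
  then show ?case by (cases "ls = []") auto
qed simp

lemma promote_last_left_gaps [simp]: "promote_last (left_gaps ls) = left_gaps ls"
proof (cases "ls = []")
  case False
  then show ?thesis
    using append_butlast_last_id[of "left_gaps ls"] by (simp add: promote_last_def last_left_gaps)
qed simp

lemma insert_caret_0: "insert_caret 0 u = LabI # u"
  by (simp add: insert_caret_def)

lemma gap_labels_split: "i \<le> length (gap_labels P) \<Longrightarrow> gap_labels (split_forest i P) = insert_caret i (gap_labels P)"
proof -
  assume i: "i \<le> length (gap_labels P)"
  obtain ls t rs where P: "P = (ls, t, rs)" by (cases P)
  consider "i < length (left_gaps ls)" | "i = length (left_gaps ls)"
    | "length (left_gaps ls) < i" "i \<le> length (left_gaps ls) + length (gaps t)"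
    | k where "i = length (left_gaps ls) + leaves t + k"
    using le_Suc_ex by (metis linorder_neqE_nat linorder_not_le not_less_eq_eq add_Suc_right)
  then show ?thesis
  proof cases
    case 1
    then show ?thesis by (simp add: P left_gaps_split insert_caret_append1)
  next
    case 2
    then show ?thesis by (simp add: P Let_def gaps_split_leaf insert_caret_0) (simp add: insert_caret_def)
  next
    case 3
    then have "i - length (left_gaps ls) < leaves t" by auto
    with 3 show ?thesis
      by (simp add: P Let_def gaps_split_leaf insert_caret_append2 insert_caret_append1)
  next
    case 4
    then have k: "k < length (right_gaps rs)" using i by (simp add: P)
    then have "insert_caret i (left_gaps ls @ gaps t @ right_gaps rs) =
       (left_gaps ls @ gaps t) @ insert_caret (Suc k) (right_gaps rs)"
      using 4 insert_caret_append2[of "left_gaps ls @ gaps t" i "right_gaps rs"] by simp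
    then show ?thesis using 4 k by (simp add: P Let_def right_gaps_split)
  qed
qed

section \<open>Undoing a split\<close>

lemma append_eq_append_Cons_iff:
  "xs @ ys = u @ c # v \<longleftrightarrow>
     (\<exists>w. xs = u @ c # w \<and> v = w @ ys) \<or> (\<exists>w. u = xs @ w \<and> ys = w @ c # v)"
  by (auto simp: append_eq_append_conv2 append_eq_Cons_conv Cons_eq_append_conv)

lemma last_gaps: "t \<noteq> Lf \<Longrightarrow> last (gaps t) = LabI \<and> gaps t \<noteq> []"
  by (induction t) auto

lemma tree_unsplit:
  "gaps t = u @ LabI # v \<Longrightarrow> u = [] \<or> last u \<noteq> LabI \<Longrightarrow>
     \<exists>t'. t = split_leaf (length u) t' \<and> length u < leaves t'"
proof (induction t arbitrary: u v)
  case (Nd a b)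
  let ?l = "if b = Lf then LabI else LabN"
  from Nd.prems(1) consider w where "gaps a = u @ LabI # w" "v = w @ ?l # gaps b"
    | "u = gaps a" "b = Lf" "v = []"
    | w where "u = gaps a @ ?l # w" "gaps b = w @ LabI # v"
    by (auto simp: append_eq_append_Cons_iff Cons_eq_append_conv split: if_splits)
  then show ?case
  proof cases
    case 1
    with Nd.IH(1)[OF 1(1) Nd.prems(2)] obtain a' where "a = split_leaf (length u) a'" "length u < leaves a'"
      by blast
    then have "Nd a b = split_leaf (length u) (Nd a' b)" "length u < leaves (Nd a' b)" by simp_all
    then show ?thesis by blast
  next
    case 2
    then have "a = Lf" using Nd.prems(2) last_gaps by metis
    then have "Nd a b = split_leaf (length u) Lf" "length u < leaves Lf" using 2 by simp_all
    then show ?thesis by blast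
  next
    case 3
    have "w = [] \<or> last w \<noteq> LabI" using Nd.prems(2) 3 by auto
    with Nd.IH(2)[OF 3(2)] obtain b' where "b = split_leaf (length w) b'" "length w < leaves b'"
      by blast
    then have "Nd a b = split_leaf (length u) (Nd a b')" "length u < leaves (Nd a b')"
      using 3 by simp_all
    then show ?thesis by blast
  qed
qed simp

lemma left_unsplit:
  "left_gaps ts = u @ LabI # v \<Longrightarrow> u = [] \<or> last u \<noteq> LabI \<Longrightarrow>
     \<exists>ts'. ts = split_trees (length u) ts' \<and> length u < length (left_gaps ts')"
proof (induction ts arbitrary: u v)
  case (Cons t ts)
  from Cons.prems(1) consider w where "gaps t = u @ LabI # w"
    | w where "u = gaps t @ LabL # w" "left_gaps ts = w @ LabI # v"
    by (auto simp: append_eq_append_Cons_iff Cons_eq_append_conv)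
  then show ?case
  proof cases
    case 1
    with tree_unsplit[OF 1 Cons.prems(2)] obtain t' where
      "t = split_leaf (length u) t'" "length u < leaves t'" by blast
    then have "t # ts = split_trees (length u) (t' # ts)" "length u < length (left_gaps (t' # ts))"
      by simp_all
    then show ?thesis by blast
  next
    case 2
    have "w = [] \<or> last w \<noteq> LabI" using Cons.prems(2) 2 by auto
    with Cons.IH[OF 2(2)] obtain ts' where
      "ts = split_trees (length w) ts'" "length w < length (left_gaps ts')" by blast
    then have "t # ts = split_trees (length u) (t # ts')" "length u < length (left_gaps (t # ts'))"
      using 2 by simp_all
    then show ?thesis by blast
  qed
qed simp

lemma right_unsplit:
  "right_gaps ts = u @ LabI # v \<Longrightarrow> last u \<noteq> LabI \<Longrightarrow>
     \<exists>ts' k. length u = Suc k \<and> ts = split_trees k ts' \<and> k < length (left_gaps ts')"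
proof (induction ts arbitrary: u v)
  case (Cons t ts)
  let ?l = "if t = Lf then LabR else LabX"
  from Cons.prems(1) obtain u' where u: "u = ?l # u'" "gaps t @ right_gaps ts = u' @ LabI # v"
    by (cases u) (auto split: if_splits)
  then consider w where "gaps t = u' @ LabI # w"
    | w where "u' = gaps t @ w" "right_gaps ts = w @ LabI # v"
    by (auto simp: append_eq_append_Cons_iff)
  then show ?case
  proof cases
    case 1
    have "u' = [] \<or> last u' \<noteq> LabI" using Cons.prems(2) u by auto
    with tree_unsplit[OF 1] obtain t' where
      "t = split_leaf (length u') t'" "length u' < leaves t'" by blast
    then have "t # ts = split_trees (length u') (t' # ts)" "length u' < length (left_gaps (t' # ts))"
      by simp_all
    then show ?thesis using u by (metis length_Cons)
  next
    case 2
    then have "w \<noteq> []" by (cases ts) (auto split: if_splits)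
    then have "last w \<noteq> LabI" using Cons.prems(2) u 2 by auto
    with Cons.IH[OF 2(2)] obtain ts' k where
      k: "length w = Suc k" "ts = split_trees k ts'" "k < length (left_gaps ts')" by blast
    then have "t # ts = split_trees (leaves t + k) (t # ts')"
      "leaves t + k < length (left_gaps (t # ts'))" by simp_all
    moreover have "length u = Suc (leaves t + k)" using u 2 k by simp
    ultimately show ?thesis by blast
  qed
qed simp

text \<open>
  The caret of gap \<open>j\<close> has two leaves as its children.
\<close>

definition exposed :: "label list \<Rightarrow> nat \<Rightarrow> bool" where
  "exposed l j \<longleftrightarrow> (\<exists>u v. l = u @ LabI # v \<and> length u = j \<and> (u = [] \<or> last u \<noteq> LabI))"

lemma forest_unsplit:
  assumes "exposed (gap_labels P) j"
  shows "\<exists>P'. P = split_forest j P' \<and> j \<le> length (gap_labels P')"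
proof -
  obtain ls t rs where P: "P = (ls, t, rs)" by (cases P)
  obtain u v where u: "left_gaps ls @ gaps t @ right_gaps rs = u @ LabI # v" "length u = j"
    "u = [] \<or> last u \<noteq> LabI"
    using assms by (auto simp: exposed_def P)
  then consider w where "left_gaps ls = u @ LabI # w"
    | w z where "u = left_gaps ls @ w" "gaps t = w @ LabI # z"
    | w where "u = left_gaps ls @ gaps t @ w" "right_gaps rs = w @ LabI # v"
    by (auto simp: append_eq_append_Cons_iff)
  then show ?thesis
  proof cases
    case 1
    with left_unsplit[OF 1 u(3)] obtain ls' where
      "ls = split_trees j ls'" "j < length (left_gaps ls')" using u by blast
    then have "P = split_forest j (ls', t, rs)" "j \<le> length (gap_labels (ls', t, rs))" by (simp_all add: P)
    then show ?thesis by blast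
  next
    case 2
    have "w = [] \<or> last w \<noteq> LabI" using u 2 by auto
    with tree_unsplit[OF 2(2)] obtain t' where
      "t = split_leaf (length w) t'" "length w < leaves t'" by blast
    then have "P = split_forest j (ls, t', rs)" "j \<le> length (gap_labels (ls, t', rs))"
      using u 2 by (auto simp: P Let_def)
    then show ?thesis by blast
  next
    case 3
    then have "w \<noteq> []" by (cases rs) (auto split: if_splits)
    then have "last w \<noteq> LabI" using u 3 by auto
    with right_unsplit[OF 3(2)] obtain rs' k where
      k: "length w = Suc k" "rs = split_trees k rs'" "k < length (left_gaps rs')" by blast
    then have "P = split_forest j (ls, t, rs')" "j \<le> length (gap_labels (ls, t, rs'))"
      using u 3 by (auto simp: P Let_def length_right_gaps)
    then show ?thesis by blast
  qed
qed

section \<open>Padding, moving the pointer and joining trees\<close>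

fun pad_left :: "forest \<Rightarrow> forest" where "pad_left (ls, t, rs) = (Lf # ls, t, rs)"
fun pad_right :: "forest \<Rightarrow> forest" where "pad_right (ls, t, rs) = (ls, t, rs @ [Lf])"

lemma gap_labels_pad [simp]:
  "gap_labels (pad_left P) = LabL # gap_labels P" "gap_labels (pad_right P) = gap_labels P @ [LabR]"
  by (cases P; simp add: right_gaps_append)+

lemma trees_elt_snoc_Lf: "trees_elt n (ts @ [Lf]) = trees_elt n ts"
  by (induction n ts rule: trees_elt.induct) auto

lemma gen0_pow_conjugate: "gen0 + gen0_pow n + - gen0 = gen0_pow n"
  by (simp only: gen0_pow_commute[symmetric] add.assoc add.right_inverse add_0_right)

lemma forest_elt_pad:
  "forest_elt (pad_left P) = forest_elt P + gen0" "forest_elt (pad_right P) = forest_elt P"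
proof -
  obtain ls t rs where P: "P = (ls, t, rs)" by (cases P)
  show "forest_elt (pad_left P) = forest_elt P + gen0"
    using gen0_pow_conjugate[of "length ls"]
    by (simp add: P trees_elt_Suc add.assoc[symmetric])
  show "forest_elt (pad_right P) = forest_elt P"
    using trees_elt_snoc_Lf[of 0 "ls @ t # rs"] by (simp add: P)
qed

lemma pair_elt_pad:
  "pair_elt (pad_left P, pad_left Q) = pair_elt (P, Q)"
  "pair_elt (pad_right P, pad_right Q) = pair_elt (P, Q)"
  by (simp_all add: forest_elt_pad diff_conv_add_uminus minus_add add.assoc del: add_uminus_conv_diff)

lemma forest_elt_move: "forest_elt (ls @ [t], u, rs) = gen0 + forest_elt (ls, t, u # rs)"
proof -
  have "gen0_pow (length ls + 1) = gen0 + gen0_pow (length ls)" by simp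
  then show ?thesis by (simp add: add.assoc)
qed

lemma trees_elt_join:
  "trees_elt n (ls @ Nd t u # rs) = xgen (n + length ls) + trees_elt n (ls @ t # u # rs)"
proof (induction ls arbitrary: n)
  case Nil
  have "trees_elt (Suc n) rs + xgen n = xgen n + trees_elt (Suc (Suc n)) rs"
    by (rule trees_elt_xgen) simp
  then show ?case by (simp add: add.assoc[symmetric])
next
  case (Cons l ls)
  then show ?case by (simp add: add.assoc del: xgen.simps)
qed

lemma gen1_gen0_pow: "gen1 + gen0_pow n = gen0_pow n + xgen n"
proof (induction n)
  case (Suc n)
  have "gen0_pow (Suc n) + xgen (Suc n) = gen0 + gen0_pow n + - gen0 + xgen n + gen0"
    by (simp only: gen0_pow.simps xgen.simps add.assoc)
  also have "gen0 + gen0_pow n + - gen0 = gen0_pow n" by (rule gen0_pow_conjugate)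
  also have "gen0_pow n + xgen n + gen0 = gen1 + (gen0_pow n + gen0)"
    by (simp only: Suc[symmetric] add.assoc)
  finally show ?case by (simp add: gen0_pow_commute)
qed simp

lemma forest_elt_join: "forest_elt (ls, Nd t u, rs) = gen1 + forest_elt (ls, t, u # rs)"
  by (simp add: trees_elt_join add.assoc[symmetric] gen1_gen0_pow)

section \<open>An action that separates reduced pairs\<close>

type_synonym point = "int \<times> bool stream"

text \<open>
  There is one Cantor set for every integer. The generator \<open>x\<^sub>0\<close> shifts their row, and \<open>x\<^sub>1\<close> maps the two
  halves of number 0 onto numbers 0 and 1. A word acts letter by letter from the left, so here the
  leftmost factor of a product acts first.
\<close>

fun act_letter :: "generator \<times> bool \<Rightarrow> point \<Rightarrow> point" where
  "act_letter (x0, True) (k, s) = (k + 1, s)"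
| "act_letter (x0, False) (k, s) = (k - 1, s)"
| "act_letter (x1, True) (k, s) =
     (if k < 0 then (k, s) else if k = 0 then (if shd s then 1 else 0, stl s) else (k + 1, s))"
| "act_letter (x1, False) (k, s) =
     (if k < 0 then (k, s) else if k = 0 then (0, False ## s) else if k = 1 then (0, True ## s)
      else (k - 1, s))"

definition act_word :: "generator word \<Rightarrow> point \<Rightarrow> point" where
  "act_word w = fold act_letter w"

lemma act_word_simps [simp]:
  "act_word [] p = p" "act_word (x # w) p = act_word w (act_letter x p)"
  "act_word (u @ v) p = act_word v (act_word u p)"
  by (simp_all add: act_word_def)

lemma act_letter_cancel: "act_letter (x, \<not> e) (act_letter (x, e) p) = p"
  by (cases p; cases x; cases e) (auto split: if_splits simp: stream.expand)

lemma act_word_inv [simp]: "act_word (inv_word w) (act_word w p) = p"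
proof (induction w arbitrary: p)
  case (Cons a w)
  then show ?case by (cases a) (auto simp: inv_word_def act_letter_cancel)
qed (simp add: inv_word_def)

lemma act_word_commutator:
  assumes "\<And>p. act_word (u @ v) p = act_word (v @ u) p"
  shows "act_word (commutator_word u v) p = p"
proof -
  have "act_word (commutator_word u v) p = act_word (inv_word u @ inv_word v) (act_word (u @ v) p)"
    by (simp add: commutator_word_def)
  also have "\<dots> = p" unfolding assms by simp
  finally show ?thesis .
qed

lemma act_word_relator: "r \<in> thompson_relators \<Longrightarrow> act_word r p = p"
  unfolding thompson_relators_def Let_def
  by (elim insertE emptyE; hypsubst; rule act_word_commutator)
     (auto simp: inv_word_def)

lemma act_word_cong: "word_eq thompson_relators u v \<Longrightarrow> act_word u = act_word v"
  by (induction rule: word_eq.induct) (auto simp: fun_eq_iff act_letter_cancel act_word_relator)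

lift_definition act :: "thompson \<Rightarrow> point \<Rightarrow> point" is act_word
  by (rule act_word_cong)

lemma act_add [simp]: "act (a + b) p = act b (act a p)" by transfer simp
lemma act_0 [simp]: "act 0 p = p" by transfer simp
lemma act_uminus: "act (- a) (act a p) = p" by transfer simp
lemma act_gen0 [simp]: "act gen0 (k, s) = (k + 1, s)" by transfer simp
lemma act_uminus_gen0 [simp]: "act (- gen0) (k, s) = (k - 1, s)" by transfer (simp add: inv_word_def)

lemma act_xgen: "act (xgen n) (k, s) =
    (if k < int n then (k, s) else if k = int n then (if shd s then k + 1 else k, stl s) else (k + 1, s))"
proof (induction n arbitrary: k)
  case 0
  have "act gen1 (k, s) = act_letter (x1, True) (k, s)" by transfer simp
  then show ?case by auto
next
  case (Suc n)
  then show ?case by auto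
qed

fun paths :: "tree \<Rightarrow> bool list list" where
  "paths Lf = [[]]"
| "paths (Nd a b) = map ((#) False) (paths a) @ map ((#) True) (paths b)"

lemma length_paths [simp]: "length (paths t) = leaves t"
  by (induction t) auto

lemma act_tree_elt_outside:
  "k < int n \<Longrightarrow> act (tree_elt n t) (k, s) = (k, s)"
  "int n < k \<Longrightarrow> act (tree_elt n t) (k, s) = (k + int (length (gaps t)), s)"
proof (induction n t arbitrary: k and k rule: tree_elt.induct)
  case (2 n a b)
  {
    case 1
    then show ?case using 2 by (simp add: act_xgen)
  next
    case 2
    then show ?case using "2.IH"(2)[of "k + 1"] "2.IH"(4)[of "k + 1 + int (length (gaps b))"]
      by (simp add: act_xgen algebra_simps)
  }
qed simp_all

lemma act_tree_elt:
  "j < leaves t \<Longrightarrow> act (tree_elt n t) (int n, (paths t ! j) @- s) = (int n + int j, s)"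
proof (induction n t arbitrary: j rule: tree_elt.induct)
  case (2 n a b)
  show ?case
  proof (cases "j < leaves a")
    case True
    then show ?thesis using "2.IH"(2)[of j]
      by (simp add: nth_append act_xgen act_tree_elt_outside)
  next
    case False
    then obtain i where j: "j = leaves a + i" using le_Suc_ex linorder_not_less by blast
    then have "i < leaves b" using 2(3) by simp
    then show ?thesis using "2.IH"(1)[of i] j
      by (simp add: nth_append act_xgen act_tree_elt_outside algebra_simps)
  qed
qed simp

fun addr_list :: "int \<Rightarrow> tree list \<Rightarrow> (int \<times> bool list) list" where
  "addr_list k [] = []"
| "addr_list k (t # ts) = map (Pair k) (paths t) @ addr_list (k + 1) ts"

lemma length_addr_list [simp]: "length (addr_list k ts) = length (left_gaps ts)"
  by (induction k ts rule: addr_list.induct) auto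

fun extend :: "int \<times> bool list \<Rightarrow> bool stream \<Rightarrow> point" where
  "extend (k, p) s = (k, p @- s)"

lemma act_trees_elt_below: "k < int n \<Longrightarrow> act (trees_elt n ts) (k, s) = (k, s)"
  by (induction n ts rule: trees_elt.induct) (auto simp: act_tree_elt_outside)

lemma act_trees_elt:
  "j < length (left_gaps ts) \<Longrightarrow>
     act (trees_elt n ts) (extend (addr_list (int n) ts ! j) s) = (int n + int j, s)"
proof (induction n ts arbitrary: j rule: trees_elt.induct)
  case (2 n t ts)
  show ?case
  proof (cases "j < leaves t")
    case True
    then show ?thesis by (simp add: nth_append act_trees_elt_below act_tree_elt)
  next
    case False
    then obtain i where j: "j = leaves t + i" using le_Suc_ex linorder_not_less by blast
    then have "i < length (left_gaps ts)" using 2(2) by simp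
    then show ?thesis using 2(1)[of i] j
      by (simp add: nth_append act_tree_elt_outside algebra_simps)
  qed
qed simp

lemma addr_list_shift: "addr_list (k + d) ts = map (\<lambda>(i, p). (i + d, p)) (addr_list k ts)"
proof (induction ts arbitrary: k)
  case (Cons t ts)
  show ?case using Cons[of "k + 1"] by (simp add: algebra_simps)
qed simp

lemma act_gen0_pow [simp]: "act (gen0_pow n) (k, s) = (k + int n, s)"
  by (induction n arbitrary: k) (auto simp: algebra_simps)

fun addrs :: "forest \<Rightarrow> (int \<times> bool list) list" where
  "addrs (ls, t, rs) = addr_list (- int (length ls)) (ls @ t # rs)"

lemma length_addrs [simp]: "length (addrs P) = Suc (length (gap_labels P))"
  by (cases P) (simp add: left_gaps_append length_right_gaps)

lemma act_forest_elt:
  assumes "j \<le> length (gap_labels P)"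
  shows "act (forest_elt P) (extend (addrs P ! j) s) = (int j, s)"
proof -
  obtain ls t rs where P: "P = (ls, t, rs)" by (cases P)
  let ?ts = "ls @ t # rs"
  have j: "j < length (left_gaps ?ts)"
    using assms by (simp add: P left_gaps_append length_right_gaps)
  have "addr_list 0 ?ts ! j = (case addrs P ! j of (i, p) \<Rightarrow> (i + int (length ls), p))"
    using j addr_list_shift[of "- int (length ls)" "int (length ls)" ?ts] by (simp add: P)
  then have "act (gen0_pow (length ls)) (extend (addrs P ! j) s) = extend (addr_list 0 ?ts ! j) s"
    by (cases "addrs P ! j") simp
  then show ?thesis using act_trees_elt[OF j, of 0 s] by (simp add: P)
qed

text \<open>
  Each of the forests maps the set of sequences below its leaf \<open>j\<close> onto the Cantor set number \<open>j\<close>.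
\<close>

lemma act_pair_elt:
  assumes "length (gap_labels P) = length (gap_labels Q)" "j \<le> length (gap_labels P)"
  shows "act (pair_elt (P, Q)) (extend (addrs P ! j) s) = extend (addrs Q ! j) s"
proof -
  have "act (pair_elt (P, Q)) (extend (addrs P ! j) s) = act (- forest_elt Q) (int j, s)"
    using act_forest_elt[OF assms(2), of s]
    by (simp add: diff_conv_add_uminus del: add_uminus_conv_diff)
  also have "\<dots> = extend (addrs Q ! j) s"
    using act_forest_elt[of j Q s] act_uminus[of "forest_elt Q" "extend (addrs Q ! j) s"] assms by simp
  finally show ?thesis .
qed

text \<open>
  On the sequences below the \<open>j\<close>-th leaf of \<open>t\<close>, the function \<open>f\<close> replaces the path to this leaf by the
  \<open>j\<close>-th address in \<open>as\<close>.
\<close>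

definition describes :: "(bool stream \<Rightarrow> point) \<Rightarrow> tree \<Rightarrow> (int \<times> bool list) list \<Rightarrow> bool" where
  "describes f t as \<longleftrightarrow>
     length as = leaves t \<and> (\<forall>j<leaves t. \<forall>s. f ((paths t ! j) @- s) = extend (as ! j) s)"

definition siblings :: "int \<times> bool list \<Rightarrow> int \<times> bool list \<Rightarrow> bool" where
  "siblings a b \<longleftrightarrow> (\<exists>i p. a = (i, p @ [False]) \<and> b = (i, p @ [True]))"

text \<open>
  No caret with two leaves can be contracted: the addresses of its leaves are not siblings.
\<close>

fun reduced_tree :: "tree \<Rightarrow> (int \<times> bool list) list \<Rightarrow> bool" where
  "reduced_tree Lf as \<longleftrightarrow> True"
| "reduced_tree (Nd a b) as \<longleftrightarrow>
     reduced_tree a (take (leaves a) as) \<and> reduced_tree b (drop (leaves a) as) \<and>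
     \<not> (a = Lf \<and> b = Lf \<and> siblings (as ! 0) (as ! 1))"

lemma describes_Nd:
  assumes "describes f (Nd a b) as"
  shows "describes (\<lambda>s. f (False ## s)) a (take (leaves a) as)"
    "describes (\<lambda>s. f (True ## s)) b (drop (leaves a) as)"
proof -
  have len: "length as = leaves a + leaves b"
    and f: "\<And>j s. j < leaves (Nd a b) \<Longrightarrow> f ((paths (Nd a b) ! j) @- s) = extend (as ! j) s"
    using assms by (auto simp: describes_def)
  show "describes (\<lambda>s. f (False ## s)) a (take (leaves a) as)"
  proof -
    have "f (False ## (paths a ! j) @- s) = extend (as ! j) s" if "j < leaves a" for j s
      using f[of j s] that by (simp add: nth_append)
    then show ?thesis unfolding describes_def using len by auto
  qed
  have "f (True ## (paths b ! j) @- s) = extend (as ! (leaves a + j)) s" if "j < leaves b" for j s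
    using f[of "leaves a + j" s] that by (simp add: nth_append)
  then show "describes (\<lambda>s. f (True ## s)) b (drop (leaves a) as)"
    unfolding describes_def using len by auto
qed

lemma shift_eq_imp_eq: "(\<And>s. p @- s = q @- s) \<Longrightarrow> p = q" for p q :: "bool list"
proof (induction p arbitrary: q)
  case Nil
  show ?case
  proof (cases q)
    case (Cons y q')
    then show ?thesis using arg_cong[OF Nil[of "sconst (\<not> y)"], of shd] by simp
  qed simp
next
  case (Cons x p)
  show ?case
  proof (cases q)
    case Nil
    then show ?thesis using arg_cong[OF Cons.prems[of "sconst (\<not> x)"], of shd] by simp
  next
    case (Cons y q')
    then show ?thesis using Cons.IH[of q'] Cons.prems by auto
  qed
qed

lemma extend_inj: "(\<And>s. extend a s = extend b s) \<Longrightarrow> a = b"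
proof -
  assume *: "\<And>s. extend a s = extend b s"
  obtain i p j q where ab: "a = (i, p)" "b = (j, q)" by (cases a, cases b)
  with * have "\<And>s. p @- s = q @- s" "i = j" by auto
  with ab show ?thesis using shift_eq_imp_eq by blast
qed

lemma describes_Lf_child:
  assumes "describes f Lf [(i, p)]"
  shows "describes (\<lambda>s. f (b ## s)) Lf [(i, p @ [b])]"
proof -
  have f: "f s = (i, p @- s)" for s using assms by (auto simp: describes_def)
  show ?thesis unfolding describes_def by (simp add: f)
qed

text \<open>
  If \<open>f\<close> replaces the empty path, then it does so on both halves of the Cantor set, with sibling
  addresses. By induction a reduced tree with a root caret would have a leaf on either side, which
  could be contracted.
\<close>

lemma describes_Lf_unique:
  "describes f Lf [(i, p)] \<Longrightarrow> describes f t as \<Longrightarrow> reduced_tree t as \<Longrightarrow> t = Lf \<and> as = [(i, p)]"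
proof (induction t arbitrary: f p as)
  case Lf
  then obtain a where as: "as = [a]" by (cases as) (auto simp: describes_def)
  then have "extend a s = extend (i, p) s" for s
    using Lf by (simp add: describes_def)
  then have "a = (i, p)" by (rule extend_inj)
  with as show ?case by simp
next
  case (Nd a b)
  have a: "a = Lf" "take (leaves a) as = [(i, p @ [False])]"
    using Nd.IH(1)[OF describes_Lf_child[OF Nd.prems(1)] describes_Nd(1)[OF Nd.prems(2)]] Nd.prems(3)
    by auto
  have b: "b = Lf" "drop (leaves a) as = [(i, p @ [True])]"
    using Nd.IH(2)[OF describes_Lf_child[OF Nd.prems(1)] describes_Nd(2)[OF Nd.prems(2)]] Nd.prems(3)
    by auto
  have "as = [(i, p @ [False])] @ [(i, p @ [True])]"
    using a b append_take_drop_id by metis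
  then show ?case using Nd.prems(3) a b by (simp add: siblings_def)
qed

lemma describes_unique:
  "describes f t as \<Longrightarrow> describes f t' as' \<Longrightarrow> reduced_tree t as \<Longrightarrow> reduced_tree t' as'
     \<Longrightarrow> t = t' \<and> as = as'"
proof (induction t arbitrary: f as t' as')
  case Lf
  then obtain i p where as: "as = [(i, p)]" by (cases as) (auto simp: describes_def)
  with Lf describes_Lf_unique[of f i p t' as'] show ?case by simp
next
  case (Nd a b)
  show ?case
  proof (cases t')
    case Lf
    then obtain i p where as: "as' = [(i, p)]" using Nd.prems(2) by (cases as') (auto simp: describes_def)
    with Lf Nd.prems describes_Lf_unique[of f i p "Nd a b" as] show ?thesis by simp
  next
    case (Nd a' b')
    note t' = this
    have a: "a = a'" "take (leaves a) as = take (leaves a') as'"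
      using Nd.IH(1)[OF describes_Nd(1)[OF Nd.prems(1)] describes_Nd(1)[OF Nd.prems(2)[unfolded t']]]
        Nd.prems(3,4) t' by auto
    have b: "b = b'" "drop (leaves a) as = drop (leaves a') as'"
      using Nd.IH(2)[OF describes_Nd(2)[OF Nd.prems(1)] describes_Nd(2)[OF Nd.prems(2)[unfolded t']]]
        Nd.prems(3,4) t' by auto
    show ?thesis using a b t' append_take_drop_id by metis
  qed
qed

lemma exposed_append: "exposed v j \<Longrightarrow> u = [] \<or> last u \<noteq> LabI \<Longrightarrow> exposed (u @ v @ w) (length u + j)"
proof -
  assume "exposed v j" and u: "u = [] \<or> last u \<noteq> LabI"
  then obtain x y where "v = x @ LabI # y" "length x = j" "x = [] \<or> last x \<noteq> LabI"
    by (auto simp: exposed_def)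
  then have "u @ v @ w = (u @ x) @ LabI # (y @ w)" "length (u @ x) = length u + j"
    "u @ x = [] \<or> last (u @ x) \<noteq> LabI" using u by (cases "x = []"; auto)+
  then show ?thesis unfolding exposed_def by blast
qed

lemma exposed_less: "exposed v j \<Longrightarrow> j < length v"
  by (auto simp: exposed_def)

lemma exposed_Nd:
  "exposed (gaps a) j \<Longrightarrow> exposed (gaps (Nd a b)) j"
  "exposed (gaps b) j \<Longrightarrow> exposed (gaps (Nd a b)) (leaves a + j)"
proof -
  show "exposed (gaps a) j \<Longrightarrow> exposed (gaps (Nd a b)) j"
    using exposed_append[of "gaps a" j "[]"] by simp
  assume b: "exposed (gaps b) j"
  then have "b \<noteq> Lf" using exposed_less by force
  then show "exposed (gaps (Nd a b)) (leaves a + j)"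
    using exposed_append[OF b, of "gaps a @ [LabN]" "[]"] by simp
qed

lemma exposed_single: "exposed [LabI] 0"
  by (auto simp: exposed_def)

lemma not_reduced_tree:
  "\<not> reduced_tree t as \<Longrightarrow> length as = leaves t \<Longrightarrow> \<exists>j. exposed (gaps t) j \<and> siblings (as ! j) (as ! Suc j)"
proof (induction t arbitrary: as)
  case (Nd a b)
  then consider "\<not> reduced_tree a (take (leaves a) as)" | "\<not> reduced_tree b (drop (leaves a) as)"
    | "a = Lf" "b = Lf" "siblings (as ! 0) (as ! 1)" by auto
  then show ?case
  proof cases
    case 1
    from Nd.IH(1)[OF 1] Nd.prems(2) obtain j where
      j: "exposed (gaps a) j" "siblings (take (leaves a) as ! j) (take (leaves a) as ! Suc j)"
      by auto
    then have "siblings (as ! j) (as ! Suc j)" using exposed_less[OF j(1)] by simp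
    then show ?thesis using exposed_Nd(1)[OF j(1)] by blast
  next
    case 2
    from Nd.IH(2)[OF 2] Nd.prems(2) obtain j where
      j: "exposed (gaps b) j" "siblings (drop (leaves a) as ! j) (drop (leaves a) as ! Suc j)"
      by auto
    have "siblings (as ! (leaves a + j)) (as ! Suc (leaves a + j))"
      using j(2) Nd.prems(2) by simp
    then show ?thesis using exposed_Nd(2)[OF j(1)] by blast
  next
    case 3
    then have "exposed (gaps (Nd a b)) 0" using exposed_single by simp
    then show ?thesis using 3(3) by (metis One_nat_def)
  qed
qed simp

lemma paths_Nil: "[] \<in> set (paths t) \<longleftrightarrow> t = Lf"
  by (cases t) auto

lemma siblings_exposed:
  "paths t ! j = p @ [False] \<Longrightarrow> paths t ! Suc j = p @ [True] \<Longrightarrow> Suc j < leaves t \<Longrightarrow> exposed (gaps t) j"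
proof (induction t arbitrary: j p)
  case (Nd a b)
  consider "Suc j < leaves a" | "j = length (gaps a)" | i where "j = leaves a + i"
    using le_Suc_ex by (metis linorder_not_less less_antisym not_less_eq)
  then show ?case
  proof cases
    case 1
    then have "False # (paths a ! j) = p @ [False]" "False # (paths a ! Suc j) = p @ [True]"
      using Nd.prems by (simp_all add: nth_append)
    then obtain p' where "paths a ! j = p' @ [False]" "paths a ! Suc j = p' @ [True]"
      by (cases p) auto
    then show ?thesis using Nd.IH(1)[of j p'] 1 exposed_Nd(1) by blast
  next
    case 2
    then have "False # (paths a ! j) = p @ [False]" "True # (paths b ! 0) = p @ [True]"
      using Nd.prems by (simp_all add: nth_append)
    then have "paths a ! j = []" "paths b ! 0 = []" by (cases p; auto)+
    then have "[] \<in> set (paths a)" "[] \<in> set (paths b)"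
      using 2 by (metis length_paths lessI nth_mem, metis length_paths zero_less_Suc nth_mem)
    then have "a = Lf" "b = Lf" by (simp_all add: paths_Nil)
    then show ?thesis using 2 exposed_single by simp
  next
    case 3
    then have "True # (paths b ! i) = p @ [False]" "True # (paths b ! Suc i) = p @ [True]"
      using Nd.prems by (simp_all add: nth_append)
    then obtain p' where "paths b ! i = p' @ [False]" "paths b ! Suc i = p' @ [True]"
      by (cases p) auto
    then show ?thesis using Nd.IH(2)[of i p'] 3 exposed_Nd(2)[of b i a] Nd.prems(3) by simp
  qed
qed simp

lemma gap_labels_decompose:
  assumes "ls @ t # rs = us @ x # vs"
  shows "\<exists>pre post. gap_labels (ls, t, rs) = pre @ gaps x @ post \<and> length pre = length (left_gaps us)
           \<and> (pre = [] \<or> last pre \<noteq> LabI)"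
proof -
  from assms consider w where "ls = us @ x # w"
    | "ls = us" "t = x" | w where "us = ls @ t # w" "rs = w @ x # vs"
    by (auto simp: append_eq_append_conv2 append_eq_Cons_conv Cons_eq_append_conv)
  then show ?thesis
  proof cases
    case 1
    then show ?thesis
      by (intro exI[of _ "left_gaps us"] exI[of _ "LabL # left_gaps w @ gaps t @ right_gaps rs"])
         (auto simp: left_gaps_append last_left_gaps)
  next
    case 2
    then show ?thesis
      by (intro exI[of _ "left_gaps us"] exI[of _ "right_gaps rs"]) (auto simp: last_left_gaps)
  next
    case 3
    then show ?thesis
      by (intro exI[of _ "left_gaps ls @ gaps t @ right_gaps w @ [if x = Lf then LabR else LabX]"]
            exI[of _ "right_gaps vs"])
         (auto simp: left_gaps_append right_gaps_append length_right_gaps)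
  qed
qed

lemma leaf_index_cases:
  "J < length (left_gaps ts) \<Longrightarrow>
     \<exists>us x vs j. ts = us @ x # vs \<and> J = length (left_gaps us) + j \<and> j < leaves x"
proof (induction ts arbitrary: J)
  case (Cons t ts)
  show ?case
  proof (cases "J < leaves t")
    case True
    then show ?thesis by (intro exI[of _ "[]"] exI[of _ t] exI[of _ ts] exI[of _ J]) simp
  next
    case False
    then obtain i where J: "J = leaves t + i" using le_Suc_ex linorder_not_less by blast
    then have "i < length (left_gaps ts)" using Cons.prems by simp
    with Cons.IH obtain us x vs j where
      "ts = us @ x # vs" "i = length (left_gaps us) + j" "j < leaves x" by blast
    then show ?thesis using J
      by (intro exI[of _ "t # us"] exI[of _ x] exI[of _ vs] exI[of _ j]) simp
  qed
qed simp

lemma addr_list_nth: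
  "j < leaves x \<Longrightarrow>
     addr_list k (us @ x # vs) ! (length (left_gaps us) + j) = (k + int (length us), paths x ! j)"
proof (induction us arbitrary: k)
  case (Cons u us)
  show ?case using Cons.IH[of "k + 1"] Cons.prems
    by (simp add: nth_append algebra_simps)
qed (simp add: nth_append)

text \<open>
  Leaves of different trees have addresses with different numbers, so siblings lie in one tree.
\<close>

lemma siblings_addrs_exposed:
  assumes "siblings (addrs Q ! j) (addrs Q ! Suc j)" "j < length (gap_labels Q)"
  shows "exposed (gap_labels Q) j"
proof -
  obtain ls t rs where Q: "Q = (ls, t, rs)" by (cases Q)
  let ?ts = "ls @ t # rs" and ?k = "- int (length ls)"
  have len: "length (left_gaps ?ts) = Suc (length (gap_labels Q))"
    by (simp add: Q left_gaps_append length_right_gaps)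
  then obtain us x vs i where i: "?ts = us @ x # vs" "j = length (left_gaps us) + i" "i < leaves x"
    using leaf_index_cases[of j ?ts] assms(2) by (metis less_SucI)
  have aj: "addrs Q ! j = (?k + int (length us), paths x ! i)"
    using addr_list_nth[OF i(3), of ?k us vs] i(1,2) by (simp add: Q)
  show ?thesis
  proof (cases "Suc i < leaves x")
    case True
    have "addrs Q ! Suc j = (?k + int (length us), paths x ! Suc i)"
      using addr_list_nth[OF True, of ?k us vs] i(1,2) by (simp add: Q)
    with aj assms(1) obtain p where "paths x ! i = p @ [False]" "paths x ! Suc i = p @ [True]"
      by (auto simp: siblings_def)
    then have "exposed (gaps x) i" using True by (rule siblings_exposed)
    with gap_labels_decompose[OF i(1)] exposed_append show ?thesis unfolding Q i(2) by metis
  next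
    case False
    then have J: "Suc j = length (left_gaps (us @ [x]))" using i by (simp add: left_gaps_append)
    have "vs \<noteq> []"
      using len J assms(2) unfolding i(1) by (auto simp: left_gaps_append)
    then obtain y vs' where vs: "vs = y # vs'" by (cases vs) auto
    have "addrs Q ! Suc j = (?k + int (length (us @ [x])), paths y ! 0)"
      using addr_list_nth[of 0 y ?k "us @ [x]" vs'] i(1) vs J by (simp add: Q)
    with aj assms(1) show ?thesis by (auto simp: siblings_def)
  qed
qed

fun describes_list :: "(point \<Rightarrow> point) \<Rightarrow> int \<Rightarrow> tree list \<Rightarrow> (int \<times> bool list) list \<Rightarrow> bool" where
  "describes_list f k [] as \<longleftrightarrow> as = []"
| "describes_list f k (t # ts) as \<longleftrightarrow> describes (\<lambda>s. f (k, s)) t (take (leaves t) as) \<and>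
     describes_list f (k + 1) ts (drop (leaves t) as)"

fun reduced_list :: "tree list \<Rightarrow> (int \<times> bool list) list \<Rightarrow> bool" where
  "reduced_list [] as \<longleftrightarrow> True"
| "reduced_list (t # ts) as \<longleftrightarrow> reduced_tree t (take (leaves t) as) \<and> reduced_list ts (drop (leaves t) as)"

lemma describes_list_unique:
  "describes_list f k ts as \<Longrightarrow> describes_list f k ts' as' \<Longrightarrow> reduced_list ts as \<Longrightarrow>
     reduced_list ts' as' \<Longrightarrow> length ts = length ts' \<Longrightarrow> ts = ts' \<and> as = as'"
proof (induction ts arbitrary: k as ts' as')
  case (Cons t ts)
  then obtain t' us where ts': "ts' = t' # us" by (cases ts') auto
  have t: "t = t' \<and> take (leaves t) as = take (leaves t') as'"
    using Cons.prems by (intro describes_unique[of "\<lambda>s. f (k, s)"]) (auto simp: ts')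
  moreover have "ts = us \<and> drop (leaves t) as = drop (leaves t') as'"
    using Cons.prems by (intro Cons.IH[of "k + 1"]) (auto simp: ts')
  ultimately show ?case using append_take_drop_id by (metis ts')
qed simp

lemma describes_listI:
  "length as = length (left_gaps ts) \<Longrightarrow>
   (\<And>j s. j < length as \<Longrightarrow> f (extend (addr_list k ts ! j) s) = extend (as ! j) s) \<Longrightarrow>
   describes_list f k ts as"
proof (induction ts arbitrary: k as)
  case (Cons t ts)
  have "f (k, (paths t ! j) @- s) = extend (as ! j) s" if "j < leaves t" for j s
    using Cons.prems(2)[of j s] Cons.prems(1) that by (simp add: nth_append)
  then have 1: "describes (\<lambda>s. f (k, s)) t (take (leaves t) as)"
    using Cons.prems(1) by (simp add: describes_def)
  have "f (extend (addr_list (k + 1) ts ! j) s) = extend (as ! (leaves t + j)) s"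
    if "j < length (left_gaps ts)" for j s
    using Cons.prems(2)[of "leaves t + j" s] Cons.prems(1) that by (simp add: nth_append)
  then have "describes_list f (k + 1) ts (drop (leaves t) as)"
    using Cons.prems(1) by (intro Cons.IH) auto
  with 1 show ?case by simp
qed simp

lemma not_reduced_list:
  "\<not> reduced_list ts as \<Longrightarrow> length as = length (left_gaps ts) \<Longrightarrow> \<exists>us x vs j. ts = us @ x # vs \<and> exposed (gaps x) j \<and>
     siblings (as ! (length (left_gaps us) + j)) (as ! Suc (length (left_gaps us) + j))"
proof (induction ts arbitrary: as)
  case (Cons t ts)
  show ?case
  proof (cases "reduced_tree t (take (leaves t) as)")
    case False
    from not_reduced_tree[OF this] Cons.prems(2) obtain j where
      j: "exposed (gaps t) j" "siblings (take (leaves t) as ! j) (take (leaves t) as ! Suc j)"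
      by auto
    then have "siblings (as ! j) (as ! Suc j)" using exposed_less[OF j(1)] by simp
    then show ?thesis using j(1)
      by (intro exI[of _ "[]"] exI[of _ t] exI[of _ ts] exI[of _ j]) simp
  next
    case True
    with Cons obtain us x vs j where *: "ts = us @ x # vs" "exposed (gaps x) j"
      "siblings (drop (leaves t) as ! (length (left_gaps us) + j))
         (drop (leaves t) as ! Suc (length (left_gaps us) + j))" by force
    have "siblings (as ! (leaves t + (length (left_gaps us) + j)))
       (as ! Suc (leaves t + (length (left_gaps us) + j)))"
      using *(3) Cons.prems(2) by simp
    then have "t # ts = (t # us) @ x # vs" "exposed (gaps x) j"
      "siblings (as ! (length (left_gaps (t # us)) + j)) (as ! Suc (length (left_gaps (t # us)) + j))"
      using *(1,2) by (simp_all add: add.assoc)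
    then show ?thesis by blast
  qed
qed simp

definition reduced :: "forest \<times> forest \<Rightarrow> bool" where
  "reduced = (\<lambda>(P, Q). length (gap_labels P) = length (gap_labels Q) \<and>
     \<not> (\<exists>j. exposed (gap_labels P) j \<and> exposed (gap_labels Q) j))"

lemma paths_inj: "paths t = paths t' \<Longrightarrow> t = t'"
proof (induction t arbitrary: t')
  case Lf
  have "[] \<in> set (paths t')" unfolding Lf[symmetric] by simp
  then show ?case by (simp add: paths_Nil)
next
  case (Nd a b)
  have "t' \<noteq> Lf" using Nd.prems paths_Nil[of t'] paths_Nil[of "Nd a b"] by auto
  then obtain a' b' where t': "t' = Nd a' b'" by (cases t') auto
  have 1: "filter hd (paths (Nd a b)) = map ((#) True) (paths b)" for a b
    by (simp add: filter_map comp_def)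
  have 2: "filter (\<lambda>p. \<not> hd p) (paths (Nd a b)) = map ((#) False) (paths a)" for a b
    by (simp add: filter_map comp_def)
  have "paths a = paths a'" "paths b = paths b'"
    using 1[of a b] 1[of a' b'] 2[of a b] 2[of a' b'] Nd.prems t'
    by (metis inj_map_eq_map list.inject injI)+
  then show ?case using Nd.IH t' by simp
qed

lemma addr_list_ge: "(i, p) \<in> set (addr_list k ts) \<Longrightarrow> k \<le> i"
  by (induction k ts rule: addr_list.induct) auto

lemma addr_list_inj: "addr_list k ts = addr_list k ts' \<Longrightarrow> ts = ts'"
proof (induction ts arbitrary: k ts')
  case Nil
  then show ?case using length_addr_list[of k ts'] by simp
next
  case (Cons t ts)
  have "ts' \<noteq> []" using Cons.prems length_addr_list[of k ts'] length_addr_list[of k "t # ts"] by auto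
  then obtain u us where ts': "ts' = u # us" by (cases ts') auto
  have "map snd (filter (\<lambda>a. fst a = k) (addr_list k (t # ts))) = paths t" for t ts
  proof -
    have "filter (\<lambda>a. fst a = k) (addr_list (k + 1) ts) = []"
      using addr_list_ge[of _ _ "k + 1" ts] by (fastforce simp: filter_empty_conv)
    then show ?thesis by (simp add: filter_map comp_def)
  qed
  from this[of t ts] this[of u us] have "t = u" using Cons.prems ts' paths_inj by metis
  then show ?case using Cons ts' by auto
qed

lemma addrs_inj: "addrs P = addrs P' \<Longrightarrow> P = P'"
proof -
  assume *: "addrs P = addrs P'"
  obtain ls t rs ls' t' rs' where P: "P = (ls, t, rs)" "P' = (ls', t', rs')" by (cases P, cases P')
  have "fst (hd (addr_list k (x # xs))) = k" for k x xs
    by (cases "paths x") (use length_paths[of x] in auto)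
  then have hd: "fst (hd (addrs (ls, t, rs))) = - int (length ls)" for ls t rs
    by (cases ls) (auto simp del: addr_list.simps)
  have "length ls = length ls'" using hd[of ls t rs] hd[of ls' t' rs'] * P by simp
  moreover from this have "ls @ t # rs = ls' @ t' # rs'" using * P addr_list_inj by simp
  ultimately show ?thesis using P by auto
qed

text \<open>
  On each Cantor set in the window of the upper forest the action of the element is described by
  the upper tree there and by the addresses of the lower leaves, and reduced descriptions are unique.
  The window has to be prescribed because padding does not change the element.
\<close>

lemma reduced_pair_unique:
  assumes red: "reduced (P, Q)" "reduced (P', Q')" and elt: "pair_elt (P, Q) = pair_elt (P', Q')"
    and win: "length (fst P) = length (fst P')" "length (snd (snd P)) = length (snd (snd P'))"
  shows "(P, Q) = (P', Q')"
proof -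
  obtain ls t rs ls' t' rs' where P: "P = (ls, t, rs)" "P' = (ls', t', rs')" by (cases P, cases P')
  let ?g = "act (pair_elt (P, Q))" and ?k = "- int (length ls)"
  have red_list: "reduced_list (ls @ t # rs) (addrs Q)" if "reduced ((ls, t, rs), Q)" for ls t rs Q
  proof (rule ccontr)
    assume "\<not> reduced_list (ls @ t # rs) (addrs Q)"
    from not_reduced_list[OF this] that obtain us x vs j where *:
      "ls @ t # rs = us @ x # vs" "exposed (gaps x) j"
      "siblings (addrs Q ! (length (left_gaps us) + j)) (addrs Q ! Suc (length (left_gaps us) + j))"
      by (auto simp: reduced_def left_gaps_append length_right_gaps simp del: addrs.simps)
    obtain pre post where "gap_labels (ls, t, rs) = pre @ gaps x @ post"
      "length pre = length (left_gaps us)" "pre = [] \<or> last pre \<noteq> LabI"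
      using gap_labels_decompose[OF *(1)] by blast
    then have "exposed (gap_labels (ls, t, rs)) (length (left_gaps us) + j)"
      using exposed_append[OF *(2), of pre post] by simp
    moreover from this have "exposed (gap_labels Q) (length (left_gaps us) + j)"
      using that exposed_less by (intro siblings_addrs_exposed[OF *(3)]) (force simp: reduced_def)
    ultimately show False using that by (auto simp: reduced_def)
  qed
  have desc: "describes_list (act (pair_elt ((ls, t, rs), Q))) (- int (length ls)) (ls @ t # rs) (addrs Q)"
    if "reduced ((ls, t, rs), Q)" for ls t rs Q
  proof (rule describes_listI)
    have len: "length (gap_labels (ls, t, rs)) = length (gap_labels Q)" using that by (simp add: reduced_def)
    show "length (addrs Q) = length (left_gaps (ls @ t # rs))"
      using len by (simp add: left_gaps_append length_right_gaps)
    show "act (pair_elt ((ls, t, rs), Q)) (extend (addr_list (- int (length ls)) (ls @ t # rs) ! j) s)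
        = extend (addrs Q ! j) s" if "j < length (addrs Q)" for j s
      using act_pair_elt[OF len, of j s] len that by simp
  qed
  have "length ls = length ls'" using win P by simp
  have "describes_list ?g ?k (ls @ t # rs) (addrs Q)"
    using desc[OF red(1)[unfolded P]] by (simp only: P)
  moreover have "describes_list ?g ?k (ls' @ t' # rs') (addrs Q')"
    using desc[OF red(2)[unfolded P]]
    unfolding elt \<open>length ls = length ls'\<close> unfolding P .
  ultimately have "ls @ t # rs = ls' @ t' # rs' \<and> addrs Q = addrs Q'"
    using win red_list[OF red(1)[unfolded P]] red_list[OF red(2)[unfolded P]]
    by (intro describes_list_unique[of ?g ?k]) (auto simp: P)
  then show ?thesis using addrs_inj[of Q Q'] \<open>length ls = length ls'\<close> P by simp
qed

section \<open>The weight of a pair of forests\<close>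

type_synonym column = "label \<times> label"

abbreviation LL :: column where "LL \<equiv> (LabL, LabL)"
abbreviation RR :: column where "RR \<equiv> (LabR, LabR)"

fun col_weight :: "column \<Rightarrow> nat" where "col_weight (x, y) = weight x y"

definition total_weight :: "column list \<Rightarrow> nat" where
  "total_weight cs = sum_list (map col_weight cs)"

definition leading :: "column list \<Rightarrow> nat" where "leading cs = length (takeWhile ((=) LL) cs)"
definition trailing :: "column list \<Rightarrow> nat" where "trailing cs = length (takeWhile ((=) RR) (rev cs))"

text \<open>
  Columns \<open>(L, L)\<close> at the left end and \<open>(R, R)\<close> at the right end are padding; the weight 2 of
  each of them is taken off.
\<close>

definition net_weight :: "column list \<Rightarrow> int" where
  "net_weight cs = int (total_weight cs) - 2 * int (leading cs) - 2 * int (trailing cs)"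

lemma total_weight_simps [simp]:
  "total_weight [] = 0" "total_weight (c # cs) = col_weight c + total_weight cs"
  "total_weight (as @ bs) = total_weight as + total_weight bs"
  by (simp_all add: total_weight_def)

lemma takeWhile_eq_append:
  "length (takeWhile ((=) c) (u @ w)) =
     (if set u \<subseteq> {c} then length u + length (takeWhile ((=) c) w) else length (takeWhile ((=) c) u))"
proof (induction u)
  case (Cons x u)
  then show ?case by (cases "x = c") simp_all
qed simp

lemma leading_append: "leading (u @ w) = (if set u \<subseteq> {LL} then length u + leading w else leading u)"
  by (simp add: leading_def takeWhile_eq_append)

lemma trailing_append: "trailing (w @ v) = (if set v \<subseteq> {RR} then length v + trailing w else trailing v)"
  by (simp add: trailing_def takeWhile_eq_append)

lemma leading_Cons: "leading (c # cs) = (if c = LL then Suc (leading cs) else 0)"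
  by (simp add: leading_def)

lemma trailing_single: "trailing [c] = (if c = RR then 1 else 0)"
  by (simp add: trailing_def)

lemma leading_Nil [simp]: "leading [] = 0" and trailing_Nil [simp]: "trailing [] = 0"
  by (simp_all add: leading_def trailing_def)

lemma leading_all: "set u \<subseteq> {LL} \<Longrightarrow> leading u = length u"
  using leading_append[of u "[]"] by simp

lemma trailing_all: "set u \<subseteq> {RR} \<Longrightarrow> trailing u = length u"
  using trailing_append[of "[]" u] by simp

lemma leading_0: "LL \<notin> set v \<Longrightarrow> leading v = 0"
  by (cases v) (auto simp: leading_Cons)

lemma trailing_0: "RR \<notin> set v \<Longrightarrow> trailing v = 0"
  by (cases v rule: rev_cases) (auto simp: trailing_append trailing_single)

text \<open>
  What the columns to the left and to the right of a column contribute, provided that no padding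
  block extends past that column.
\<close>

definition outer_weight :: "column list \<Rightarrow> column list \<Rightarrow> int" where
  "outer_weight u v = int (total_weight u) + int (total_weight v) - 2 * int (leading u) - 2 * int (trailing v)"

lemma net_weight_append: "RR \<notin> set u \<Longrightarrow> LL \<notin> set v \<Longrightarrow> net_weight (u @ v) = outer_weight u v"
  by (simp add: net_weight_def outer_weight_def leading_append trailing_append leading_0 trailing_0 leading_all trailing_all)

text \<open>
  The column \<open>c\<close> is to be thought of as a gap next to the upper pointer. Then the hypotheses hold by the
  upper labels alone, and a padding block can reach \<open>c\<close> only from its own side.
\<close>

lemma net_weight_column:
  assumes "RR \<notin> set u" "LL \<notin> set v"
  shows "net_weight (u @ c # v) = int (col_weight c) + outer_weight u v
     - (if c = LL \<and> set u \<subseteq> {LL} then 2 else 0) - (if c = RR \<and> set v \<subseteq> {RR} then 2 else 0)"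
proof -
  have "leading (u @ c # v) = leading u + (if c = LL \<and> set u \<subseteq> {LL} then 1 else 0)"
    using assms by (simp add: leading_append leading_Cons leading_0 leading_all)
  moreover have "trailing (u @ c # v) = trailing v + (if c = RR \<and> set v \<subseteq> {RR} then 1 else 0)"
    using assms trailing_append[of "u @ [c]" v] by (simp add: trailing_append trailing_single trailing_0 trailing_all)
  ultimately show ?thesis by (simp add: net_weight_def outer_weight_def)
qed

lemma net_weight_pad:
  "net_weight (LL # cs) = net_weight cs" "net_weight (cs @ [RR]) = net_weight cs"
proof -
  have "trailing (LL # cs) = trailing cs"
    using trailing_append[of "[LL]" cs] by (simp add: trailing_single trailing_all)
  then show "net_weight (LL # cs) = net_weight cs" by (simp add: net_weight_def leading_Cons)
  have "leading (cs @ [RR]) = leading cs" by (simp add: leading_append leading_Cons leading_all)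
  then show "net_weight (cs @ [RR]) = net_weight cs" by (simp add: net_weight_def trailing_append trailing_single)
qed

lemma net_weight_nonneg: "0 \<le> net_weight cs"
proof (induction cs)
  case (Cons c cs)
  have trailing: "2 * trailing ds \<le> total_weight ds" for ds
  proof (induction ds rule: rev_induct)
    case (snoc d ds)
    then show ?case by (cases "d = RR") (auto simp: trailing_append trailing_single)
  qed simp
  show ?case
  proof (cases "c = LL")
    case True
    then show ?thesis using Cons net_weight_pad(1) by simp
  next
    case False
    then show ?thesis using trailing[of "c # cs"] by (simp add: net_weight_def leading_Cons)
  qed
qed (simp add: net_weight_def)

lemma RR_notin_zip: "LabR \<notin> set a \<Longrightarrow> RR \<notin> set (zip a b)"
  by (auto dest: set_zip_leftD)

lemma LL_notin_zip: "LabL \<notin> set a \<Longrightarrow> LL \<notin> set (zip a b)"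
  by (auto dest: set_zip_leftD)

text \<open>
  The sign of the change is read off from the table of weights. The conditions on padding enter when the
  column \<open>(x, y)\<close> ceases to belong to the padding on the right or the new one joins that on the left.
\<close>

lemma net_weight_move:
  assumes "LabR \<notin> set a" "LabL \<notin> set a'" "length a = length b" "x = LabR \<or> x = LabX"
  shows "net_weight (zip (a @ LabL # a') (b @ y # b')) - net_weight (zip (a @ x # a') (b @ y # b')) =
    (if y = LabN \<or> y = LabX \<or> (y = LabR \<and> \<not> (x = LabR \<and> set (zip a' b') \<subseteq> {RR}))
       \<or> (y = LabI \<and> x = LabX) \<or> (y = LabL \<and> set (zip a b) \<subseteq> {LL}) then - 1 else 1)"
  using assms by (cases y) (auto simp: net_weight_column RR_notin_zip LL_notin_zip)

lemma net_weight_join: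
  assumes "LabR \<notin> set a" "LabL \<notin> set a'" "length a = length b"
    "(x, x') = (LabR, LabI) \<or> (x, x') = (LabX, LabN)"
  shows "net_weight (zip (a @ x' # a') (b @ y # b')) - net_weight (zip (a @ x # a') (b @ y # b')) =
    (if x = LabR \<and> y = LabR \<and> \<not> set (zip a' b') \<subseteq> {RR} then - 1 else 1)"
  using assms by (cases y) (auto simp: net_weight_column RR_notin_zip LL_notin_zip)

text \<open>
  The column that disappears has weight 1. The preceding lower label may change from \<open>I\<close> to \<open>N\<close> or
  from \<open>R\<close> to \<open>X\<close>, but opposite to \<open>L\<close> these have equal weights.
\<close>

lemma net_weight_cancel:
  assumes "LabR \<notin> set a" "LabL \<notin> set a'" "length a = length b" "a = [] \<or> last a = LabL"
  shows "net_weight (zip (a @ LabR # a') (promote_last b @ LabI # b')) = net_weight (zip (a @ a') (b @ b')) + 1"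
proof -
  have len: "length (promote_last b) = length b" by (auto simp: promote_last_def)
  have "outer_weight (zip a (promote_last b)) c = outer_weight (zip a b) c" for c
  proof (cases "a = []")
    case True
    then show ?thesis by simp
  next
    case False
    then obtain a0 b0 z where ab: "a = a0 @ [LabL]" "b = b0 @ [z]" "length a0 = length b0"
      using assms(3,4) by (cases a rule: rev_cases; cases b rule: rev_cases) auto
    show ?thesis unfolding outer_weight_def ab
      by (cases z) (simp_all add: ab leading_append leading_Cons)
  qed
  moreover have "net_weight (zip (a @ LabR # a') (promote_last b @ LabI # b'))
      = 1 + outer_weight (zip a (promote_last b)) (zip a' b')"
    using assms by (simp add: len net_weight_column RR_notin_zip LL_notin_zip)
  moreover have "net_weight (zip (a @ a') (b @ b')) = outer_weight (zip a b) (zip a' b')"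
    using assms by (simp add: net_weight_append RR_notin_zip LL_notin_zip)
  ultimately show ?thesis by simp
qed

section \<open>Exposed carets in both forests\<close>

lemma exposed_nth: "exposed l j \<longleftrightarrow> j < length l \<and> l ! j = LabI \<and> (j = 0 \<or> l ! (j - 1) \<noteq> LabI)"
proof
  assume "exposed l j"
  then obtain u v where "l = u @ LabI # v" "length u = j" "u = [] \<or> last u \<noteq> LabI"
    by (auto simp: exposed_def)
  then show "j < length l \<and> l ! j = LabI \<and> (j = 0 \<or> l ! (j - 1) \<noteq> LabI)"
    by (cases "u = []") (auto simp: nth_append last_conv_nth)
next
  assume *: "j < length l \<and> l ! j = LabI \<and> (j = 0 \<or> l ! (j - 1) \<noteq> LabI)"
  then have "l = take j l @ LabI # drop (Suc j) l" using id_take_nth_drop[of j l] by simp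
  moreover have "length (take j l) = j" using * by simp
  moreover have "take j l = [] \<or> last (take j l) \<noteq> LabI"
    using * by (cases "j = 0") (auto simp: last_conv_nth)
  ultimately show "exposed l j" unfolding exposed_def by blast
qed

definition no_common :: "label list \<Rightarrow> label list \<Rightarrow> bool" where
  "no_common a b \<longleftrightarrow> \<not> (\<exists>j. exposed a j \<and> exposed b j)"

lemma reduced_iff: "reduced (P, Q) \<longleftrightarrow> length (gap_labels P) = length (gap_labels Q) \<and> no_common (gap_labels P) (gap_labels Q)"
  by (simp add: reduced_def no_common_def)

lemma exposed_replace:
  assumes "x \<noteq> LabI" "y \<noteq> LabI \<or> j \<noteq> length u" "exposed (u @ y # v) j"
  shows "exposed (u @ x # v) j"
  using assms by (auto simp: exposed_nth nth_append nth_Cons' split: if_splits)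

lemma no_common_replace:
  "x \<noteq> LabI \<Longrightarrow> y \<noteq> LabI \<Longrightarrow> no_common (u @ x # v) b \<longleftrightarrow> no_common (u @ y # v) b"
  unfolding no_common_def using exposed_replace[of x y _ u v] exposed_replace[of y x _ u v] by blast

lemma exposed_at: "exposed (u @ y # v) (length u) \<longleftrightarrow> y = LabI \<and> (u = [] \<or> last u \<noteq> LabI)"
  by (cases "u = []") (auto simp: exposed_nth nth_append last_conv_nth)

lemma no_common_pad:
  "no_common (LabL # a) (LabL # b) = no_common a b"
  "length a = length b \<Longrightarrow> no_common (a @ [LabR]) (b @ [LabR]) = no_common a b"
proof -
  have 1: "exposed (LabL # a) j \<longleftrightarrow> (\<exists>i. j = Suc i \<and> exposed a i)" for a j
    by (cases j) (auto simp: exposed_nth nth_Cons')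
  show "no_common (LabL # a) (LabL # b) = no_common a b"
    unfolding no_common_def 1 by blast
  have 2: "exposed (a @ [LabR]) j \<longleftrightarrow> exposed a j" for a j
    by (auto simp: exposed_nth nth_append)
  show "no_common (a @ [LabR]) (b @ [LabR]) = no_common a b"
    unfolding no_common_def 2 ..
qed

text \<open>
  The labels differ only near the gap at the pointer. There the upper labels are \<open>L\<close>, \<open>R\<close> and \<open>X\<close>, so
  that the upper forest has no exposed caret.
\<close>

lemma no_common_cancel:
  assumes "length a = length b" "a = [] \<or> last a = LabL" "a' = [] \<or> hd a' \<noteq> LabI"
  shows "no_common (a @ LabR # a') (promote_last b @ LabI # b') \<longleftrightarrow> no_common (a @ a') (b @ b')"
proof -
  have len: "length (promote_last b) = length b" by (auto simp: promote_last_def)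
  have b: "promote_last b ! j = b ! j" if "Suc j < length b" for j
    using that by (auto simp: promote_last_def nth_append nth_butlast)
  have a: "a ! j = LabL" if "Suc j = length a" for j
    using that assms(2) last_conv_nth[of a] by (metis Suc_neq_Zero diff_Suc_1 list.size(3))
  have a': "a' ! 0 \<noteq> LabI" if "0 < length a'" using that assms(3) by (auto simp: hd_conv_nth)
  have low: "exposed (a @ LabR # a') j \<and> exposed (promote_last b @ LabI # b') j
      \<longleftrightarrow> exposed (a @ a') j \<and> exposed (b @ b') j" if "j < length a" for j
  proof (cases "Suc j = length a")
    case True
    then show ?thesis using a[OF True] by (simp add: exposed_nth nth_append)
  next
    case False
    then have "Suc j < length b" "j - 1 < length b" "Suc (j - 1) < length b" using that assms(1) by auto
    then show ?thesis using b[of j] b[of "j - 1"] that assms(1)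
      by (auto simp: exposed_nth nth_append len)
  qed
  have high: "exposed (a @ LabR # a') (Suc j) \<and> exposed (promote_last b @ LabI # b') (Suc j)
      \<longleftrightarrow> exposed (a @ a') j \<and> exposed (b @ b') j" if "length a < j" for j
    using that assms(1) by (auto simp: exposed_nth nth_append len nth_Cons' Suc_diff_le)
  have mid: "\<not> exposed (a @ LabR # a') (length a)" "\<not> exposed (a @ LabR # a') (Suc (length a))"
    "\<not> exposed (a @ a') (length a)"
    using a' by (auto simp: exposed_nth nth_append)
  show ?thesis
  proof
    assume *: "no_common (a @ LabR # a') (promote_last b @ LabI # b')"
    show "no_common (a @ a') (b @ b')" unfolding no_common_def
    proof clarify
      fix j assume j: "exposed (a @ a') j" "exposed (b @ b') j"
      then show False using low[of j] high[of j] mid * unfolding no_common_def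
        by (metis linorder_neqE_nat)
    qed
  next
    assume *: "no_common (a @ a') (b @ b')"
    show "no_common (a @ LabR # a') (promote_last b @ LabI # b')" unfolding no_common_def
    proof clarify
      fix j assume j: "exposed (a @ LabR # a') j" "exposed (promote_last b @ LabI # b') j"
      consider "j < length a" | "j = length a" | "j = Suc (length a)" | i where "j = Suc i" "length a < i"
        by (metis Suc_lessI less_antisym linorder_neqE_nat lessE not_less_eq)
      then show False
        using low[of j] high mid j * unfolding no_common_def by cases blast+
    qed
  qed
qed

section \<open>Which labels can be adjacent\<close>

lemma set_gaps: "set (gaps t) \<subseteq> {LabI, LabN}"
  by (induction t) auto

lemma set_left_gaps: "set (left_gaps ts) \<subseteq> {LabI, LabN, LabL}"
  using set_gaps by (induction ts) force+

lemma set_right_gaps: "set (right_gaps ts) \<subseteq> {LabI, LabN, LabR, LabX}"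
  using set_gaps by (induction ts) force+

fun follows :: "label \<Rightarrow> label \<Rightarrow> bool" where
  "follows LabL y \<longleftrightarrow> True"
| "follows LabI y \<longleftrightarrow> True"
| "follows LabR y \<longleftrightarrow> y = LabR \<or> y = LabX"
| "follows _ y \<longleftrightarrow> y = LabN \<or> y = LabI"

lemma hd_gaps: "t \<noteq> Lf \<Longrightarrow> hd (gaps t) = LabI \<or> hd (gaps t) = LabN"
  using set_gaps[of t] last_gaps[of t] hd_in_set[of "gaps t"] by blast

lemma gaps_eq_Nil [simp]: "gaps t = [] \<longleftrightarrow> t = Lf"
  by (cases t) auto

lemma successively_gaps: "successively follows (gaps t)"
proof (induction t)
  case (Nd a b)
  then show ?case using last_gaps[of a] hd_gaps[of b]
    by (cases "a = Lf"; cases "b = Lf") (auto simp: successively_append_iff successively_Cons)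
qed simp

lemma successively_left_gaps: "successively follows (left_gaps ts)"
proof (induction ts)
  case (Cons t ts)
  then show ?case using last_gaps[of t] successively_gaps[of t]
    by (cases "t = Lf") (auto simp: successively_append_iff successively_Cons)
qed simp

lemma successively_right_gaps: "successively follows (right_gaps ts)"
proof (induction ts)
  case (Cons t ts)
  have "right_gaps ts = [] \<or> hd (right_gaps ts) = LabR \<or> hd (right_gaps ts) = LabX"
    by (cases ts) auto
  then show ?case using Cons last_gaps[of t] hd_gaps[of t] successively_gaps[of t]
    by (cases "t = Lf"; elim disjE) (auto simp: successively_append_iff successively_Cons)
qed simp

lemma successively_gap_labels: "successively follows (gap_labels P)"
proof -
  obtain ls t rs where P: "P = (ls, t, rs)" by (cases P)
  have "successively follows (gaps t @ right_gaps rs)"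
    using successively_gaps successively_right_gaps last_gaps[of t]
    by (cases "t = Lf") (auto simp: successively_append_iff)
  then show ?thesis using successively_left_gaps last_left_gaps[of ls]
    by (cases "ls = []") (auto simp: P successively_append_iff)
qed

lemma follows_gap_labels: "gap_labels P = u @ x # y # v \<Longrightarrow> follows x y"
  using successively_gap_labels[of P] by (simp add: successively_append_iff)

section \<open>The effect of the generators on reduced pairs\<close>

fun pair_weight :: "forest \<times> forest \<Rightarrow> int" where "pair_weight (P, Q) = net_weight (zip (gap_labels P) (gap_labels Q))"

fun pad_left_pair where "pad_left_pair (P, Q) = (pad_left P, pad_left Q)"
fun pad_right_pair where "pad_right_pair (P, Q) = (pad_right P, pad_right Q)"

lemma pad_left_pair:
  assumes "reduced d"
  shows "reduced (pad_left_pair d)" "pair_elt (pad_left_pair d) = pair_elt d"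
    "pair_weight (pad_left_pair d) = pair_weight d"
proof -
  obtain P Q where d: "d = (P, Q)" by (cases d)
  show "reduced (pad_left_pair d)" "pair_weight (pad_left_pair d) = pair_weight d"
    using assms by (simp_all add: d reduced_iff no_common_pad net_weight_pad)
  show "pair_elt (pad_left_pair d) = pair_elt d"
    unfolding d pad_left_pair.simps by (rule pair_elt_pad)
qed

lemma pad_right_pair:
  assumes "reduced d"
  shows "reduced (pad_right_pair d)" "pair_elt (pad_right_pair d) = pair_elt d"
    "pair_weight (pad_right_pair d) = pair_weight d"
proof -
  obtain P Q where d: "d = (P, Q)" by (cases d)
  show "reduced (pad_right_pair d)" "pair_weight (pad_right_pair d) = pair_weight d"
    using assms by (simp_all add: d reduced_iff no_common_pad net_weight_pad)
  show "pair_elt (pad_right_pair d) = pair_elt d"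
    unfolding d pad_right_pair.simps by (rule pair_elt_pad)
qed

lemma split_at_length:
  "length (a @ x # a') = length B \<Longrightarrow> \<exists>b y b'. B = b @ y # b' \<and> length b = length a \<and> length b' = length a'"
proof -
  assume *: "length (a @ x # a') = length B"
  then have "B = take (length a) B @ B ! length a # drop (Suc (length a)) B"
    by (intro id_take_nth_drop) simp
  moreover have "length (take (length a) B) = length a" "length (drop (Suc (length a)) B) = length a'"
    using * by auto
  ultimately show ?thesis by blast
qed

lemma notin_labels:
  "LabR \<notin> set (left_gaps ls)" "LabX \<notin> set (left_gaps ls)" "LabR \<notin> set (gaps t)" "LabX \<notin> set (gaps t)"
  "LabL \<notin> set (gaps t)" "LabL \<notin> set (right_gaps rs)"
  using set_left_gaps[of ls] set_gaps[of t] set_right_gaps[of rs] by auto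

lemma move_reduced:
  "reduced ((ls @ [t], u, rs), Q) \<longleftrightarrow> reduced ((ls, t, u # rs), Q)"
  using no_common_replace[of LabL "if u = Lf then LabR else LabX" "left_gaps ls @ gaps t"
      "gaps u @ right_gaps rs" "gap_labels Q"]
  by (simp add: reduced_iff left_gaps_append split: if_splits)

lemma pair_weight_move:
  assumes "reduced ((ls, t, u # rs), Q)"
    and "gap_labels Q = b @ y # b'" "length b = length (left_gaps ls @ gaps t)"
  shows "pair_weight ((ls @ [t], u, rs), Q) - pair_weight ((ls, t, u # rs), Q) =
    (if y = LabN \<or> y = LabX
       \<or> (y = LabR \<and> \<not> (u = Lf \<and> set (zip (gaps u @ right_gaps rs) b') \<subseteq> {RR}))
       \<or> (y = LabI \<and> u \<noteq> Lf) \<or> (y = LabL \<and> set (zip (left_gaps ls @ gaps t) b) \<subseteq> {LL}) then - 1 else 1)"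
  using net_weight_move[of "left_gaps ls @ gaps t" "gaps u @ right_gaps rs" b
      "if u = Lf then LabR else LabX" y b'] assms notin_labels
  by (auto simp: left_gaps_append)

lemma pair_weight_move_abs:
  assumes "reduced ((ls, t, u # rs), Q)"
  shows "\<bar>pair_weight ((ls @ [t], u, rs), Q) - pair_weight ((ls, t, u # rs), Q)\<bar> = 1"
proof -
  have "length ((left_gaps ls @ gaps t) @ (if u = Lf then LabR else LabX) # gaps u @ right_gaps rs)
      = length (gap_labels Q)"
    using assms by (simp add: reduced_iff)
  from split_at_length[OF this] obtain b y b' where
    "gap_labels Q = b @ y # b'" "length b = length (left_gaps ls @ gaps t)" by blast
  from pair_weight_move[OF assms this] show ?thesis by (auto split: if_splits)
qed

text \<open>
  The only caret that the upper forest gains is the new one, and it is exposed only if both trees are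
  trivial.
\<close>

lemma join_reduced:
  assumes "reduced ((ls, t, u # rs), Q)"
    and "\<not> (t = Lf \<and> u = Lf \<and> exposed (gap_labels Q) (length (left_gaps ls)))"
  shows "reduced ((ls, Nd t u, rs), Q)"
proof -
  let ?a = "left_gaps ls @ gaps t" and ?a' = "gaps u @ right_gaps rs"
  let ?x = "if u = Lf then LabR else LabX" and ?x' = "if u = Lf then LabI else LabN"
  have "\<not> (exposed (?a @ ?x' # ?a') j \<and> exposed (gap_labels Q) j)" for j
  proof (cases "j = length ?a \<and> u = Lf")
    case True
    show ?thesis
    proof (cases "t = Lf")
      case True
      then show ?thesis using assms(2) \<open>j = length ?a \<and> u = Lf\<close> by simp
    next
      case False
      then show ?thesis
        using True last_gaps[of t] exposed_at[of ?a ?x' ?a'] by simp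
    qed
  next
    case False
    then have "exposed (?a @ ?x # ?a') j" if "exposed (?a @ ?x' # ?a') j"
      using that by (intro exposed_replace[of ?x ?x']) auto
    then show ?thesis using assms(1) by (auto simp: reduced_iff no_common_def)
  qed
  then show ?thesis using assms(1) by (simp add: reduced_iff no_common_def)
qed

lemma unjoin_reduced:
  assumes "reduced ((ls, Nd t u, rs), Q)"
  shows "reduced ((ls, t, u # rs), Q)"
proof -
  let ?a = "left_gaps ls @ gaps t" and ?a' = "gaps u @ right_gaps rs"
  let ?x = "if u = Lf then LabR else LabX" and ?x' = "if u = Lf then LabI else LabN"
  have "exposed (?a @ ?x' # ?a') j" if j: "exposed (?a @ ?x # ?a') j" for j
  proof (cases "u = Lf")
    case True
    have "?a' = [] \<or> ?a' ! 0 \<noteq> LabI" using True by (cases rs) auto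
    then show ?thesis using j True by (auto simp: exposed_nth nth_append nth_Cons' split: if_splits)
  next
    case False
    then show ?thesis using j exposed_replace[of LabN LabX j ?a ?a'] by simp
  qed
  then show ?thesis using assms by (auto simp: reduced_iff no_common_def)
qed

lemma pair_weight_join:
  assumes "reduced ((ls, t, u # rs), Q)"
    and "gap_labels Q = b @ y # b'" "length b = length (left_gaps ls @ gaps t)"
  shows "pair_weight ((ls, Nd t u, rs), Q) - pair_weight ((ls, t, u # rs), Q) =
    (if u = Lf \<and> y = LabR \<and> \<not> set (zip (gaps u @ right_gaps rs) b') \<subseteq> {RR} then - 1 else 1)"
  using net_weight_join[of "left_gaps ls @ gaps t" "gaps u @ right_gaps rs" b
      "if u = Lf then LabR else LabX" "if u = Lf then LabI else LabN" y b'] assms notin_labels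
  by (auto simp: left_gaps_append)

lemma pair_weight_join_abs:
  assumes "reduced ((ls, t, u # rs), Q)"
  shows "\<bar>pair_weight ((ls, Nd t u, rs), Q) - pair_weight ((ls, t, u # rs), Q)\<bar> = 1"
proof -
  have "length ((left_gaps ls @ gaps t) @ (if u = Lf then LabR else LabX) # gaps u @ right_gaps rs)
      = length (gap_labels Q)"
    using assms by (simp add: reduced_iff)
  from split_at_length[OF this] obtain b y b' where
    "gap_labels Q = b @ y # b'" "length b = length (left_gaps ls @ gaps t)" by blast
  from pair_weight_join[OF assms this] show ?thesis by (auto split: if_splits)
qed

text \<open>
  From the lower forest \<open>Q'\<close> to \<open>Q\<close>, two trivial trees above an exposed lower caret are joined and the
  resulting common caret is removed. In the other direction it is the step \<open>x\<^sub>1\<^sup>-\<^sup>1\<close> at a trivial tree: the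
  leaf is split in both forests and the upper caret taken away.
\<close>

lemma cancel:
  assumes len: "length (gap_labels (ls, Lf, rs)) = length (gap_labels Q)"
  defines "Q' \<equiv> split_forest (length (left_gaps ls)) Q"
  shows "reduced ((ls, Lf, Lf # rs), Q') \<longleftrightarrow> reduced ((ls, Lf, rs), Q)"
    and "pair_weight ((ls, Lf, Lf # rs), Q') = pair_weight ((ls, Lf, rs), Q) + 1"
    and "pair_elt ((ls, Lf, rs), Q) = gen1 + pair_elt ((ls, Lf, Lf # rs), Q')"
proof -
  let ?i = "length (left_gaps ls)"
  let ?b = "take ?i (gap_labels Q)" and ?b' = "drop ?i (gap_labels Q)"
  have i: "?i \<le> length (gap_labels Q)" using len by simp
  have Q': "gap_labels Q' = promote_last ?b @ LabI # ?b'"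
    unfolding Q'_def gap_labels_split[OF i] insert_caret_def ..
  have Q: "gap_labels Q = ?b @ ?b'" by simp
  have ls: "left_gaps ls = [] \<or> last (left_gaps ls) = LabL" using last_left_gaps by auto
  have rs: "right_gaps rs = [] \<or> hd (right_gaps rs) \<noteq> LabI" by (cases rs) auto
  have lenb: "length (left_gaps ls) = length ?b" using i by simp
  have "no_common (left_gaps ls @ LabR # right_gaps rs) (gap_labels Q') \<longleftrightarrow>
      no_common (left_gaps ls @ right_gaps rs) (gap_labels Q)"
    unfolding Q' by (subst Q) (rule no_common_cancel[OF lenb ls rs])
  moreover have "length (gap_labels Q') = Suc (length (gap_labels Q))"
    unfolding Q'_def gap_labels_split[OF i] by simp
  ultimately show "reduced ((ls, Lf, Lf # rs), Q') \<longleftrightarrow> reduced ((ls, Lf, rs), Q)"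
    using len by (simp add: reduced_iff)
  have "net_weight (zip (left_gaps ls @ LabR # right_gaps rs) (gap_labels Q'))
      = net_weight (zip (left_gaps ls @ right_gaps rs) (gap_labels Q)) + 1"
    unfolding Q' by (subst (3) Q) (rule net_weight_cancel[OF _ _ lenb ls]; simp add: notin_labels)
  then show "pair_weight ((ls, Lf, Lf # rs), Q') = pair_weight ((ls, Lf, rs), Q) + 1" by simp
  have "forest_elt (ls, Nd Lf Lf, rs) = forest_elt (ls, Lf, rs) + xgen ?i"
    using forest_elt_split[of ?i "(ls, Lf, rs)"] by simp
  moreover have "forest_elt Q' = forest_elt Q + xgen ?i"
    unfolding Q'_def by (rule forest_elt_split[OF i])
  ultimately have "pair_elt ((ls, Nd Lf Lf, rs), Q') = pair_elt ((ls, Lf, rs), Q)"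
    by (simp del: forest_elt.simps add: diff_conv_add_uminus minus_add add.assoc del: add_uminus_conv_diff)
  moreover have "pair_elt ((ls, Nd Lf Lf, rs), Q') = gen1 + pair_elt ((ls, Lf, Lf # rs), Q')"
    using forest_elt_join[of ls Lf Lf rs] by (simp del: forest_elt.simps add: add_diff_eq)
  ultimately show "pair_elt ((ls, Lf, rs), Q) = gen1 + pair_elt ((ls, Lf, Lf # rs), Q')" by simp
qed

lemma pair_elt_move: "pair_elt ((ls @ [t], u, rs), Q) = gen0 + pair_elt ((ls, t, u # rs), Q)"
  using forest_elt_move[of ls t u rs] by (simp del: forest_elt.simps add: add_diff_eq)

lemma pair_elt_join: "pair_elt ((ls, Nd t u, rs), Q) = gen1 + pair_elt ((ls, t, u # rs), Q)"
  using forest_elt_join[of ls t u rs] by (simp del: forest_elt.simps add: add_diff_eq)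

lemma padded_pair:
  assumes "reduced d"
  obtains ls l t r rs Q where "reduced ((ls @ [l], t, r # rs), Q)"
    "pair_elt ((ls @ [l], t, r # rs), Q) = pair_elt d" "pair_weight ((ls @ [l], t, r # rs), Q) = pair_weight d"
proof -
  let ?d = "pad_left_pair (pad_right_pair d)"
  have *: "reduced ?d" "pair_elt ?d = pair_elt d" "pair_weight ?d = pair_weight d"
    using assms by (simp_all add: pad_left_pair pad_right_pair)
  obtain ls t rs Q where d: "d = ((ls, t, rs), Q)" by (metis surj_pair)
  obtain ls' l where ls': "Lf # ls = ls' @ [l]" by (metis append_butlast_last_id list.distinct(1))
  obtain r rs' where rs': "rs @ [Lf] = r # rs'" by (cases rs) auto
  have "?d = ((ls' @ [l], t, r # rs'), pad_left (pad_right Q))"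
    using ls' rs' by (simp add: d)
  with * that show thesis by metis
qed

definition letters :: "thompson set" where "letters = {gen0, - gen0, gen1, - gen1}"

text \<open>
  The steps \<open>x\<^sub>0\<^sup>-\<^sup>1\<close> and \<open>x\<^sub>1\<^sup>-\<^sup>1\<close> lead to pairs from which \<open>x\<^sub>0\<close> and \<open>x\<^sub>1\<close> lead back, so the lemmas on
  moving, joining and cancelling cover all four letters.
\<close>

lemma letter_step:
  assumes "reduced d" "s \<in> letters"
  shows "\<exists>d'. reduced d' \<and> pair_elt d' = s + pair_elt d \<and> pair_weight d' \<le> pair_weight d + 1"
proof -
  obtain ls l t r rs Q where d: "reduced ((ls @ [l], t, r # rs), Q)"
    "pair_elt ((ls @ [l], t, r # rs), Q) = pair_elt d" "pair_weight ((ls @ [l], t, r # rs), Q) = pair_weight d"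
    using padded_pair[OF assms(1)] .
  let ?ls = "ls @ [l]"
  consider "s = gen0" | "s = - gen0" | "s = gen1" | "s = - gen1"
    using assms(2) by (auto simp: letters_def)
  then show ?thesis
  proof cases
    case 1
    let ?d = "((?ls @ [t], r, rs), Q)"
    have "reduced ?d" using d(1) move_reduced by blast
    moreover have "pair_elt ?d = s + pair_elt d" using pair_elt_move d(2) 1 by metis
    moreover have "pair_weight ?d \<le> pair_weight d + 1" using pair_weight_move_abs[OF d(1)] d(3) by linarith
    ultimately show ?thesis by blast
  next
    case 2
    let ?d = "((ls, l, t # r # rs), Q)"
    have red: "reduced ?d" using d(1) move_reduced by blast
    moreover have "pair_elt ?d = s + pair_elt d"
      using pair_elt_move[of ls l t "r # rs" Q] d(2) 2 by (metis minus_add_cancel)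
    moreover have "pair_weight ?d \<le> pair_weight d + 1" using pair_weight_move_abs[OF red] d(3) by linarith
    ultimately show ?thesis by blast
  next
    case 3
    show ?thesis
    proof (cases "t = Lf \<and> r = Lf \<and> exposed (gap_labels Q) (length (left_gaps ?ls))")
      case True
      then obtain Q' where Q': "Q = split_forest (length (left_gaps ?ls)) Q'"
        "length (left_gaps ?ls) \<le> length (gap_labels Q')" using forest_unsplit by blast
      have "length (gap_labels Q) = Suc (length (gap_labels Q'))"
        unfolding Q'(1) gap_labels_split[OF Q'(2)] by simp
      then have len: "length (gap_labels (?ls, Lf, rs)) = length (gap_labels Q')"
        using d(1) True by (simp add: reduced_iff)
      let ?d = "((?ls, Lf, rs), Q')"
      note c = cancel[OF len, folded Q'(1)]
      have "reduced ?d" using c(1) d(1) True by simp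
      moreover have "pair_elt ?d = s + pair_elt d" using c(3) d(2) True 3 by simp
      moreover have "pair_weight ?d \<le> pair_weight d + 1" using c(2) d(3) True by simp
      ultimately show ?thesis by blast
    next
      case False
      let ?d = "((?ls, Nd t r, rs), Q)"
      have "reduced ?d" using join_reduced[OF d(1) False] .
      moreover have "pair_elt ?d = s + pair_elt d" using pair_elt_join d(2) 3 by metis
      moreover have "pair_weight ?d \<le> pair_weight d + 1" using pair_weight_join_abs[OF d(1)] d(3) by linarith
      ultimately show ?thesis by blast
    qed
  next
    case 4
    show ?thesis
    proof (cases t)
      case Lf
      let ?d = "((?ls, Lf, Lf # r # rs), split_forest (length (left_gaps ?ls)) Q)"
      have "length (gap_labels (?ls, Lf, r # rs)) = length (gap_labels Q)"
        using d(1) Lf by (simp add: reduced_iff)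
      note c = cancel[OF this]
      have "reduced ?d" using c(1) d(1) Lf by blast
      moreover have "pair_elt ?d = s + pair_elt d" using c(3) d(2) Lf 4 by (metis minus_add_cancel)
      moreover have "pair_weight ?d \<le> pair_weight d + 1" using c(2) d(3) Lf by simp
      ultimately show ?thesis by blast
    next
      case (Nd a b)
      let ?d = "((?ls, a, b # r # rs), Q)"
      have red: "reduced ?d" using d(1) unjoin_reduced Nd by blast
      moreover have "pair_elt ?d = s + pair_elt d"
        using pair_elt_join[of ?ls a b "r # rs" Q] d(2) 4 Nd by (metis minus_add_cancel)
      moreover have "pair_weight ?d \<le> pair_weight d + 1" using pair_weight_join_abs[OF red] d(3)[unfolded Nd] by linarith
      ultimately show ?thesis by blast
    qed
  qed
qed

lemma gap_labels_no_caret: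
  assumes "LabI \<notin> set (gap_labels P)"
  shows "\<exists>m n. P = (replicate m Lf, Lf, replicate n Lf)"
proof -
  obtain ls t rs where P: "P = (ls, t, rs)" by (cases P)
  have gaps: "t = Lf" if "LabI \<notin> set (gaps t)" for t
    using that last_gaps[of t] last_in_set[of "gaps t"] by metis
  have "ls = replicate (length ls) Lf" if "LabI \<notin> set (left_gaps ls)" for ls
    using that gaps by (induction ls) auto
  moreover have "rs = replicate (length rs) Lf" if "LabI \<notin> set (right_gaps rs)" for rs
    using that gaps by (induction rs) auto
  moreover have "LabI \<notin> set (left_gaps ls)" "LabI \<notin> set (gaps t)" "LabI \<notin> set (right_gaps rs)"
    using assms by (simp_all add: P)
  ultimately have "P = (replicate (length ls) Lf, Lf, replicate (length rs) Lf)"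
    using gaps unfolding P by blast
  then show ?thesis by blast
qed

lemma left_gaps_replicate: "left_gaps (replicate m Lf) = replicate m LabL"
  by (induction m) auto

lemma right_gaps_replicate: "right_gaps (replicate m Lf) = replicate m LabR"
  by (induction m) auto

lemma gap_labels_eq_no_caret:
  assumes "gap_labels P = gap_labels Q" "LabI \<notin> set (gap_labels P)"
  shows "P = Q"
proof -
  obtain m n k l where PQ: "P = (replicate m Lf, Lf, replicate n Lf)" "Q = (replicate k Lf, Lf, replicate l Lf)"
    using assms gap_labels_no_caret by metis
  then have *: "replicate m LabL @ replicate n LabR = replicate k LabL @ replicate l LabR"
    using assms(1) by (simp add: left_gaps_replicate right_gaps_replicate)
  from arg_cong[OF *, of "filter ((=) LabL)"] arg_cong[OF *, of "filter ((=) LabR)"]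
  have "m = k" "n = l" by (simp_all add: filter_replicate)
  then show ?thesis using PQ by simp
qed

text \<open>
  Let \<open>y\<close> and \<open>z\<close> be the lower labels of the gaps to the right and to the left of the current tree
  \<open>t\<close>. If moving the pointer to the right does not lower the weight, then \<open>y\<close> is \<open>L\<close>, or it is \<open>I\<close> below
  an upper \<open>R\<close>, or it is \<open>R\<close> and padding starts there. If \<open>t\<close> has a caret, then removing its root
  lowers the weight. If \<open>t\<close> is a leaf, then moving to the left does, except in two cases: for
  \<open>y = I\<close> after \<open>z \<noteq> I\<close> joining \<open>t\<close> to the next tree cancels a caret, and when all columns are padding the
  element is the identity. That moving left helps depends on which lower labels can be adjacent.
\<close>

lemma decreasing_letter:
  assumes "reduced d" "pair_elt d \<noteq> 0"
  shows "\<exists>d' s. s \<in> letters \<and> reduced d' \<and> pair_elt d' = s + pair_elt d \<and> pair_weight d' = pair_weight d - 1"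
proof -
  obtain ls l t r rs Q where d: "reduced ((ls @ [l], t, r # rs), Q)"
    "pair_elt ((ls @ [l], t, r # rs), Q) = pair_elt d" "pair_weight ((ls @ [l], t, r # rs), Q) = pair_weight d"
    using padded_pair[OF assms(1)] .
  let ?ls = "ls @ [l]"
  let ?u = "left_gaps ls @ gaps l" and ?v = "gaps r @ right_gaps rs"
  let ?x = "if r = Lf then LabR else LabX"
  have "length ((?u @ LabL # gaps t) @ ?x # ?v) = length (gap_labels Q)"
    using d(1) by (simp add: reduced_iff left_gaps_append)
  from split_at_length[OF this] obtain b0 y b' where
    B0: "gap_labels Q = b0 @ y # b'" "length b0 = length (?u @ LabL # gaps t)" "length b' = length ?v" by blast
  from split_at_length[OF B0(2)[symmetric]] obtain b z bt where
    B: "b0 = b @ z # bt" "length b = length ?u" "length bt = length (gaps t)" by blast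
  \<comment> \<open>the change caused by moving the pointer to the right\<close>
  have right: "pair_weight ((?ls @ [t], r, rs), Q) - pair_weight d =
    (if y = LabN \<or> y = LabX \<or> (y = LabR \<and> \<not> (r = Lf \<and> set (zip ?v b') \<subseteq> {RR}))
       \<or> (y = LabI \<and> r \<noteq> Lf) \<or> (y = LabL \<and> set (zip (?u @ LabL # gaps t) b0) \<subseteq> {LL}) then - 1 else 1)"
    using pair_weight_move[OF d(1) B0(1)] B0(2) d(3) by (simp add: left_gaps_append)
  show ?thesis
  proof (cases "pair_weight ((?ls @ [t], r, rs), Q) - pair_weight d = - 1")
    case True
    have "reduced ((?ls @ [t], r, rs), Q)" using d(1) move_reduced by blast
    moreover have "pair_elt ((?ls @ [t], r, rs), Q) = gen0 + pair_elt d"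
      using pair_elt_move d(2) by metis
    moreover have "pair_weight ((?ls @ [t], r, rs), Q) = pair_weight d - 1" using True by linarith
    ultimately show ?thesis unfolding letters_def by blast
  next
    case False
    then have not: "y \<noteq> LabN" "y \<noteq> LabX" "y = LabR \<Longrightarrow> r = Lf \<and> set (zip ?v b') \<subseteq> {RR}"
      "y = LabI \<Longrightarrow> r = Lf" "y = LabL \<Longrightarrow> \<not> set (zip (?u @ LabL # gaps t) b0) \<subseteq> {LL}"
      using right by (auto split: if_splits)
    show ?thesis
    proof (cases t)
      case (Nd a c)
      let ?d = "((?ls, a, c # r # rs), Q)"
      have red: "reduced ?d" using d(1) unjoin_reduced Nd by blast
      have elt: "pair_elt ?d = - gen1 + pair_elt d"
        using pair_elt_join[of ?ls a c "r # rs" Q] d(2) Nd by (metis minus_add_cancel)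
      have "length (gaps a @ (if c = Lf then LabI else LabN) # gaps c) = length bt" using B(3) Nd by simp
      from split_at_length[OF this] obtain ba w bc where
        bt: "bt = ba @ w # bc" "length ba = length (gaps a)" "length bc = length (gaps c)" by blast
      have "gap_labels Q = (b @ z # ba) @ w # (bc @ y # b')" by (simp add: B0 B bt)
      then have join: "pair_weight d - pair_weight ?d = (if c = Lf \<and> w = LabR \<and>
            \<not> set (zip (gaps c @ right_gaps (r # rs)) (bc @ y # b')) \<subseteq> {RR} then - 1 else 1)"
        using pair_weight_join[OF red, of "b @ z # ba" w "bc @ y # b'"] B(2) bt(2) d(3)[unfolded Nd]
        by (simp add: left_gaps_append)
      \<comment> \<open>removing the root fails to help only above a lower R that is not followed by padding;
        but the gap after t is padding if the lower label before it is R\<close>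
      have "set (zip (gaps c @ right_gaps (r # rs)) (bc @ y # b')) \<subseteq> {RR}"
        if c: "c = Lf" "w = LabR"
      proof -
        have "gap_labels Q = (b @ z # ba) @ LabR # y # b'" using B0 B bt c by simp
        then have "y = LabR \<or> y = LabX" using follows_gap_labels by fastforce
        then have "y = LabR" "r = Lf" "set (zip ?v b') \<subseteq> {RR}" using not by auto
        then show "set (zip (gaps c @ right_gaps (r # rs)) (bc @ y # b')) \<subseteq> {RR}"
          using c bt by auto
      qed
      then have "pair_weight ?d = pair_weight d - 1" using join by (auto split: if_splits)
      then show ?thesis using red elt unfolding letters_def by blast
    next
      case Lf
      then have bt: "bt = []" using B(3) by simp
      have labsQ: "gap_labels Q = b @ z # y # b'" using B0 B bt by simp
      let ?d = "((ls, l, t # r # rs), Q)"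
      have red: "reduced ?d" using d(1) move_reduced by blast
      have elt: "pair_elt ?d = - gen0 + pair_elt d"
        using pair_elt_move[of ls l t "r # rs" Q] d(2) by (metis minus_add_cancel)
      have left: "pair_weight d - pair_weight ?d = (if z = LabN \<or> z = LabX
          \<or> (z = LabR \<and> \<not> set (zip (?x # ?v) (y # b')) \<subseteq> {RR})
          \<or> (z = LabL \<and> set (zip ?u b) \<subseteq> {LL}) then - 1 else 1)"
        using pair_weight_move[OF red labsQ] B(2) d(3) Lf by simp
      have zy: "follows z y" using follows_gap_labels[OF labsQ] .
      have goal_left: ?thesis if "pair_weight d - pair_weight ?d = 1"
      proof -
        have "pair_weight ?d = pair_weight d - 1" using that by linarith
        then show ?thesis using red elt unfolding letters_def by blast
      qed
      have yRR: "set (zip (?x # ?v) (y # b')) \<subseteq> {RR}" if "y = LabR"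
        using not(3)[OF that] that by auto
      consider "y = LabL" | "y = LabI" | "y = LabR" using not by (cases y) auto
      then show ?thesis
      proof cases
        case 1
        then have "z = LabL \<or> z = LabI" using zy by (cases z) auto
        moreover have "\<not> (z = LabL \<and> set (zip ?u b) \<subseteq> {LL})"
          using not(5)[OF 1] B(1,2) bt Lf zip_append[of ?u b "[LabL]" "[z]"] by auto
        ultimately show ?thesis using left by (intro goal_left) auto
      next
        case 3
        then have z: "z = LabR \<or> z = LabI \<or> z = LabL" using zy by (cases z) auto
        show ?thesis
        proof (cases "z = LabL \<and> set (zip ?u b) \<subseteq> {LL}")
          case True
          have "zip (gap_labels (?ls, t, r # rs)) (gap_labels Q) = zip ?u b @ (LabL, z) # zip (?x # ?v) (y # b')"
            using zip_append[of ?u b "LabL # ?x # ?v" "z # y # b'"] B(2) labsQ Lf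
            by (simp add: left_gaps_append)
          then have "set (zip (gap_labels (?ls, t, r # rs)) (gap_labels Q)) \<subseteq> {LL, RR}"
            using True yRR[OF 3] by (auto simp del: gap_labels.simps zip_Cons_Cons)
          moreover have len: "length (gap_labels (?ls, t, r # rs)) = length (gap_labels Q)"
            using d(1) by (simp add: reduced_iff)
          ultimately have "gap_labels (?ls, t, r # rs) ! i = gap_labels Q ! i \<and> gap_labels (?ls, t, r # rs) ! i \<noteq> LabI"
            if "i < length (gap_labels Q)" for i
            using that by (fastforce simp: set_zip)
          then have "gap_labels (?ls, t, r # rs) = gap_labels Q" "LabI \<notin> set (gap_labels (?ls, t, r # rs))"
            using len by (metis nth_equalityI, metis in_set_conv_nth)
          then have "(?ls, t, r # rs) = Q" by (rule gap_labels_eq_no_caret)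
          then have "pair_elt ((?ls, t, r # rs), Q) = 0" by simp
          then show ?thesis using d(2) assms(2) by simp
        next
          case False
          then show ?thesis using z left yRR[OF 3] by (intro goal_left) auto
        qed
      next
        case 2
        show ?thesis
        proof (cases "z = LabI")
          case True
          then show ?thesis using left by (intro goal_left) auto
        next
          case False
          have "exposed (gap_labels Q) (length (b @ [z]))"
            using exposed_at[of "b @ [z]" y b'] labsQ 2 False by simp
          moreover have "length (b @ [z]) = length (left_gaps ?ls)" using B(2) by (simp add: left_gaps_append)
          ultimately have "exposed (gap_labels Q) (length (left_gaps ?ls))" by simp
          then obtain Q' where Q': "Q = split_forest (length (left_gaps ?ls)) Q'"
            "length (left_gaps ?ls) \<le> length (gap_labels Q')" using forest_unsplit by blast
          have tr: "t = Lf" "r = Lf" using Lf not(4) 2 by auto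
          have "length (gap_labels Q) = Suc (length (gap_labels Q'))"
            unfolding Q'(1) gap_labels_split[OF Q'(2)] by simp
          then have len: "length (gap_labels (?ls, Lf, rs)) = length (gap_labels Q')"
            using d(1) tr by (simp add: reduced_iff)
          note c = cancel[OF len, folded Q'(1)]
          have "reduced ((?ls, Lf, rs), Q')" using c(1) d(1) tr by simp
          moreover have "pair_elt ((?ls, Lf, rs), Q') = gen1 + pair_elt d" using c(3) d(2) tr by simp
          moreover have "pair_weight ((?ls, Lf, rs), Q') = pair_weight d - 1" using c(2) d(3) tr by simp
          ultimately show ?thesis unfolding letters_def by blast
        qed
      qed
    qed
  qed
qed

section \<open>Word length\<close>

lemma pair_weight_nonneg: "0 \<le> pair_weight d"
  by (cases d) (simp add: net_weight_nonneg)

lemma pad_left_inj: "pad_left P = pad_left P' \<longleftrightarrow> P = P'"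
  by (cases P; cases P') auto

lemma pad_right_inj: "pad_right P = pad_right P' \<longleftrightarrow> P = P'"
  by (cases P; cases P') auto

definition pad :: "nat \<Rightarrow> nat \<Rightarrow> forest \<times> forest \<Rightarrow> forest \<times> forest" where
  "pad i j d = (pad_left_pair ^^ i) ((pad_right_pair ^^ j) d)"

lemma pad:
  assumes "reduced d"
  shows "reduced (pad i j d)" "pair_elt (pad i j d) = pair_elt d" "pair_weight (pad i j d) = pair_weight d"
proof -
  have 1: "reduced ((pad_right_pair ^^ j) d) \<and> pair_elt ((pad_right_pair ^^ j) d) = pair_elt d
      \<and> pair_weight ((pad_right_pair ^^ j) d) = pair_weight d"
    using assms by (induction j) (auto simp: pad_right_pair)
  have "reduced (pad i j d) \<and> pair_elt (pad i j d) = pair_elt d \<and> pair_weight (pad i j d) = pair_weight d"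
    unfolding pad_def using 1 by (induction i) (auto simp: pad_left_pair)
  then show "reduced (pad i j d)" "pair_elt (pad i j d) = pair_elt d" "pair_weight (pad i j d) = pair_weight d"
    by auto
qed

lemma pad_window:
  "length (fst (fst (pad i j d))) = length (fst (fst d)) + i"
  "length (snd (snd (fst (pad i j d)))) = length (snd (snd (fst d))) + j"
proof -
  have 1: "length (fst (fst ((pad_right_pair ^^ j) d))) = length (fst (fst d)) \<and>
     length (snd (snd (fst ((pad_right_pair ^^ j) d)))) = length (snd (snd (fst d))) + j"
  proof (induction j)
    case (Suc j)
    obtain ls t rs Q where "(pad_right_pair ^^ j) d = ((ls, t, rs), Q)" by (metis surj_pair)
    with Suc show ?case by simp
  qed simp
  have "length (fst (fst (pad i j d))) = length (fst (fst d)) + i \<and>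
    length (snd (snd (fst (pad i j d)))) = length (snd (snd (fst d))) + j"
  proof (induction i)
    case (Suc i)
    obtain ls t rs Q where "pad i j d = ((ls, t, rs), Q)" by (metis surj_pair)
    with Suc show ?case by (simp add: pad_def)
  qed (use 1 in \<open>simp add: pad_def\<close>)
  then show "length (fst (fst (pad i j d))) = length (fst (fst d)) + i"
    "length (snd (snd (fst (pad i j d)))) = length (snd (snd (fst d))) + j" by auto
qed

lemma reduced_unique_up_to_padding:
  assumes "reduced d" "reduced d'" "pair_elt d = pair_elt d'"
  shows "\<exists>i j i' j'. pad i j d = pad i' j' d'"
proof -
  let ?i' = "length (fst (fst d))" and ?j' = "length (snd (snd (fst d)))"
  let ?i = "length (fst (fst d'))" and ?j = "length (snd (snd (fst d')))"
  obtain P Q P' Q' where PQ: "pad ?i ?j d = (P, Q)" "pad ?i' ?j' d' = (P', Q')" by (metis surj_pair)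
  have "(P, Q) = (P', Q')"
  proof (rule reduced_pair_unique)
    show "reduced (P, Q)" "reduced (P', Q')" "pair_elt (P, Q) = pair_elt (P', Q')"
      using pad[OF assms(1), of ?i ?j] pad[OF assms(2), of ?i' ?j'] assms(3) PQ by auto
    show "length (fst P) = length (fst P')" "length (snd (snd P)) = length (snd (snd P'))"
      using pad_window[of ?i ?j d] pad_window[of ?i' ?j' d'] PQ by auto
  qed
  then show ?thesis using PQ by metis
qed

lemma abs_thompson_simps:
  "abs_thompson [] = 0" "abs_thompson (u @ v) = abs_thompson u + abs_thompson v"
  by (simp_all add: zero_thompson_def plus_thompson.abs_eq)

lemma abs_letter: "abs_thompson [a] \<in> letters"
proof -
  have "gen0 = abs_thompson [(x0, True)]" "gen1 = abs_thompson [(x1, True)]"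
    by (simp_all add: gen0_def gen1_def)
  moreover have "- gen0 = abs_thompson [(x0, False)]" "- gen1 = abs_thompson [(x1, False)]"
    by (simp_all add: gen0_def gen1_def uminus_thompson.abs_eq inv_word_def)
  moreover obtain x e where "a = (x, e)" by (cases a)
  ultimately show ?thesis unfolding letters_def by (cases x; cases e) auto
qed

lemma letter_is_abs: "s \<in> letters \<Longrightarrow> \<exists>a. abs_thompson [a] = s"
proof -
  have "gen0 = abs_thompson [(x0, True)]" "gen1 = abs_thompson [(x1, True)]"
    by (simp_all add: gen0_def gen1_def)
  moreover have "- gen0 = abs_thompson [(x0, False)]" "- gen1 = abs_thompson [(x1, False)]"
    by (simp_all add: gen0_def gen1_def uminus_thompson.abs_eq inv_word_def)
  moreover assume "s \<in> letters"
  ultimately show ?thesis unfolding letters_def by (metis insertE emptyE)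
qed

lemma abs_Cons: "abs_thompson (a # w) = abs_thompson [a] + abs_thompson w"
  using abs_thompson_simps(2)[of "[a]" w] by simp

lemma word_to_pair: "\<exists>d. reduced d \<and> pair_elt d = abs_thompson w \<and> pair_weight d \<le> int (length w)"
proof (induction w)
  case Nil
  have "reduced (([], Lf, []), ([], Lf, []))" "pair_elt (([], Lf, []), ([], Lf, [])) = 0"
    "pair_weight (([], Lf, []), ([], Lf, [])) = 0"
    by (simp_all add: reduced_def exposed_def net_weight_def)
  then show ?case
    by (intro exI[of _ "(([], Lf, []), ([], Lf, []))"])
       (simp del: pair_elt.simps pair_weight.simps add: abs_thompson_simps)
next
  case (Cons a w)
  then obtain d where d: "reduced d" "pair_elt d = abs_thompson w" "pair_weight d \<le> int (length w)" by blast
  from letter_step[OF d(1) abs_letter[of a]] obtain d' where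
    "reduced d'" "pair_elt d' = abs_thompson [a] + pair_elt d" "pair_weight d' \<le> pair_weight d + 1" by blast
  then have "reduced d' \<and> pair_elt d' = abs_thompson (a # w) \<and> pair_weight d' \<le> int (length (a # w))"
    using d abs_Cons[of a w] by simp
  then show ?case by blast
qed

lemma pair_to_word: "reduced d \<Longrightarrow> \<exists>w. abs_thompson w = pair_elt d \<and> int (length w) \<le> pair_weight d"
proof (induction "nat (pair_weight d)" arbitrary: d rule: less_induct)
  case less
  show ?case
  proof (cases "pair_elt d = 0")
    case True
    then show ?thesis using pair_weight_nonneg[of d]
      by (intro exI[of _ "[]"]) (simp add: abs_thompson_simps)
  next
    case False
    from decreasing_letter[OF less.prems False] obtain d' s where
      s: "s \<in> letters" "reduced d'" "pair_elt d' = s + pair_elt d" "pair_weight d' = pair_weight d - 1" by blast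
    have "nat (pair_weight d') < nat (pair_weight d)" using s(4) pair_weight_nonneg[of d'] by linarith
    from less.hyps[OF this s(2)] obtain w where
      w: "abs_thompson w = pair_elt d'" "int (length w) \<le> pair_weight d'" by blast
    have "- s \<in> letters" using s(1) by (auto simp: letters_def)
    then obtain a where a: "abs_thompson [a] = - s" using letter_is_abs by blast
    have "abs_thompson (a # w) = pair_elt d"
      unfolding abs_Cons[of a w] a w s(3) by simp
    then show ?thesis using w(2) s(4) by (intro exI[of _ "a # w"]) simp
  qed
qed

lemma abs_eq_iff: "abs_thompson u = abs_thompson v \<longleftrightarrow> word_class thompson_relators u = word_class thompson_relators v"
  unfolding word_class_eq_iff by (rule thompson.abs_eq_iff)

text \<open>
  Fordham's criterion. The weight is at most the length of any word because each letter adds at most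
  1 and the weight does not depend on the choice of the reduced pair; following decreasing letters
  yields a word whose length is at most the weight.
\<close>

lemma geodesic_length_pair:
  assumes "reduced d" "pair_elt d = abs_thompson w"
  shows "int (geodesic_length (word_class thompson_relators w)) = pair_weight d"
proof -
  obtain v where v: "abs_thompson v = pair_elt d" "int (length v) \<le> pair_weight d"
    using pair_to_word[OF assms(1)] by blast
  have lower: "pair_weight d \<le> int (length u)" if "abs_thompson u = pair_elt d" for u
  proof -
    obtain d' where d': "reduced d'" "pair_elt d' = abs_thompson u" "pair_weight d' \<le> int (length u)"
      using word_to_pair by blast
    have "pair_elt d = pair_elt d'" using d'(2) that by simp
    from reduced_unique_up_to_padding[OF assms(1) d'(1) this]
    obtain i j i' j' where "pad i j d = pad i' j' d'" by blast
    then have "pair_weight d = pair_weight d'"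
      using pad(3)[OF assms(1), of i j] pad(3)[OF d'(1), of i' j'] by simp
    then show ?thesis using d' by simp
  qed
  have "geodesic_length (word_class thompson_relators w) = length v"
    unfolding geodesic_length_def
  proof (rule Least_equality)
    have "abs_thompson w = abs_thompson v" using v assms(2) by simp
    then show "\<exists>u. length u = length v \<and> represents u (word_class thompson_relators w)"
      by (auto simp: represents_def abs_eq_iff)
    show "length v \<le> k" if k: "\<exists>u. length u = k \<and> represents u (word_class thompson_relators w)" for k
    proof -
      obtain u where u: "length u = k" "represents u (word_class thompson_relators w)" using k by blast
      then have "abs_thompson u = pair_elt d" using assms(2) by (simp add: represents_def abs_eq_iff[symmetric])
      then show ?thesis using lower v(2) u(1) by force
    qed
  qed
  then show ?thesis using v lower[OF v(1)] by simp
qed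

section \<open>Forests as walks through the states\<close>

text \<open>
  The tree \<open>u\<close> with its leftmost leaf replaced by a caret whose right child is \<open>r\<close>. In symmetric order
  this caret comes first, then those of \<open>r\<close>, then those of \<open>u\<close>. Every nontrivial tree is of this form
  in exactly one way.
\<close>

fun push :: "tree \<Rightarrow> tree \<Rightarrow> tree" where
  "push r Lf = Nd Lf r"
| "push r (Nd a b) = Nd (push r a) b"

lemma push_neq_Lf [simp]: "push r u \<noteq> Lf" "Lf \<noteq> push r u"
  by (cases u; simp)+

lemma gaps_push: "gaps (push r u) = (if r = Lf then LabI else LabN) # gaps r @ gaps u"
  by (induction u) auto

lemma push_inject [simp]: "push r u = push r' u' \<longleftrightarrow> r = r' \<and> u = u'"
proof (induction u arbitrary: u')
  case Lf
  then show ?case by (cases u') auto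
next
  case (Nd a b)
  then show ?case by (cases u') auto
qed

declare push.simps [simp del]

lemma push_cases: "t \<noteq> Lf \<Longrightarrow> \<exists>r u. t = push r u"
proof (induction t)
  case (Nd a b)
  show ?case
  proof (cases "a = Lf")
    case True
    then show ?thesis by (metis push.simps(1))
  next
    case False
    then show ?thesis using Nd by (metis push.simps(2))
  qed
qed simp

text \<open>
  The part of a forest that is still to be read: first the trees on the stack, all of them
  nontrivial, then a pointed forest.
\<close>

type_synonym remainder = "tree list \<times> forest"

definition side_of :: "tree list \<Rightarrow> side" where
  "side_of ls = (if ls = [] then RightSide else LeftSide)"

text \<open>
  Reading one gap. Behind the first caret of a tree \<open>push r u\<close> the trees \<open>r\<close> and \<open>u\<close> are left, and the
  nontrivial ones among them are put on the stack; the state records the new height of the stack as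
  its excess. If the stack is empty, then \<open>u\<close> may be trivial and stays in its place in the forest.
\<close>

inductive step :: "remainder \<Rightarrow> forest_state \<Rightarrow> remainder \<Rightarrow> bool" where
  pop: "step (push Lf Lf # hs, ls, f) (LabI, side_of ls, length hs) (hs, ls, f)"
| pop_push1: "u \<noteq> Lf \<Longrightarrow> step (push Lf u # hs, ls, f) (LabI, side_of ls, Suc (length hs)) (u # hs, ls, f)"
| pop_push2: "r \<noteq> Lf \<Longrightarrow> step (push r Lf # hs, ls, f) (LabN, side_of ls, Suc (length hs)) (r # hs, ls, f)"
| push_both: "r \<noteq> Lf \<Longrightarrow> u \<noteq> Lf \<Longrightarrow>
    step (push r u # hs, ls, f) (LabN, side_of ls, Suc (Suc (length hs))) (r # u # hs, ls, f)"
| leftL: "step ([], Lf # ls, f) (LabL, LeftSide, 0) ([], ls, f)"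
| leftI: "step ([], push Lf u # ls, f) (LabI, LeftSide, 0) ([], u # ls, f)"
| leftN: "r \<noteq> Lf \<Longrightarrow> step ([], push r u # ls, f) (LabN, LeftSide, Suc 0) ([r], u # ls, f)"
| rightR: "step ([], [], Lf, Lf # rs) (LabR, RightSide, 0) ([], [], Lf, rs)"
| rightX: "u \<noteq> Lf \<Longrightarrow> step ([], [], Lf, u # rs) (LabX, RightSide, 0) ([], [], u, rs)"
| rightI: "step ([], [], push Lf u, rs) (LabI, RightSide, 0) ([], [], u, rs)"
| rightN: "r \<noteq> Lf \<Longrightarrow> step ([], [], push r u, rs) (LabN, RightSide, Suc 0) ([r], [], u, rs)"

abbreviation exhausted :: remainder where "exhausted \<equiv> ([], [], Lf, [])"

fun compatible :: "forest_state \<Rightarrow> remainder \<Rightarrow> bool" where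
  "compatible (LabL, p, h) (hs, ls, t, rs) \<longleftrightarrow> p = LeftSide \<and> h = 0 \<and> hs = []"
| "compatible (LabR, p, h) (hs, ls, t, rs) \<longleftrightarrow> p = RightSide \<and> h = 0 \<and> hs = [] \<and> ls = [] \<and> t = Lf"
| "compatible (LabX, p, h) (hs, ls, t, rs) \<longleftrightarrow> p = RightSide \<and> h = 0 \<and> hs = [] \<and> ls = [] \<and> t \<noteq> Lf"
| "compatible (LabN, p, h) (hs, ls, t, rs) \<longleftrightarrow>
     p = side_of ls \<and> h = length hs \<and> Lf \<notin> set hs \<and> hs \<noteq> []"
| "compatible (LabI, p, h) (hs, ls, t, rs) \<longleftrightarrow> p = side_of ls \<and> h = length hs \<and> Lf \<notin> set hs"

fun remaining_labels :: "remainder \<Rightarrow> label list" where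
  "remaining_labels (hs, f) = concat (map gaps hs) @ gap_labels f"

lemma step_labels: "step \<rho> \<tau> \<rho>' \<Longrightarrow> remaining_labels \<rho> = label_of \<tau> # remaining_labels \<rho>'"
  by (induction rule: step.induct) (auto simp: gaps_push)

lemma step_compatible: "step \<rho> \<tau> \<rho>' \<Longrightarrow> compatible \<sigma> \<rho> \<Longrightarrow> compatible \<tau> \<rho>'"
  by (induction rule: step.induct; cases \<sigma>; cases "fst \<sigma>") (auto simp: side_of_def)

lemma step_transition: "step \<rho> \<tau> \<rho>' \<Longrightarrow> compatible \<sigma> \<rho> \<Longrightarrow> \<tau> \<in> set (transitions \<sigma>)"
  by (induction rule: step.induct; cases \<sigma>; cases "fst \<sigma>") (auto simp: side_of_def split: if_splits)

lemma exhausted_transition: "compatible \<sigma> exhausted \<Longrightarrow> end_state \<in> set (transitions \<sigma>)"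
  by (cases \<sigma>; cases "fst \<sigma>") (auto simp: side_of_def)

lemma transition_exhausted: "end_state \<in> set (transitions \<sigma>) \<Longrightarrow> compatible \<sigma> exhausted"
  by (cases \<sigma> rule: transitions.cases) (auto simp: side_of_def)

lemma not_step_exhausted: "\<not> step exhausted \<tau> \<rho>'"
  by (auto elim: step.cases)

lemma step_deterministic: "step \<rho> \<tau> \<rho>1 \<Longrightarrow> step \<rho> \<tau>' \<rho>2 \<Longrightarrow> \<tau> = \<tau>' \<and> \<rho>1 = \<rho>2"
  by (induction rule: step.induct; erule step.cases; simp)

lemma step_total:
  assumes "compatible \<sigma> \<rho>" "\<rho> \<noteq> exhausted"
  shows "\<exists>\<tau> \<rho>'. step \<rho> \<tau> \<rho>'"
proof -
  obtain hs ls t rs where \<rho>: "\<rho> = (hs, ls, t, rs)" by (cases \<rho>)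
  have hs: "Lf \<notin> set hs" using assms(1) unfolding \<rho> by (cases \<sigma>; cases "fst \<sigma>") auto
  show ?thesis
  proof (cases hs)
    case (Cons T hs')
    then obtain r u where "T = push r u" using push_cases[of T] hs by auto
    then show ?thesis unfolding \<rho> Cons by (cases "r = Lf"; cases "u = Lf") (blast intro: step.intros)+
  next
    case Nil
    show ?thesis
    proof (cases ls)
      case (Cons T ls')
      show ?thesis
      proof (cases "T = Lf")
        case True
        then show ?thesis unfolding \<rho> Nil Cons by (blast intro: step.intros)
      next
        case False
        then obtain r u where "T = push r u" using push_cases by blast
        then show ?thesis unfolding \<rho> Nil Cons by (cases "r = Lf") (blast intro: step.intros)+
      qed
    next
      case ls: Nil
      show ?thesis
      proof (cases "t = Lf")
        case True
        then obtain u rs' where "rs = u # rs'" using assms(2) by (cases rs) (auto simp: \<rho> Nil ls)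
        then show ?thesis unfolding \<rho> Nil ls True by (cases "u = Lf") (blast intro: step.intros)+
      next
        case False
        then obtain r u where "t = push r u" using push_cases by blast
        then show ?thesis unfolding \<rho> Nil ls by (cases "r = Lf") (blast intro: step.intros)+
      qed
    qed
  qed
qed

text \<open>
  Together with \<open>step_injective\<close> this says that a transition and the remainder after it
  determine the remainder before it. The state \<open>\<sigma>\<close> is needed for this: the remainder after the
  transition does not show whether the tree just read was on the stack or in the forest.
\<close>

lemma step_backward:
  assumes "\<tau> \<in> set (transitions \<sigma>)" "compatible \<tau> \<rho>'"
  shows "\<exists>\<rho>. compatible \<sigma> \<rho> \<and> step \<rho> \<tau> \<rho>'"
proof -
  obtain hs ls t rs where \<rho>': "\<rho>' = (hs, ls, t, rs)" by (cases \<rho>')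
  have inner: ?thesis if \<sigma>: "\<sigma> = (l, p, Suc h)" "l = LabN \<or> l = LabI" for l p h
  proof -
    have "\<tau> \<in> {(LabN, p, Suc (Suc h)), (LabN, p, Suc h), (LabI, p, Suc h), (LabI, p, h)}"
      using assms(1) \<sigma> by auto
    then consider "\<tau> = (LabN, p, Suc (Suc h))" | "\<tau> = (LabN, p, Suc h)" | "\<tau> = (LabI, p, Suc h)"
      | "\<tau> = (LabI, p, h)" by blast
    then show ?thesis
    proof cases
      case 1
      then obtain r u hs' where hs: "hs = r # u # hs'" "length hs' = h" "r \<noteq> Lf" "u \<noteq> Lf" "Lf \<notin> set hs'"
        "p = side_of ls"
        using assms(2) unfolding \<rho>' by (cases hs; cases "tl hs") auto
      then have "step (push r u # hs', ls, t, rs) \<tau> \<rho>'" unfolding \<rho>' 1 by (auto intro: step.intros)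
      moreover have "compatible \<sigma> (push r u # hs', ls, t, rs)" using \<sigma> hs by auto
      ultimately show ?thesis by blast
    next
      case 2
      then obtain r hs' where hs: "hs = r # hs'" "length hs' = h" "r \<noteq> Lf" "Lf \<notin> set hs'"
        "p = side_of ls"
        using assms(2) unfolding \<rho>' by (cases hs) auto
      then have "step (push r Lf # hs', ls, t, rs) \<tau> \<rho>'" unfolding \<rho>' 2 by (auto intro: step.intros)
      moreover have "compatible \<sigma> (push r Lf # hs', ls, t, rs)" using \<sigma> hs by auto
      ultimately show ?thesis by blast
    next
      case 3
      then obtain u hs' where hs: "hs = u # hs'" "length hs' = h" "u \<noteq> Lf" "Lf \<notin> set hs'"
        "p = side_of ls"
        using assms(2) unfolding \<rho>' by (cases hs) auto
      then have "step (push Lf u # hs', ls, t, rs) \<tau> \<rho>'" unfolding \<rho>' 3 by (auto intro: step.intros)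
      moreover have "compatible \<sigma> (push Lf u # hs', ls, t, rs)" using \<sigma> hs by auto
      ultimately show ?thesis by blast
    next
      case 4
      then have hs: "length hs = h" "Lf \<notin> set hs" "p = side_of ls"
        using assms(2) unfolding \<rho>' by auto
      then have "step (push Lf Lf # hs, ls, t, rs) \<tau> \<rho>'" unfolding \<rho>' 4 by (auto intro: step.intros)
      moreover have "compatible \<sigma> (push Lf Lf # hs, ls, t, rs)" using \<sigma> hs by auto
      ultimately show ?thesis by blast
    qed
  qed
  have leftL: "step ([], Lf # ls, t, rs) (LabL, LeftSide, 0) \<rho>'" if "hs = []"
    using that \<rho>' by (auto intro: step.intros)
  have leftI: "\<exists>x. step ([], x, t, rs) (LabI, LeftSide, 0) \<rho>' \<and> x \<noteq> []"
    if "compatible (LabI, LeftSide, 0) \<rho>'"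
    using that step.leftI[of "hd ls" "tl ls" "(t, rs)"] \<rho>'
    by (cases ls) (auto simp: side_of_def)
  have leftN: "\<exists>x. step ([], x, t, rs) (LabN, LeftSide, Suc 0) \<rho>' \<and> x \<noteq> []"
    if "compatible (LabN, LeftSide, Suc 0) \<rho>'"
    using that step.leftN[of "hd hs" "hd ls" "tl ls" "(t, rs)"] \<rho>'
    by (cases ls; cases hs) (auto simp: side_of_def)
  have rightI: "\<exists>x. step ([], [], x, rs) (LabI, RightSide, 0) \<rho>' \<and> x \<noteq> Lf"
    if "compatible (LabI, RightSide, 0) \<rho>'"
    using that step.rightI[of t rs] \<rho>'
    by (cases ls) (auto simp: side_of_def)
  have rightN: "\<exists>x. step ([], [], x, rs) (LabN, RightSide, Suc 0) \<rho>' \<and> x \<noteq> Lf"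
    if "compatible (LabN, RightSide, Suc 0) \<rho>'"
    using that step.rightN[of "hd hs" t rs] \<rho>'
    by (cases ls; cases hs) (auto simp: side_of_def)
  have rightR: "step ([], [], Lf, Lf # rs) (LabR, RightSide, 0) \<rho>'"
    if "compatible (LabR, RightSide, 0) \<rho>'"
    using that step.rightR[of rs] \<rho>' by auto
  have rightX: "step ([], [], Lf, t # rs) (LabX, RightSide, 0) \<rho>'"
    if "compatible (LabX, RightSide, 0) \<rho>'"
    using that step.rightX[of t rs] \<rho>' by auto
  have compI: "compatible (LabI, LeftSide, 0) ([], x, t, rs)" if "x \<noteq> []" for x
    using that by (simp add: side_of_def)
  have compI': "compatible (LabI, RightSide, 0) ([], [], x, y)" for x y
    by (simp add: side_of_def)
  have compL: "compatible start_state ([], x)" for x by (cases x) simp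
  have compR: "compatible end_state ([], [], Lf, x)" for x by simp
  have compX: "compatible (LabX, RightSide, 0) ([], [], t, x)" if "t \<noteq> Lf" for t x using that by simp
  show ?thesis
  proof (cases \<sigma> rule: transitions.cases)
    case 1
    then have "\<tau> \<in> {(LabL, LeftSide, 0), (LabN, LeftSide, Suc 0), (LabI, LeftSide, 0),
        (LabN, RightSide, Suc 0), (LabI, RightSide, 0), (LabR, RightSide, 0), (LabX, RightSide, 0)}"
      using assms(1) by auto
    then show ?thesis unfolding 1 using assms(2) compL leftL leftI leftN rightI rightN rightR rightX \<rho>'
      by (elim insertE emptyE) (metis compatible.simps(1))+
  next
    case 2
    then have "\<tau> \<in> {(LabR, RightSide, 0), (LabX, RightSide, 0)}" using assms(1) by auto
    then show ?thesis unfolding 2 using assms(2) compR rightR rightX by (elim insertE emptyE) metis+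
  next
    case 3
    then have "\<tau> \<in> {(LabN, RightSide, Suc 0), (LabI, RightSide, 0)}" using assms(1) by auto
    then show ?thesis unfolding 3 using assms(2) compX rightI rightN by (elim insertE emptyE) metis+
  next
    case 4
    then have "\<tau> \<in> {(LabN, LeftSide, Suc 0), (LabI, LeftSide, 0), (LabL, LeftSide, 0)}"
      using assms(1) by auto
    then show ?thesis unfolding 4 using assms(2) compI leftI leftN leftL \<rho>'
      by (elim insertE emptyE) (metis compatible.simps(1) list.distinct(1))+
  next
    case 5
    then have "\<tau> \<in> {(LabN, RightSide, Suc 0), (LabI, RightSide, 0), (LabR, RightSide, 0), (LabX, RightSide, 0)}"
      using assms(1) by auto
    then show ?thesis unfolding 5 using assms(2) compI' rightI rightN rightR rightX
      by (elim insertE emptyE) metis+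
  next
    case (6 p h)
    then show ?thesis using inner by blast
  next
    case (7 p h)
    then show ?thesis using inner by blast
  qed (use assms(1) in auto)
qed

lemma step_injective:
  "step \<rho>1 \<tau> \<rho>' \<Longrightarrow> step \<rho>2 \<tau> \<rho>' \<Longrightarrow> compatible \<sigma> \<rho>1 \<Longrightarrow> compatible \<sigma> \<rho>2 \<Longrightarrow> \<rho>1 = \<rho>2"
  by (erule step.cases; erule step.cases; clarsimp?; cases \<sigma>; cases "fst \<sigma>";
      clarsimp simp: side_of_def)

fun walk :: "forest_state \<Rightarrow> forest_state list \<Rightarrow> bool" where
  "walk \<sigma> [] \<longleftrightarrow> \<sigma> = end_state"
| "walk \<sigma> (\<tau> # xs) \<longleftrightarrow> \<tau> \<in> set (transitions \<sigma>) \<and> walk \<tau> xs"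

fun encodes :: "remainder \<Rightarrow> forest_state list \<Rightarrow> bool" where
  "encodes \<rho> [] \<longleftrightarrow> False"
| "encodes \<rho> (\<tau> # xs) \<longleftrightarrow>
     \<rho> = exhausted \<and> \<tau> = end_state \<and> xs = [] \<or> (\<exists>\<rho>'. step \<rho> \<tau> \<rho>' \<and> encodes \<rho>' xs)"

lemma encodes_exists: "compatible \<sigma> \<rho> \<Longrightarrow> \<exists>xs. encodes \<rho> xs"
proof (induction "length (remaining_labels \<rho>)" arbitrary: \<sigma> \<rho> rule: less_induct)
  case less
  show ?case
  proof (cases "\<rho> = exhausted")
    case True
    then have "encodes \<rho> [end_state]" by simp
    then show ?thesis by blast
  next
    case False
    then obtain \<tau> \<rho>' where s: "step \<rho> \<tau> \<rho>'" using step_total less.prems by blast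
    have "length (remaining_labels \<rho>') < length (remaining_labels \<rho>)"
      unfolding step_labels[OF s] by simp
    from less.hyps[OF this step_compatible[OF s less.prems]] obtain xs where "encodes \<rho>' xs" ..
    then have "encodes \<rho> (\<tau> # xs)" unfolding encodes.simps using s by blast
    then show ?thesis by blast
  qed
qed

lemma encodes_walk:
  "encodes \<rho> xs \<Longrightarrow> compatible \<sigma> \<rho> \<Longrightarrow> walk \<sigma> xs \<and> map label_of xs = remaining_labels \<rho> @ [LabR]"
proof (induction xs arbitrary: \<sigma> \<rho>)
  case (Cons \<tau> xs)
  then consider "\<rho> = exhausted" "\<tau> = end_state" "xs = []" | \<rho>' where "step \<rho> \<tau> \<rho>'" "encodes \<rho>' xs"
    unfolding encodes.simps by blast
  then show ?case
  proof cases
    case 1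
    then show ?thesis using exhausted_transition Cons.prems(2) by simp
  next
    case 2
    then show ?thesis
      using Cons.IH[OF 2(2) step_compatible[OF 2(1) Cons.prems(2)]]
        step_transition[OF 2(1) Cons.prems(2)] step_labels[OF 2(1)] by simp
  qed
qed simp

lemma encodes_unique: "encodes \<rho> xs \<Longrightarrow> encodes \<rho> ys \<Longrightarrow> xs = ys"
proof (induction xs arbitrary: \<rho> ys)
  case (Cons \<tau> xs)
  obtain \<tau>' ys' where ys: "ys = \<tau>' # ys'" using Cons.prems(2) by (cases ys) auto
  show ?case
  proof (cases "\<rho> = exhausted")
    case True
    then show ?thesis using Cons.prems not_step_exhausted unfolding ys encodes.simps by blast
  next
    case False
    then obtain \<rho>1 \<rho>2 where "step \<rho> \<tau> \<rho>1" "encodes \<rho>1 xs" "step \<rho> \<tau>' \<rho>2" "encodes \<rho>2 ys'"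
      using Cons.prems unfolding ys encodes.simps by blast
    then show ?thesis using step_deterministic Cons.IH unfolding ys by blast
  qed
qed simp

lemma walk_encodes: "walk \<sigma> xs \<Longrightarrow> xs \<noteq> [] \<Longrightarrow> \<exists>\<rho>. compatible \<sigma> \<rho> \<and> encodes \<rho> xs"
proof (induction xs arbitrary: \<sigma>)
  case (Cons \<tau> xs)
  show ?case
  proof (cases "xs = []")
    case True
    then have "\<tau> = end_state" "end_state \<in> set (transitions \<sigma>)" using Cons.prems by auto
    then have "compatible \<sigma> exhausted \<and> encodes exhausted (\<tau> # xs)"
      using True transition_exhausted by simp
    then show ?thesis by blast
  next
    case False
    have "walk \<tau> xs" "\<tau> \<in> set (transitions \<sigma>)" using Cons.prems(1) by simp_all
    from Cons.IH[OF this(1) False] obtain \<rho>' where \<rho>': "compatible \<tau> \<rho>'" "encodes \<rho>' xs" by blast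
    from step_backward[OF \<open>\<tau> \<in> set (transitions \<sigma>)\<close> \<rho>'(1)] obtain \<rho>
      where "compatible \<sigma> \<rho>" "step \<rho> \<tau> \<rho>'" by blast
    then have "compatible \<sigma> \<rho> \<and> encodes \<rho> (\<tau> # xs)" unfolding encodes.simps using \<rho>'(2) by blast
    then show ?thesis by blast
  qed
qed simp

lemma encodes_injective:
  "encodes \<rho>1 xs \<Longrightarrow> encodes \<rho>2 xs \<Longrightarrow> compatible \<sigma> \<rho>1 \<Longrightarrow> compatible \<sigma> \<rho>2 \<Longrightarrow> \<rho>1 = \<rho>2"
proof (induction xs arbitrary: \<sigma> \<rho>1 \<rho>2)
  case (Cons \<tau> xs)
  show ?case
  proof (cases "xs = []")
    case True
    then show ?thesis using Cons.prems by auto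
  next
    case False
    then obtain a b where ab: "step \<rho>1 \<tau> a" "encodes a xs" "step \<rho>2 \<tau> b" "encodes b xs"
      using Cons.prems unfolding encodes.simps by blast
    then have "a = b" using Cons.IH step_compatible Cons.prems(3,4) by blast
    then show ?thesis using ab step_injective Cons.prems(3,4) by blast
  qed
qed simp

definition walk_of :: "forest \<Rightarrow> forest_state list" where
  "walk_of P = (THE xs. encodes ([], P) xs)"

lemma compatible_start [simp]: "compatible start_state ([], P)"
  by (cases P) simp

lemma compatible_start_iff: "compatible start_state \<rho> \<longleftrightarrow> (\<exists>P. \<rho> = ([], P))"
  by (cases \<rho>) auto

lemma encodes_walk_of: "encodes ([], P) (walk_of P)"
  unfolding walk_of_def using encodes_exists[OF compatible_start[of P]] encodes_unique
  by (metis the_equality)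

lemma walk_of:
  "walk start_state (walk_of P)" "map label_of (walk_of P) = gap_labels P @ [LabR]"
  using encodes_walk[OF encodes_walk_of compatible_start] by auto

lemma bij_walk_of: "bij_betw walk_of UNIV {xs. walk start_state xs}"
proof (rule bij_betw_imageI)
  show "inj walk_of"
    using encodes_injective[OF encodes_walk_of, of _ _ start_state] encodes_walk_of
    by (intro injI) (metis compatible_start prod.inject)
  show "range walk_of = {xs. walk start_state xs}"
  proof (intro equalityI subsetI)
    fix xs assume "xs \<in> {xs. walk start_state xs}"
    then have "walk start_state xs" "xs \<noteq> []" by auto
    then obtain \<rho> where \<rho>: "compatible start_state \<rho>" "encodes \<rho> xs" using walk_encodes by blast
    from \<rho>(1) obtain P where "\<rho> = ([], P)" unfolding compatible_start_iff ..
    with \<rho>(2) have "encodes ([], P) xs" by simp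
    then have "xs = walk_of P" using encodes_unique encodes_walk_of by blast
    then show "xs \<in> range walk_of" by blast
  qed (use walk_of in auto)
qed

section \<open>Pairs of walks\<close>

lemma weight_pos: "0 < weight x y"
  by (cases x; cases y) auto

lemma weight_neq_0 [simp]: "weight x y \<noteq> 0"
  using weight_pos[of x y] by simp

lemma weight_le_4: "weight x y \<le> 4"
  by (cases x; cases y) auto

lemma distinct_transitions: "distinct (transitions \<sigma>)"
  by (cases \<sigma> rule: transitions.cases) auto

function completions :: "nat \<Rightarrow> forest_state \<times> forest_state \<Rightarrow> nat" where
  "completions d (\<sigma>, \<tau>) =
     (if d = 0 then (if \<sigma> = end_state \<and> \<tau> = end_state then 1 else 0)
      else (\<Sum>(\<sigma>', \<tau>')\<leftarrow>List.product (transitions \<sigma>) (transitions \<tau>).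
        if common_caret \<sigma> \<tau> \<sigma>' \<tau>' then 0
        else if weight (label_of \<sigma>') (label_of \<tau>') \<le> d
        then completions (d - weight (label_of \<sigma>') (label_of \<tau>')) (\<sigma>', \<tau>') else 0))"
  by pat_completeness auto
termination by (relation "measure fst") (auto simp: weight_pos)

declare completions.simps [simp del]

fun pair_walk :: "nat \<Rightarrow> forest_state \<times> forest_state \<Rightarrow> (forest_state \<times> forest_state) list \<Rightarrow> bool" where
  "pair_walk d (\<sigma>, \<tau>) [] \<longleftrightarrow> d = 0 \<and> \<sigma> = end_state \<and> \<tau> = end_state"
| "pair_walk d (\<sigma>, \<tau>) ((\<sigma>', \<tau>') # zs) \<longleftrightarrow> \<sigma>' \<in> set (transitions \<sigma>) \<and> \<tau>' \<in> set (transitions \<tau>) \<and>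
     \<not> common_caret \<sigma> \<tau> \<sigma>' \<tau>' \<and> weight (label_of \<sigma>') (label_of \<tau>') \<le> d \<and>
     pair_walk (d - weight (label_of \<sigma>') (label_of \<tau>')) (\<sigma>', \<tau>') zs"

lemma completions_eq_card_pair_walks:
  "finite {zs. pair_walk d p zs} \<and> completions d p = card {zs. pair_walk d p zs}"
proof (induction d p rule: completions.induct)
  case (1 d \<sigma> \<tau>)
  show ?case
  proof (cases "d = 0")
    case True
    have "pair_walk 0 (\<sigma>, \<tau>) zs \<longleftrightarrow> zs = [] \<and> \<sigma> = end_state \<and> \<tau> = end_state" for zs
      by (cases zs) auto
    then have "{zs. pair_walk 0 (\<sigma>, \<tau>) zs} = (if \<sigma> = end_state \<and> \<tau> = end_state then {[]} else {})"
      by auto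
    then show ?thesis using True by (simp add: completions.simps)
  next
    case False
    let ?w = "\<lambda>(\<sigma>', \<tau>'). weight (label_of \<sigma>') (label_of \<tau>')"
    let ?L = "List.product (transitions \<sigma>) (transitions \<tau>)"
    let ?ok = "\<lambda>p. \<not> common_caret \<sigma> \<tau> (fst p) (snd p) \<and> ?w p \<le> d"
    let ?A = "\<lambda>p. if ?ok p then (#) p ` {zs. pair_walk (d - ?w p) p zs} else {}"
    have IH: "finite {zs. pair_walk (d - ?w p) p zs}
        \<and> completions (d - ?w p) p = card {zs. pair_walk (d - ?w p) p zs}"
      if "p \<in> set ?L" "?ok p" for p
      using 1[OF False, of p "fst p" "snd p"] that by (cases p) auto
    have eq: "{zs. pair_walk d (\<sigma>, \<tau>) zs} = (\<Union>p\<in>set ?L. ?A p)"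
    proof (intro equalityI subsetI)
      fix zs assume "zs \<in> {zs. pair_walk d (\<sigma>, \<tau>) zs}"
      then show "zs \<in> (\<Union>p\<in>set ?L. ?A p)" using False by (cases zs) (fastforce split: prod.splits)+
    next
      fix zs assume "zs \<in> (\<Union>p\<in>set ?L. ?A p)"
      then show "zs \<in> {zs. pair_walk d (\<sigma>, \<tau>) zs}" by (auto split: if_splits)
    qed
    have fin: "finite (?A p)" if "p \<in> set ?L" for p using IH[OF that] by auto
    have "card (\<Union>p\<in>set ?L. ?A p) = (\<Sum>p\<in>set ?L. card (?A p))"
      using fin by (intro card_UN_disjoint) auto
    also have "\<dots> = (\<Sum>p\<in>set ?L. if ?ok p then completions (d - ?w p) p else 0)"
      using IH by (intro sum.cong refl) (auto simp: card_image)
    also have "\<dots> = (\<Sum>p\<leftarrow>?L. if ?ok p then completions (d - ?w p) p else 0)"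
      by (rule sum.distinct_set_conv_list) (simp add: distinct_product distinct_transitions)
    also have "\<dots> = completions d (\<sigma>, \<tau>)"
      using False by (simp add: completions.simps[of d]) (auto intro!: arg_cong[of _ _ sum_list] map_cong)
    finally have "card (\<Union>p\<in>set ?L. ?A p) = completions d (\<sigma>, \<tau>)" .
    moreover have "finite (\<Union>p\<in>set ?L. ?A p)" using fin by (intro finite_UN_I) simp_all
    ultimately show ?thesis unfolding eq by (simp only: simp_thms)
  qed
qed

definition path_ok :: "label list \<Rightarrow> label list \<Rightarrow> bool" where
  "path_ok a b \<longleftrightarrow> (\<forall>j. Suc j < length a \<longrightarrow>
     \<not> (a ! Suc j = LabI \<and> b ! Suc j = LabI \<and> a ! j \<noteq> LabI \<and> b ! j \<noteq> LabI))"

lemma path_ok_Cons: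
  "path_ok (x # x' # a) (y # y' # b) \<longleftrightarrow>
     \<not> (x' = LabI \<and> y' = LabI \<and> x \<noteq> LabI \<and> y \<noteq> LabI) \<and> path_ok (x' # a) (y' # b)"
proof -
  have all: "(\<forall>j. P j) \<longleftrightarrow> P 0 \<and> (\<forall>j. P (Suc j))" for P :: "nat \<Rightarrow> bool"
    by (metis not0_implies_Suc)
  show ?thesis unfolding path_ok_def by (subst all) simp
qed

lemma no_common_iff_path_ok:
  assumes "length a = length b"
  shows "no_common a b \<longleftrightarrow> path_ok (LabL # a) (LabL # b)"
proof -
  have "(LabL # a) ! j \<noteq> LabI \<longleftrightarrow> j = 0 \<or> a ! (j - 1) \<noteq> LabI" for a j
    by (cases j) auto
  then show ?thesis using assms unfolding no_common_def path_ok_def exposed_nth by auto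
qed

lemma pair_walk_iff:
  "pair_walk d (\<sigma>, \<tau>) zs \<longleftrightarrow> walk \<sigma> (map fst zs) \<and> walk \<tau> (map snd zs) \<and>
     path_ok (label_of \<sigma> # map label_of (map fst zs)) (label_of \<tau> # map label_of (map snd zs)) \<and>
     total_weight (zip (map label_of (map fst zs)) (map label_of (map snd zs))) = d"
proof (induction zs arbitrary: d \<sigma> \<tau>)
  case Nil
  then show ?case by (auto simp: path_ok_def)
next
  case (Cons z zs)
  obtain \<sigma>' \<tau>' where z: "z = (\<sigma>', \<tau>')" by (cases z)
  show ?case
    unfolding z list.map pair_walk.simps walk.simps path_ok_Cons fst_conv snd_conv zip_Cons_Cons
      total_weight_simps col_weight.simps Cons.IH common_caret_def
    by auto
qed

text \<open>
  The walks have one column more than the forests, because they end with \<open>R\<close> opposite to \<open>R\<close>, of weight 2.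
\<close>

lemma bij_pairs_pair_walks:
  "bij_betw (\<lambda>(P, Q). zip (walk_of P) (walk_of Q))
     {(P, Q). reduced (P, Q) \<and> total_weight (zip (gap_labels P) (gap_labels Q)) + 2 = d}
     {zs. pair_walk d (start_state, start_state) zs}"
proof (rule bij_betw_imageI)
  have len: "length (walk_of P) = Suc (length (gap_labels P))" for P
    using arg_cong[OF walk_of(2)[of P], of length] by simp
  have inj: "inj walk_of" using bij_walk_of by (simp add: bij_betw_def)
  let ?f = "\<lambda>(P, Q). zip (walk_of P) (walk_of Q)"
  let ?A = "{(P, Q). reduced (P, Q) \<and> total_weight (zip (gap_labels P) (gap_labels Q)) + 2 = d}"
  have unzip: "map fst (zip (walk_of P) (walk_of Q)) = walk_of P"
    "map snd (zip (walk_of P) (walk_of Q)) = walk_of Q" if "length (gap_labels P) = length (gap_labels Q)" for P Q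
    using that len[of P] len[of Q] by auto
  have iff: "pair_walk d (start_state, start_state) (zip (walk_of P) (walk_of Q)) \<longleftrightarrow> (P, Q) \<in> ?A"
    if l: "length (gap_labels P) = length (gap_labels Q)" for P Q
    unfolding pair_walk_iff unzip[OF l] walk_of(2)
    using l no_common_iff_path_ok[of "gap_labels P @ [LabR]" "gap_labels Q @ [LabR]"]
    by (simp add: walk_of(1) reduced_iff no_common_pad)
  show "inj_on ?f ?A"
  proof (intro inj_onI, clarify)
    fix P Q P' Q'
    assume r: "reduced (P, Q)" "reduced (P', Q')"
      and eq: "zip (walk_of P) (walk_of Q) = zip (walk_of P') (walk_of Q')"
    then have "length (gap_labels P) = length (gap_labels Q)" "length (gap_labels P') = length (gap_labels Q')"
      by (auto simp: reduced_iff)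
    then have "walk_of P = walk_of P'" "walk_of Q = walk_of Q'" using unzip eq by metis+
    then show "P = P' \<and> Q = Q'" using inj by (simp add: inj_eq)
  qed
  show "?f ` ?A = {zs. pair_walk d (start_state, start_state) zs}"
  proof (intro equalityI subsetI)
    fix zs assume "zs \<in> ?f ` ?A"
    then obtain P Q where "zs = zip (walk_of P) (walk_of Q)" "(P, Q) \<in> ?A" by auto
    then show "zs \<in> {zs. pair_walk d (start_state, start_state) zs}"
      using iff[of P Q] by (auto simp: reduced_iff)
  next
    fix zs assume zs: "zs \<in> {zs. pair_walk d (start_state, start_state) zs}"
    then have "walk start_state (map fst zs)" "walk start_state (map snd zs)"
      by (simp_all add: pair_walk_iff)
    then obtain P Q where PQ: "map fst zs = walk_of P" "map snd zs = walk_of Q"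
      using bij_walk_of unfolding bij_betw_def by (metis (mono_tags, lifting) imageE mem_Collect_eq)
    then have "zs = zip (walk_of P) (walk_of Q)" by (metis zip_map_fst_snd)
    moreover have "length (gap_labels P) = length (gap_labels Q)"
      using PQ len[of P] len[of Q] by (metis length_map nat.inject)
    ultimately show "zs \<in> ?f ` ?A" using iff[of P Q] zs by (intro image_eqI[of _ _ "(P, Q)"]) auto
  qed
qed

section \<open>Effect of the program on the machine\<close>

definition exec :: "'a prog \<Rightarrow> machine \<Rightarrow> machine" where
  "exec p m = snd (run_state p m)"

definition tick :: "nat \<Rightarrow> machine \<Rightarrow> machine" where
  "tick k m = m\<lparr>operations := operations m + k\<rparr>"

definition put :: "address \<Rightarrow> int \<Rightarrow> machine \<Rightarrow> machine" where
  "put a v m = (let mem = AList.update a v (memory m)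
     in m\<lparr>memory := mem, peak := max (peak m) (length mem)\<rparr>)"

definition remove :: "address \<Rightarrow> machine \<Rightarrow> machine" where
  "remove a m = m\<lparr>memory := AList.delete a (memory m)\<rparr>"

lemma tick_simps [simp]:
  "memory (tick k m) = memory m" "peak (tick k m) = peak m" "operations (tick k m) = operations m + k"
  "stored_value (tick k m) a = stored_value m a" "tick k (tick l m) = tick (k + l) m"
  by (simp_all add: tick_def stored_value_def)

lemma put_simps [simp]:
  "operations (put a v m) = operations m" "put a v (tick k m) = tick k (put a v m)"
  by (simp_all add: put_def tick_def Let_def)

lemma remove_simps [simp]:
  "operations (remove a m) = operations m" "peak (remove a m) = peak m"
  "remove a (tick k m) = tick k (remove a m)"
  by (simp_all add: remove_def tick_def)

lemma stored_value_put: "stored_value (put a v m) b = (if b = a then v else stored_value m b)"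
  by (simp add: put_def stored_value_def update_conv' Let_def)

lemma stored_value_remove: "stored_value (remove a m) b = (if b = a then 0 else stored_value m b)"
  by (simp add: remove_def stored_value_def delete_conv')

lemma run_op1_tick: "run_state (op1 v) m = (v, tick 1 m)"
  by (simp add: run_op1 tick_def)

lemma run_load_tick: "run_state (load a) m = (stored_value m a, tick 1 m)"
  by (simp add: run_load tick_def)

lemma run_store_put: "run_state (store a v) m = ((), tick 1 (put a v m))"
  by (simp add: store_def charge_def State_Monad.update_def put_def tick_def Let_def)

lemma run_discard_remove: "run_state (discard a) m = ((), tick 1 (remove a m))"
  by (simp add: discard_def charge_def State_Monad.update_def remove_def tick_def)

lemma exec_for_each: "exec (for_each xs body) m = fold (\<lambda>x. exec (body x)) xs m"
proof (induction xs arbitrary: m)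
  case (Cons x xs)
  show ?case using Cons[of "exec (body x) m"] by (simp add: exec_def case_prod_unfold)
qed (simp add: exec_def)

definition target :: "nat \<Rightarrow> forest_state \<times> forest_state \<Rightarrow> address" where
  "target wt = (\<lambda>(\<sigma>', \<tau>'). Totals (wt + weight (label_of \<sigma>') (label_of \<tau>')) \<sigma>' \<tau>')"

lemma exec_process_transition:
  "exec (process_transition wt (\<sigma>, \<tau>) c (\<sigma>', \<tau>')) m =
     (if common_caret \<sigma> \<tau> \<sigma>' \<tau>' then tick 1 m
      else tick 6 (put (target wt (\<sigma>', \<tau>')) (stored_value m (target wt (\<sigma>', \<tau>')) + c) m))"
  by (simp add: exec_def process_transition_def run_op1_tick run_load_tick run_store_put target_def)

lemma exec_process_pair:
  "exec (process_pair wt (\<sigma>, \<tau>)) m =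
     (if stored_value m (Totals wt \<sigma> \<tau>) = 0 then tick 2 m
      else fold (\<lambda>q. exec (process_transition wt (\<sigma>, \<tau>) (stored_value m (Totals wt \<sigma> \<tau>)) q))
        (List.product (transitions \<sigma>) (transitions \<tau>)) (tick 2 m))"
  using exec_for_each[of "List.product (transitions \<sigma>) (transitions \<tau>)"
      "process_transition wt (\<sigma>, \<tau>) (stored_value m (Totals wt \<sigma> \<tau>))" "tick 2 m"]
  by (simp add: exec_def process_pair_def run_op1_tick run_load_tick numeral_2_eq_2)

definition pairs_of :: "nat \<Rightarrow> machine \<Rightarrow> (forest_state \<times> forest_state) list" where
  "pairs_of wt m = List.map_filter
     (\<lambda>a. case a of Totals wt' \<sigma> \<tau> \<Rightarrow> if wt' = wt then Some (\<sigma>, \<tau>) else None | _ \<Rightarrow> None)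
     (map fst (memory m))"

lemma run_stored_pairs: "run_state (stored_pairs wt) m = (pairs_of wt m, tick (length (memory m)) m)"
  by (simp add: stored_pairs_def pairs_of_def charge_def State_Monad.update_def tick_def)

lemma exec_process_weight:
  fixes wt m
  defines "ps \<equiv> pairs_of wt m"
  defines "m1 \<equiv> fold (\<lambda>p. exec (process_pair wt p)) ps (tick (length (memory m)) m)"
  shows "exec (process_weight wt) m =
    fold (\<lambda>p. exec (discard (Totals wt (fst p) (snd p)))) ps
      (tick 2 (put (H wt) (stored_value m1 (Totals wt end_state end_state)) m1))"
proof -
  have 1: "run_state (for_each ps (process_pair wt)) (tick (length (memory m)) m) = ((), m1)"
    unfolding m1_def using exec_for_each[of ps "process_pair wt" "tick (length (memory m)) m"]
    by (simp add: exec_def prod_eq_iff)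
  have 2: "snd (run_state (for_each ps (\<lambda>(\<sigma>, \<tau>). discard (Totals wt \<sigma> \<tau>))) m')
     = fold (\<lambda>p. exec (discard (Totals wt (fst p) (snd p)))) ps m'" for m'
    using exec_for_each[of ps "\<lambda>(\<sigma>, \<tau>). discard (Totals wt \<sigma> \<tau>)" m']
    by (simp add: exec_def case_prod_unfold)
  show ?thesis
    using 2 by (simp add: process_weight_def exec_def run_stored_pairs run_load_tick run_store_put
        1 ps_def[symmetric] numeral_2_eq_2)
qed

definition keys :: "machine \<Rightarrow> address set" where "keys m = set (map fst (memory m))"

definition inside :: "address set \<Rightarrow> nat \<Rightarrow> machine \<Rightarrow> bool" where
  "inside S B m \<longleftrightarrow> distinct (map fst (memory m)) \<and> keys m \<subseteq> S \<and> peak m \<le> B"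

lemma keys_simps [simp]:
  "keys (tick k m) = keys m" "keys (put a v m) = insert a (keys m)" "keys (remove a m) = keys m - {a}"
  by (auto simp: keys_def put_def remove_def Let_def update_keys delete_keys)

lemma inside_tick [simp]: "inside S B (tick k m) = inside S B m"
  by (simp add: inside_def)

lemma length_memory_le:
  assumes "inside S B m" "finite S" shows "length (memory m) \<le> card S"
proof -
  have "length (memory m) = card (keys m)"
    using assms(1) distinct_card[of "map fst (memory m)"] by (simp add: inside_def keys_def)
  then show ?thesis using assms by (simp add: inside_def card_mono)
qed

lemma inside_put:
  assumes "inside S B m" "a \<in> S" "finite S" "card S \<le> B"
  shows "inside S B (put a v m)"
proof -
  have d: "distinct (map fst (memory (put a v m)))"
    using assms(1) by (simp add: inside_def put_def Let_def distinct_update)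
  have k: "keys (put a v m) \<subseteq> S" using assms by (simp add: inside_def)
  have "length (memory (put a v m)) = card (keys (put a v m))"
    using d distinct_card[of "map fst (memory (put a v m))"] by (simp add: keys_def)
  also have "\<dots> \<le> card S" using k assms(3) by (simp add: card_mono)
  finally have "length (memory (put a v m)) \<le> B" using assms(4) by simp
  then have "peak (put a v m) \<le> B" using assms(1) by (simp add: put_def inside_def Let_def)
  then show ?thesis using d k by (simp add: inside_def)
qed

lemma inside_remove: "inside S B m \<Longrightarrow> inside (S - {a}) B (remove a m)"
  by (auto simp: inside_def) (auto simp: remove_def distinct_delete)

lemma stored_value_outside: "a \<notin> keys m \<Longrightarrow> stored_value m a = 0"
  by (auto simp: stored_value_def keys_def split: option.splits dest: map_of_SomeD intro: rev_image_eqI)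

text \<open>
  If \<open>g a\<close> is the number of completions from the states at \<open>a\<close>, then this is the number of pairs of
  walks that pass through the stored counters.
\<close>

definition potential :: "address set \<Rightarrow> (address \<Rightarrow> int) \<Rightarrow> machine \<Rightarrow> int" where
  "potential S g m = (\<Sum>a\<in>S. stored_value m a * g a)"

lemma potential_tick [simp]: "potential S g (tick k m) = potential S g m"
  by (simp add: potential_def)

lemma potential_put:
  assumes "finite S" "a \<in> S"
  shows "potential S g (put a v m) = potential S g m + (v - stored_value m a) * g a"
proof -
  have "potential S g (put a v m) = v * g a + (\<Sum>b\<in>S - {a}. stored_value m b * g b)"
    unfolding potential_def by (subst sum.remove[OF assms]) (simp add: stored_value_put)
  moreover have "potential S g m = stored_value m a * g a + (\<Sum>b\<in>S - {a}. stored_value m b * g b)"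
    unfolding potential_def by (rule sum.remove[OF assms])
  ultimately show ?thesis by (simp add: algebra_simps)
qed

lemma potential_superset:
  assumes "keys m \<subseteq> S" "S \<subseteq> S'" "finite S'"
  shows "potential S' g m = potential S g m"
  unfolding potential_def
proof (rule sum.mono_neutral_right)
  show "\<forall>a\<in>S' - S. stored_value m a * g a = 0" using assms(1) stored_value_outside by auto
qed (use assms in auto)

text \<open>
  Processing the weight \<open>wt\<close> changes counters of larger weight only.
\<close>

definition old_address :: "nat \<Rightarrow> address \<Rightarrow> bool" where
  "old_address wt a \<longleftrightarrow> (\<forall>l \<sigma> \<tau>. a = Totals l \<sigma> \<tau> \<longrightarrow> l \<le> wt)"

lemma old_address_simps [simp]:
  "old_address wt (Totals l \<sigma> \<tau>) \<longleftrightarrow> l \<le> wt" "old_address wt (H i)"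
  by (cases \<sigma>; cases \<tau>; simp add: old_address_def)+

lemma old_target: "\<not> old_address wt (target wt q)"
  by (cases q) (auto simp: old_address_def target_def weight_pos)

lemma exec_transitions:
  fixes c :: int and \<sigma> \<tau> :: forest_state
  assumes "finite S" "card S \<le> B" "inside S B m" "\<And>q. q \<in> set qs \<Longrightarrow> target wt q \<in> S"
  defines "m' \<equiv> fold (\<lambda>q. exec (process_transition wt (\<sigma>, \<tau>) c q)) qs m"
  shows "inside S B m' \<and> operations m' \<le> operations m + 6 * length qs
    \<and> (\<forall>a. old_address wt a \<longrightarrow> stored_value m' a = stored_value m a)
    \<and> potential S g m' = potential S g m +
        c * (\<Sum>(\<sigma>', \<tau>')\<leftarrow>qs. if common_caret \<sigma> \<tau> \<sigma>' \<tau>' then 0 else g (target wt (\<sigma>', \<tau>')))"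
  unfolding m'_def using assms(3,4)
proof (induction qs arbitrary: m)
  case (Cons q qs)
  obtain \<sigma>' \<tau>' where q: "q = (\<sigma>', \<tau>')" by (cases q)
  let ?a = "target wt (\<sigma>', \<tau>')"
  let ?m = "exec (process_transition wt (\<sigma>, \<tau>) c q) m"
  have a: "?a \<in> S" using Cons.prems(2)[of q] q by simp
  have "inside S B ?m" using Cons.prems(1) inside_put[OF Cons.prems(1) a assms(1,2)]
    by (simp add: q exec_process_transition)
  from Cons.IH[OF this] Cons.prems(2)
  have IH: "inside S B (fold (\<lambda>q. exec (process_transition wt (\<sigma>, \<tau>) c q)) qs ?m)
    \<and> operations (fold (\<lambda>q. exec (process_transition wt (\<sigma>, \<tau>) c q)) qs ?m) \<le> operations ?m + 6 * length qs
    \<and> (\<forall>a. old_address wt a \<longrightarrow>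
         stored_value (fold (\<lambda>q. exec (process_transition wt (\<sigma>, \<tau>) c q)) qs ?m) a = stored_value ?m a)
    \<and> potential S g (fold (\<lambda>q. exec (process_transition wt (\<sigma>, \<tau>) c q)) qs ?m) = potential S g ?m +
        c * (\<Sum>(\<sigma>', \<tau>')\<leftarrow>qs. if common_caret \<sigma> \<tau> \<sigma>' \<tau>' then 0 else g (target wt (\<sigma>', \<tau>')))"
    by simp
  have ops: "operations ?m \<le> operations m + 6" by (simp add: q exec_process_transition)
  have val: "stored_value ?m b = stored_value m b" if "old_address wt b" for b
    using that old_target[of wt q] by (auto simp: q exec_process_transition stored_value_put)
  have pot: "potential S g ?m = potential S g m
      + c * (if common_caret \<sigma> \<tau> \<sigma>' \<tau>' then 0 else g (target wt (\<sigma>', \<tau>')))"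
    by (simp add: q exec_process_transition potential_put[OF assms(1) a])
  have fold: "fold (\<lambda>q. exec (process_transition wt (\<sigma>, \<tau>) c q)) (q # qs) m
     = fold (\<lambda>q. exec (process_transition wt (\<sigma>, \<tau>) c q)) qs ?m" by simp
  show ?case unfolding fold using IH ops val pot by (simp add: q distrib_left)
qed simp

lemma length_transitions: "length (transitions \<sigma>) \<le> 7"
  by (cases \<sigma> rule: transitions.cases) auto

lemma completions_0: "completions 0 (\<sigma>, \<tau>) = (if \<sigma> = end_state \<and> \<tau> = end_state then 1 else 0)"
  by (subst completions.simps) simp

definition weight_of_target :: "(address \<Rightarrow> int) \<Rightarrow> nat \<Rightarrow> forest_state \<times> forest_state \<Rightarrow> int" where
  "weight_of_target g wt = (\<lambda>(\<sigma>, \<tau>). \<Sum>(\<sigma>', \<tau>')\<leftarrow>List.product (transitions \<sigma>) (transitions \<tau>).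
     if common_caret \<sigma> \<tau> \<sigma>' \<tau>' then 0 else g (target wt (\<sigma>', \<tau>')))"

text \<open>
  A pair costs 2 operations and at most 6 for each of its at most \<open>7 * 7\<close> pairs of transitions.
\<close>

lemma exec_pairs:
  assumes "finite S" "card S \<le> B" "inside S B m"
    "\<And>\<sigma> \<tau> q. (\<sigma>, \<tau>) \<in> set ps \<Longrightarrow> q \<in> set (transitions \<sigma>) \<times> set (transitions \<tau>) \<Longrightarrow> target wt q \<in> S"
  defines "m' \<equiv> fold (\<lambda>p. exec (process_pair wt p)) ps m"
  shows "inside S B m' \<and> operations m' \<le> operations m + 296 * length ps
    \<and> (\<forall>a. old_address wt a \<longrightarrow> stored_value m' a = stored_value m a)
    \<and> potential S g m' = potential S g m +
        (\<Sum>p\<leftarrow>ps. stored_value m (Totals wt (fst p) (snd p)) * weight_of_target g wt p)"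
  unfolding m'_def using assms(3,4)
proof (induction ps arbitrary: m)
  case (Cons p ps)
  obtain \<sigma> \<tau> where p: "p = (\<sigma>, \<tau>)" by (cases p)
  let ?c = "stored_value m (Totals wt \<sigma> \<tau>)"
  let ?qs = "List.product (transitions \<sigma>) (transitions \<tau>)"
  let ?m = "exec (process_pair wt p) m"
  have tr: "target wt q \<in> S" if "q \<in> set ?qs" for q using Cons.prems(2)[of \<sigma> \<tau> q] p that by auto
  have "length ?qs \<le> 7 * 7" 
    using mult_le_mono[OF length_transitions[of \<sigma>] length_transitions[of \<tau>]] by simp
  then have m: "inside S B ?m \<and> operations ?m \<le> operations m + 296
    \<and> (\<forall>a. old_address wt a \<longrightarrow> stored_value ?m a = stored_value m a)
    \<and> potential S g ?m = potential S g m + ?c * weight_of_target g wt p"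
    using exec_transitions[OF assms(1,2), of "tick 2 m" ?qs wt \<sigma> \<tau> ?c g] tr Cons.prems(1)
    by (auto simp: p exec_process_pair weight_of_target_def)
  have old: "old_address wt (Totals wt a b)" for a b by (simp add: old_address_def)
  let ?m' = "fold (\<lambda>p. exec (process_pair wt p)) ps ?m"
  have IH: "inside S B ?m' \<and> operations ?m' \<le> operations ?m + 296 * length ps
    \<and> (\<forall>a. old_address wt a \<longrightarrow> stored_value ?m' a = stored_value ?m a)
    \<and> potential S g ?m' = potential S g ?m +
        (\<Sum>p\<leftarrow>ps. stored_value ?m (Totals wt (fst p) (snd p)) * weight_of_target g wt p)"
  proof (rule Cons.IH)
    show "inside S B ?m" using m by blast
    show "target wt q \<in> S" if "(\<sigma>, \<tau>) \<in> set ps" "q \<in> set (transitions \<sigma>) \<times> set (transitions \<tau>)"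
      for \<sigma> \<tau> q
      using that(1) by (intro Cons.prems(2)[OF _ that(2)]) simp
  qed
  have fold: "fold (\<lambda>p. exec (process_pair wt p)) (p # ps) m = ?m'" by simp
  show ?case unfolding fold using IH m old by (simp add: p)
qed simp

lemma exec_discards:
  "inside S B m \<Longrightarrow> (let m' = fold (\<lambda>p. exec (discard (Totals wt (fst p) (snd p)))) ps m in
     inside (S - (\<lambda>p. Totals wt (fst p) (snd p)) ` set ps) B m' \<and> operations m' = operations m + length ps
     \<and> (\<forall>a. a \<notin> (\<lambda>p. Totals wt (fst p) (snd p)) ` set ps \<longrightarrow> stored_value m' a = stored_value m a))"
proof (induction ps arbitrary: m S)
  case (Cons p ps)
  let ?a = "Totals wt (fst p) (snd p)"
  let ?m = "exec (discard ?a) m"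
  have m: "?m = tick 1 (remove ?a m)" by (simp add: exec_def run_discard_remove)
  have "inside (S - {?a}) B ?m" using inside_remove[OF Cons.prems] by (simp add: m)
  from Cons.IH[OF this] show ?case
    by (simp add: Let_def) (auto simp: m stored_value_remove Diff_insert2[symmetric] insert_commute)
qed (simp add: Let_def)

section \<open>The addresses in use\<close>

definition states_upto :: "nat \<Rightarrow> forest_state set" where
  "states_upto e = UNIV \<times> UNIV \<times> {..e}"

definition totals_between :: "nat \<Rightarrow> nat \<Rightarrow> address set" where
  "totals_between a b = (\<Union>l\<in>{a..b}. \<Union>\<sigma>\<in>states_upto l. \<Union>\<tau>\<in>states_upto l. {Totals l \<sigma> \<tau>})"

text \<open>
  Between two rounds of the main loop the counters of four consecutive weights are in use; in the course
  of a round there is a fifth one. The excess of a state is at most the weight, because the latter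
  grows by at least 1 with every transition and the former by at most 1.
\<close>

definition live_addresses :: "nat \<Rightarrow> address set" where
  "live_addresses wt = totals_between wt (wt + 3) \<union> H ` {..<wt}"

definition work_addresses :: "nat \<Rightarrow> address set" where
  "work_addresses wt = totals_between wt (wt + 4) \<union> H ` {..wt}"

lemma UNIV_label: "(UNIV :: label set) = {LabL, LabN, LabX, LabR, LabI}"
  using label.exhaust by auto

lemma UNIV_side: "(UNIV :: side set) = {LeftSide, RightSide}"
  using side.exhaust by auto

lemma states_upto: "finite (states_upto e)" "card (states_upto e) = 10 * (e + 1)"
  by (simp_all add: states_upto_def UNIV_label UNIV_side card_cartesian_product)

lemma mem_totals_between:
  "Totals l \<sigma> \<tau> \<in> totals_between a b \<longleftrightarrow> a \<le> l \<and> l \<le> b \<and> snd (snd \<sigma>) \<le> l \<and> snd (snd \<tau>) \<le> l"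
  by (cases \<sigma>; cases \<tau>) (auto simp: totals_between_def states_upto_def)

lemma totals_between_cases: "a \<in> totals_between b c \<Longrightarrow> \<exists>l \<sigma> \<tau>. a = Totals l \<sigma> \<tau>"
  by (auto simp: totals_between_def)

lemma totals_between_bound:
  "finite (totals_between a (a + 4)) \<and> card (totals_between a (a + 4)) \<le> 500 * (a + 5)\<^sup>2"
proof -
  let ?A = "states_upto (a + 4)"
  have sub: "totals_between a (a + 4) \<subseteq> (\<lambda>(l, \<sigma>, \<tau>). Totals l \<sigma> \<tau>) ` ({a..a + 4} \<times> ?A \<times> ?A)"
  proof
    fix x assume "x \<in> totals_between a (a + 4)"
    then obtain l \<sigma> \<tau> where x: "x = Totals l \<sigma> \<tau>" "l \<in> {a..a + 4}"
      "\<sigma> \<in> states_upto l" "\<tau> \<in> states_upto l"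
      by (auto simp: totals_between_def)
    then have "\<sigma> \<in> ?A" "\<tau> \<in> ?A" by (auto simp: states_upto_def)
    with x show "x \<in> (\<lambda>(l, \<sigma>, \<tau>). Totals l \<sigma> \<tau>) ` ({a..a + 4} \<times> ?A \<times> ?A)"
      by (intro image_eqI[of _ _ "(l, \<sigma>, \<tau>)"]) auto
  qed
  have "card ((\<lambda>(l, \<sigma>, \<tau>). Totals l \<sigma> \<tau>) ` ({a..a + 4} \<times> ?A \<times> ?A)) \<le> card ({a..a + 4} \<times> ?A \<times> ?A)"
    by (rule card_image_le) (simp add: states_upto)
  also have "\<dots> = 500 * (a + 5)\<^sup>2" 
    by (simp add: card_cartesian_product states_upto power2_eq_square algebra_simps)
  finally have "card ((\<lambda>(l, \<sigma>, \<tau>). Totals l \<sigma> \<tau>) ` ({a..a + 4} \<times> ?A \<times> ?A)) \<le> 500 * (a + 5)\<^sup>2" .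
  moreover have fin: "finite ((\<lambda>(l, \<sigma>, \<tau>). Totals l \<sigma> \<tau>) ` ({a..a + 4} \<times> ?A \<times> ?A))"
    by (simp add: states_upto)
  ultimately show ?thesis using card_mono[OF fin sub] finite_subset[OF sub fin] by linarith
qed

lemma work_addresses_bound:
  "finite (work_addresses wt)" "card (work_addresses wt) \<le> 501 * (wt + 5)\<^sup>2"
proof -
  show "finite (work_addresses wt)" using totals_between_bound by (simp add: work_addresses_def)
  have "card (work_addresses wt) \<le> card (totals_between wt (wt + 4)) + card (H ` {..wt})"
    unfolding work_addresses_def by (rule card_Un_le)
  also have "card (H ` {..wt}) \<le> wt + 1" using card_image_le[of "{..wt}" H] by simp
  also have "wt + 1 \<le> (wt + 5)\<^sup>2"
    by (simp add: power2_eq_square add_mult_distrib add_mult_distrib2)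
  finally show "card (work_addresses wt) \<le> 501 * (wt + 5)\<^sup>2"
    using totals_between_bound[of wt] by linarith
qed

lemma transition_excess: "\<sigma>' \<in> set (transitions \<sigma>) \<Longrightarrow> snd (snd \<sigma>') \<le> snd (snd \<sigma>) + 1"
  by (cases \<sigma> rule: transitions.cases) auto

lemma set_map_filter: "set (List.map_filter f xs) = {y. \<exists>x\<in>set xs. f x = Some y}"
  by (induction xs) (auto simp: List.map_filter_simps split: option.splits)

lemma distinct_map_filter:
  "distinct xs \<Longrightarrow> (\<And>x y z. f x = Some z \<Longrightarrow> f y = Some z \<Longrightarrow> x = y) \<Longrightarrow>
     distinct (List.map_filter f xs)"
  by (induction xs) (auto simp: List.map_filter_simps set_map_filter split: option.splits)

definition pair_at :: "nat \<Rightarrow> address \<Rightarrow> (forest_state \<times> forest_state) option" where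
  "pair_at wt a = (case a of Totals wt' \<sigma> \<tau> \<Rightarrow> if wt' = wt then Some (\<sigma>, \<tau>) else None | _ \<Rightarrow> None)"

lemma pair_at: "pair_at wt a = Some p \<longleftrightarrow> a = Totals wt (fst p) (snd p)"
  by (cases a; cases p) (auto simp: pair_at_def)

lemma pairs_of_eq: "pairs_of wt m = List.map_filter (pair_at wt) (map fst (memory m))"
  unfolding pairs_of_def pair_at_def ..

lemma set_pairs_of: "p \<in> set (pairs_of wt m) \<longleftrightarrow> Totals wt (fst p) (snd p) \<in> keys m"
  unfolding pairs_of_eq set_map_filter pair_at keys_def by blast

lemma length_pairs_of: "length (pairs_of wt m) \<le> length (memory m)"
  unfolding pairs_of_def List.map_filter_def
  using length_filter_le[of _ "map fst (memory m)"] by simp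

lemma distinct_pairs_of: "distinct (map fst (memory m)) \<Longrightarrow> distinct (pairs_of wt m)"
  unfolding pairs_of_eq by (rule distinct_map_filter) (simp_all add: pair_at)

section \<open>The invariant of the main loop\<close>

text \<open>
  How much a unit in a counter contributes to \<open>h\<^sub>\<ell>\<close>.
\<close>

fun coef :: "nat \<Rightarrow> address \<Rightarrow> int" where
  "coef l (Totals l' \<sigma> \<tau>) = (if l' \<le> l then int (completions (l - l') (\<sigma>, \<tau>)) else 0)"
| "coef l _ = 0"

lemma int_sum_list: "int (sum_list xs) = sum_list (map int xs)"
  by (induction xs) auto

definition late_coef :: "nat \<Rightarrow> nat \<Rightarrow> address \<Rightarrow> int" where
  "late_coef wt l a = (if old_address wt a then 0 else coef l a)"

lemma weight_of_target_completions:
  assumes "wt < l"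
  shows "weight_of_target (late_coef wt l) wt p = int (completions (l - wt) p)"
proof -
  obtain \<sigma> \<tau> where p: "p = (\<sigma>, \<tau>)" by (cases p)
  have l: "late_coef wt l (target wt (\<sigma>', \<tau>')) =
     int (if weight (label_of \<sigma>') (label_of \<tau>') \<le> l - wt
       then completions (l - wt - weight (label_of \<sigma>') (label_of \<tau>')) (\<sigma>', \<tau>') else 0)" for \<sigma>' \<tau>'
    using assms old_target[of wt "(\<sigma>', \<tau>')"] by (auto simp: late_coef_def target_def)
  have "l - wt \<noteq> 0" using assms by simp
  then have "int (completions (l - wt) (\<sigma>, \<tau>)) =
    int (\<Sum>(\<sigma>', \<tau>')\<leftarrow>List.product (transitions \<sigma>) (transitions \<tau>).
        if common_caret \<sigma> \<tau> \<sigma>' \<tau>' then 0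
        else if weight (label_of \<sigma>') (label_of \<tau>') \<le> l - wt
        then completions (l - wt - weight (label_of \<sigma>') (label_of \<tau>')) (\<sigma>', \<tau>') else 0)"
    by (subst completions.simps) (simp only: if_False)
  also have "\<dots> = weight_of_target (late_coef wt l) wt p"
    unfolding weight_of_target_def p prod.case int_sum_list map_map l
    by (intro arg_cong[of _ _ sum_list] map_cong) auto
  finally show ?thesis by (simp add: p)
qed

definition invariant :: "nat \<Rightarrow> nat \<Rightarrow> machine \<Rightarrow> bool" where
  "invariant B wt m \<longleftrightarrow> inside (live_addresses wt) B m
     \<and> (\<forall>l\<ge>wt. potential (live_addresses wt) (coef l) m = int (completions (l - 2) (start_state, start_state)))
     \<and> (\<forall>l. 2 \<le> l \<and> l < wt \<longrightarrow> stored_value m (H l) = int (completions (l - 2) (start_state, start_state)))"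

lemma live_subset_work: "live_addresses wt \<subseteq> work_addresses wt" "live_addresses (Suc wt) \<subseteq> work_addresses wt"
  unfolding live_addresses_def work_addresses_def totals_between_def by fastforce+

text \<open>
  A counter of weight \<open>wt\<close> is replaced by its successors. By the recursion for \<open>completions\<close> the
  number of completions of a pair is the sum of those of its successors, so for \<open>l > wt\<close> the potential
  is unchanged when the counters of weight \<open>wt\<close> are discarded. For \<open>l = wt\<close> the only counter that
  contributes is the one at the end states, and it is stored as \<open>h\<^sub>\<ell>\<close>.
\<close>

lemma process_weight_step:
  assumes inv: "invariant B wt m" and B: "501 * (wt + 5)\<^sup>2 \<le> B" and wt: "2 \<le> wt"
  shows "invariant B (Suc wt) (exec (process_weight wt) m)
    \<and> operations (exec (process_weight wt) m) \<le> operations m + 300 * B"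
proof -
  let ?S = "work_addresses wt" and ?ps = "pairs_of wt m"
  let ?T = "(\<lambda>p. Totals wt (fst p) (snd p)) ` set ?ps"
  define m0 where "m0 = tick (length (memory m)) m"
  define m1 where "m1 = fold (\<lambda>p. exec (process_pair wt p)) ?ps m0"
  define h where "h = stored_value m1 (Totals wt end_state end_state)"
  define m2 where "m2 = tick 2 (put (H wt) h m1)"
  define m3 where "m3 = fold (\<lambda>p. exec (discard (Totals wt (fst p) (snd p)))) ?ps m2"
  have m3: "exec (process_weight wt) m = m3"
    unfolding m3_def m2_def h_def m1_def m0_def by (rule exec_process_weight)
  \<comment> \<open>all addresses used in this round; in contrast to the work addresses it contains no new counters
    of weight wt, so that none of these is left after the discards\<close>
  let ?U = "keys m \<union> totals_between (wt + 1) (wt + 4) \<union> {H wt}"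
  have live: "inside (live_addresses wt) B m" using inv by (simp add: invariant_def)
  have keys: "keys m \<subseteq> live_addresses wt" using live by (simp add: inside_def)
  have sub: "?U \<subseteq> ?S"
  proof -
    have "totals_between (wt + 1) (wt + 4) \<subseteq> ?S" "H wt \<in> ?S"
      by (auto simp: totals_between_def work_addresses_def)
    then show ?thesis using keys live_subset_work(1)[of wt] by blast
  qed
  have fin: "finite ?U" "card ?U \<le> B"
  proof -
    show "finite ?U" by (rule finite_subset[OF sub work_addresses_bound(1)])
    show "card ?U \<le> B"
      using card_mono[OF work_addresses_bound(1) sub] work_addresses_bound(2)[of wt] B by linarith
  qed
  have len: "length (memory m) \<le> B" "length ?ps \<le> B" "1 \<le> B"
  proof -
    have "card (live_addresses wt) \<le> B" "finite (live_addresses wt)"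
      using work_addresses_bound[of wt] B live_subset_work(1)[of wt] card_mono finite_subset
      by (metis order_trans, metis finite_subset)
    then show "length (memory m) \<le> B" using length_memory_le[OF live] by simp
    then show "length ?ps \<le> B" using length_pairs_of[of wt m] by simp
    have "1 \<le> 501 * (wt + 5)\<^sup>2" by simp
    then show "1 \<le> B" using B by linarith
  qed
  have w0: "inside ?U B m0"
    using live by (auto simp: m0_def inside_def)
  have tgt: "target wt q \<in> ?U"
    if "(\<sigma>, \<tau>) \<in> set ?ps" "q \<in> set (transitions \<sigma>) \<times> set (transitions \<tau>)" for \<sigma> \<tau> q
  proof -
    obtain \<sigma>' \<tau>' where q: "q = (\<sigma>', \<tau>')" by (cases q)
    have "Totals wt \<sigma> \<tau> \<in> live_addresses wt" using that(1) keys set_pairs_of[of "(\<sigma>, \<tau>)"] by auto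
    then have "snd (snd \<sigma>) \<le> wt" "snd (snd \<tau>) \<le> wt"
      by (auto simp: live_addresses_def mem_totals_between)
    moreover have "snd (snd \<sigma>') \<le> snd (snd \<sigma>) + 1" "snd (snd \<tau>') \<le> snd (snd \<tau>) + 1"
      using that(2) transition_excess q by auto
    ultimately have "target wt q \<in> totals_between (wt + 1) (wt + 4)"
      using weight_pos[of "label_of \<sigma>'" "label_of \<tau>'"] weight_le_4[of "label_of \<sigma>'" "label_of \<tau>'"]
      by (simp add: q target_def mem_totals_between)
    then show ?thesis by blast
  qed
  have M1: "inside ?U B m1 \<and> operations m1 \<le> operations m0 + 296 * length ?ps
    \<and> (\<forall>a. old_address wt a \<longrightarrow> stored_value m1 a = stored_value m0 a)
    \<and> potential ?U g m1 = potential ?U g m0 +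
        (\<Sum>p\<leftarrow>?ps. stored_value m0 (Totals wt (fst p) (snd p)) * weight_of_target g wt p)" for g
    unfolding m1_def by (rule exec_pairs[OF fin w0 tgt])
  have w2: "inside ?U B m2" unfolding m2_def using inside_put[OF _ _ fin] M1 by simp
  have M3: "inside (?U - ?T) B m3" "operations m3 = operations m2 + length ?ps"
    "\<And>a. a \<notin> ?T \<Longrightarrow> stored_value m3 a = stored_value m2 a"
    using exec_discards[OF w2, of wt ?ps] by (auto simp: m3_def Let_def)
  have T: "?T = {a \<in> keys m. \<exists>\<sigma> \<tau>. a = Totals wt \<sigma> \<tau>}"
  proof (intro equalityI subsetI)
    fix a assume "a \<in> {a \<in> keys m. \<exists>\<sigma> \<tau>. a = Totals wt \<sigma> \<tau>}"
    then obtain \<sigma> \<tau> where "a = Totals wt \<sigma> \<tau>" "a \<in> keys m" by blast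
    then show "a \<in> ?T" using set_pairs_of[of "(\<sigma>, \<tau>)" wt m]
      by (intro image_eqI[of _ _ "(\<sigma>, \<tau>)"]) simp_all
  qed (auto simp: set_pairs_of)
  have S1: "?U - ?T \<subseteq> live_addresses (Suc wt)"
  proof
    fix a assume a: "a \<in> ?U - ?T"
    show "a \<in> live_addresses (Suc wt)"
    proof (cases "a \<in> keys m")
      case True
      then have "a \<in> live_addresses wt" using keys by blast
      then show ?thesis
      proof (cases a)
        case (Totals l \<sigma> \<tau>)
        then have "l \<noteq> wt" using a True T by blast
        then show ?thesis using \<open>a \<in> live_addresses wt\<close> Totals
          by (auto simp: live_addresses_def mem_totals_between)
      qed (auto simp: live_addresses_def dest: totals_between_cases)
    next
      case False
      then show ?thesis using a by (auto simp: live_addresses_def add.commute)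
    qed
  qed
  have inside3: "inside (live_addresses (Suc wt)) B m3"
    using M3(1) S1 by (auto simp: inside_def)
  have old_m: "stored_value m1 a = stored_value m a" if "old_address wt a" for a
    using M1 that by (simp add: m0_def)
  \<comment> \<open>outside the counters T of weight wt, all counters in U have a larger weight\<close>
  have late: "(if a \<in> ?T then 0 else coef l a) = late_coef wt l a" if "a \<in> ?U" for a l
  proof (cases a)
    case (Totals l' \<sigma> \<tau>)
    show ?thesis
    proof (cases "a \<in> keys m")
      case True
      then have "wt \<le> l'" using keys Totals by (auto simp: live_addresses_def mem_totals_between)
      moreover have "a \<in> ?T \<longleftrightarrow> l' = wt" unfolding T using True Totals by blast
      ultimately show ?thesis by (simp add: late_coef_def Totals)
    next
      case False
      have "a \<notin> ?T" unfolding T using False by blast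
      moreover have "wt < l'" using that False Totals by (auto simp: mem_totals_between)
      ultimately show ?thesis by (simp add: late_coef_def Totals)
    qed
  qed (auto simp: late_coef_def T)
  have late_T: "stored_value x a * late_coef wt l a = 0" if "a \<in> ?U - (?U - ?T)" for x a l
  proof -
    have "a \<in> ?U" "a \<in> ?T" using that by blast+
    then show ?thesis using late[of a l] by simp
  qed
  have late_not_T: "coef l a = late_coef wt l a" if "a \<in> ?U - ?T" for a l
  proof -
    have "a \<in> ?U" "a \<notin> ?T" using that by blast+
    then show ?thesis using late[of a l] by simp
  qed
  have finT: "finite ?T" "?T \<subseteq> ?U"
    by (intro finite_imageI finite_set) (use T in blast)
  have finlive: "finite (live_addresses k)" for k
    using work_addresses_bound(1) live_subset_work(1) finite_subset by blast
  have pot3: "potential (live_addresses (Suc wt)) (coef l) m3 = int (completions (l - 2) (start_state, start_state))"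
    if l: "Suc wt \<le> l" for l
  proof -
    have "potential (live_addresses (Suc wt)) (coef l) m3 = potential (?U - ?T) (coef l) m3"
      using M3(1) S1 finlive by (intro potential_superset) (auto simp: inside_def)
    also have "\<dots> = (\<Sum>a\<in>?U - ?T. stored_value m1 a * coef l a)"
      unfolding potential_def
    proof (rule sum.cong[OF HOL.refl])
      fix a assume "a \<in> ?U - ?T"
      then have "stored_value m3 a = stored_value m2 a" using M3(3) by blast
      then show "stored_value m3 a * coef l a = stored_value m1 a * coef l a"
        by (cases a) (auto simp: m2_def stored_value_put)
    qed
    also have "\<dots> = (\<Sum>a\<in>?U. stored_value m1 a * late_coef wt l a)"
    proof (rule sum.mono_neutral_cong_left[OF fin(1)])
      show "\<forall>a\<in>?U - (?U - ?T). stored_value m1 a * late_coef wt l a = 0" using late_T by blast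
      show "stored_value m1 a * coef l a = stored_value m1 a * late_coef wt l a" if "a \<in> ?U - ?T" for a
        using late_not_T[OF that] by simp
    qed blast
    also have "\<dots> = potential ?U (late_coef wt l) m0 +
        (\<Sum>p\<leftarrow>?ps. stored_value m (Totals wt (fst p) (snd p)) * int (completions (l - wt) p))"
      using M1[of "late_coef wt l"] weight_of_target_completions[of wt l] l
      by (simp add: potential_def m0_def)
    also have "(\<Sum>p\<leftarrow>?ps. stored_value m (Totals wt (fst p) (snd p)) * int (completions (l - wt) p))
        = (\<Sum>p\<in>set ?ps. stored_value m (Totals wt (fst p) (snd p)) * int (completions (l - wt) p))"
      using live distinct_pairs_of by (intro sum.distinct_set_conv_list[symmetric]) (auto simp: inside_def)
    also have "\<dots> = (\<Sum>a\<in>?T. stored_value m a * coef l a)"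
      using l by (subst sum.reindex) (auto simp: inj_on_def intro!: sum.cong)
    also have "potential ?U (late_coef wt l) m0 = (\<Sum>a\<in>?U - ?T. stored_value m a * coef l a)"
      unfolding potential_def m0_def tick_simps
    proof (rule sum.mono_neutral_cong_right[OF fin(1)])
      show "\<forall>a\<in>?U - (?U - ?T). stored_value m a * late_coef wt l a = 0" using late_T by blast
      show "stored_value m a * late_coef wt l a = stored_value m a * coef l a" if "a \<in> ?U - ?T" for a
        using late_not_T[OF that] by simp
    qed blast
    also have "(\<Sum>a\<in>?U - ?T. stored_value m a * coef l a) + (\<Sum>a\<in>?T. stored_value m a * coef l a)
        = potential ?U (coef l) m"
      unfolding potential_def by (rule sum.subset_diff[OF finT(2) fin(1), symmetric])
    also have "\<dots> = potential (keys m) (coef l) m"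
      using fin(1) by (intro potential_superset) auto
    also have "\<dots> = potential (live_addresses wt) (coef l) m"
      using keys finlive by (intro potential_superset[symmetric]) auto
    also have "\<dots> = int (completions (l - 2) (start_state, start_state))"
      using inv l by (simp add: invariant_def)
    finally show ?thesis .
  qed
  have h: "h = int (completions (wt - 2) (start_state, start_state))"
  proof -
    let ?e = "Totals wt end_state end_state"
    have "coef wt a = (if a = ?e then 1 else 0)" if "a \<in> live_addresses wt" for a
    proof (cases a)
      case (Totals l \<sigma> \<tau>)
      then have "wt \<le> l" using that by (auto simp: live_addresses_def mem_totals_between)
      then show ?thesis by (simp add: Totals completions_0)
    qed simp_all
    then have "potential (live_addresses wt) (coef wt) m
        = (\<Sum>a\<in>live_addresses wt. if a = ?e then stored_value m a else 0)"
      unfolding potential_def by (intro sum.cong) auto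
    also have "\<dots> = stored_value m ?e"
      using finlive[of wt] by (simp add: sum.delta' live_addresses_def mem_totals_between)
    also have "\<dots> = h" unfolding h_def using old_m[of ?e] by (simp add: old_address_def)
    finally show ?thesis using inv by (simp add: invariant_def)
  qed
  have H3: "stored_value m3 (H l) = int (completions (l - 2) (start_state, start_state))"
    if l: "2 \<le> l" "l < Suc wt" for l
  proof -
    have "stored_value m3 (H l) = stored_value m2 (H l)" using T by (intro M3(3)) auto
    also have "\<dots> = (if l = wt then h else stored_value m (H l))"
      using old_m[of "H l"] by (simp add: m2_def stored_value_put old_address_def)
    finally show ?thesis using h inv l by (auto simp: invariant_def)
  qed
  have "operations m3 \<le> operations m + 300 * B"
  proof -
    have "operations m1 \<le> operations m + length (memory m) + 296 * length ?ps"
      using M1[of "\<lambda>_. 0"] by (simp add: m0_def)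
    moreover have "operations m3 = operations m1 + 2 + length ?ps" using M3(2) by (simp add: m2_def)
    ultimately show ?thesis using len by linarith
  qed
  then show ?thesis unfolding m3 invariant_def using inside3 pot3 H3 by simp
qed

section \<open>Time and space\<close>

text \<open>
  The counters take up to \<open>500 * (n + 10)\<^sup>2\<close> addresses, from five weights and from ten states for each
  excess; the rest is for the three arrays.
\<close>

definition size_bound :: "nat \<Rightarrow> nat" where "size_bound n = 503 * (n + 10)\<^sup>2"

lemma invariant_start:
  assumes "1 \<le> B"
  shows "invariant B 2 (exec (store (Totals 2 start_state start_state) 1) initial_machine)"
    "operations (exec (store (Totals 2 start_state start_state) 1) initial_machine) = 1"
proof -
  let ?a = "Totals 2 start_state start_state"
  let ?m = "exec (store ?a 1) initial_machine"
  have m: "?m = tick 1 (put ?a 1 initial_machine)"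
    by (simp add: exec_def run_store_put)
  show "operations ?m = 1" unfolding m tick_simps put_simps by (simp add: initial_machine_def)
  have a: "?a \<in> live_addresses 2" by (simp add: live_addresses_def mem_totals_between)
  have ins: "inside (live_addresses 2) B ?m"
    using a assms unfolding m by (simp add: inside_def keys_def put_def initial_machine_def)
  have fin: "finite (live_addresses 2)"
    using work_addresses_bound(1) live_subset_work(1) finite_subset by blast
  have "stored_value initial_machine b = 0" for b
    by (simp add: stored_value_def initial_machine_def)
  then have "potential (live_addresses 2) g ?m = g ?a" for g
    unfolding m potential_tick potential_put[OF fin a] by (simp add: potential_def)
  then show "invariant B 2 ?m" using ins by (simp add: invariant_def)
qed

lemma invariant_loop:
  assumes "invariant B 2 m" "501 * (n + 10)\<^sup>2 \<le> B" "2 \<le> k" "k \<le> n + 5"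
  shows "invariant B k (fold (\<lambda>wt. exec (process_weight wt)) [2..<k] m)
    \<and> operations (fold (\<lambda>wt. exec (process_weight wt)) [2..<k] m) \<le> operations m + 300 * B * (k - 2)"
  using assms(3,4)
proof (induction k rule: dec_induct)
  case (step k)
  let ?m = "fold (\<lambda>wt. exec (process_weight wt)) [2..<k] m"
  have "(k + 5)\<^sup>2 \<le> (n + 10)\<^sup>2" using step.prems by (intro power_mono) auto
  then have "501 * (k + 5)\<^sup>2 \<le> B" using assms(2) by linarith
  then have "invariant B (Suc k) (exec (process_weight k) ?m)
    \<and> operations (exec (process_weight k) ?m) \<le> operations ?m + 300 * B"
    using step by (intro process_weight_step) auto
  moreover have "operations ?m \<le> operations m + 300 * B * (k - 2)" using step by simp
  moreover have "300 * B * (Suc k - 2) = 300 * B * (k - 2) + 300 * B"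
  proof -
    have "Suc k - 2 = Suc (k - 2)" using step.hyps by simp
    then show ?thesis by (simp only: mult_Suc_right add.commute)
  qed
  ultimately show ?case using step.hyps by simp
qed (use assms(1) in simp)

lemma exec_series_step:
  "\<exists>k v. k \<le> 5 \<and> exec (do { v \<leftarrow> times_one_minus_q2 arr i; store b v }) m = tick k (put b v m)"
proof (cases "i < 6")
  case True
  then have "exec (do { v \<leftarrow> times_one_minus_q2 arr i; store b v }) m
      = tick 3 (put b (stored_value m (arr i)) m)"
    by (simp add: exec_def times_one_minus_q2_def run_op1_tick run_load_tick run_store_put)
  then show ?thesis by (metis numeral_le_iff semiring_norm(68,71,72,73))
next
  case False
  then have "exec (do { v \<leftarrow> times_one_minus_q2 arr i; store b v }) m
      = tick 5 (put b (stored_value m (arr i) - stored_value m (arr (i - 2))) m)"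
    by (simp add: exec_def times_one_minus_q2_def run_op1_tick run_load_tick run_store_put)
  then show ?thesis by blast
qed

lemma exec_series_loop:
  fixes b arr :: "nat \<Rightarrow> address" and d :: nat
  assumes "finite S" "card S \<le> B" "inside S B m" "\<And>i. i \<in> set is \<Longrightarrow> b i \<in> S"
  defines "m' \<equiv> exec (for_each is (\<lambda>i. do { v \<leftarrow> times_one_minus_q2 arr (i + d); store (b i) v })) m"
  shows "inside S B m' \<and> operations m' \<le> operations m + 5 * length is"
  unfolding m'_def exec_for_each using assms(3,4)
proof (induction "is" arbitrary: m)
  case (Cons i "is")
  let ?body = "\<lambda>i. do { v \<leftarrow> times_one_minus_q2 arr (i + d); store (b i) v }"
  obtain k v where k: "k \<le> 5" "exec (?body i) m = tick k (put (b i) v m)"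
    using exec_series_step[of arr "i + d" "b i" m] by auto
  have "inside S B (exec (?body i) m)"
    unfolding k(2) using inside_put[OF Cons.prems(1) Cons.prems(2)[of i] assms(1,2)] by simp
  then have "inside S B (fold (\<lambda>i. exec (?body i)) is (exec (?body i) m)) \<and>
      operations (fold (\<lambda>i. exec (?body i)) is (exec (?body i) m))
        \<le> operations (exec (?body i) m) + 5 * length is"
    using Cons.prems(2) by (intro Cons.IH) auto
  moreover have "operations (exec (?body i) m) \<le> operations m + 5" using k by simp
  ultimately show ?case by simp
qed simp

lemma exec_traverse_load:
  "exec (State_Monad.traverse_list (\<lambda>k. load (b k)) ks) m = tick (length ks) m"
proof (induction ks arbitrary: m)
  case Nil
  then show ?case by (simp add: exec_def tick_def)
next
  case (Cons k ks)
  show ?case using Cons[of "tick 1 m"] by (simp add: exec_def run_load_tick case_prod_unfold)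
qed

lemma exec_sphere_series:
  assumes "invariant B (n + 5) m" and B: "B = size_bound n"
  shows "peak (exec (sphere_series n) m) \<le> B"
    "operations (exec (sphere_series n) m) \<le> operations m + 11 * (n + 1)"
proof -
  let ?S = "work_addresses (n + 5) \<union> (G ` {..<n + 5} \<union> F ` {..n})"
  define m1 where "m1 = exec (for_each [4..<n + 5] (\<lambda>i. do {
      v \<leftarrow> times_one_minus_q2 H (i + 0); store (G i) v })) m"
  define m2 where "m2 = exec (for_each [0..<n + 1] (\<lambda>i. do {
      v \<leftarrow> times_one_minus_q2 G (i + 4); store (F i) v })) m1"
  have e: "exec (sphere_series n) m = exec (State_Monad.traverse_list (\<lambda>k. load (F k)) [0..<n + 1]) m2"
    unfolding m1_def m2_def sphere_series_def exec_def
    by (simp add: del: upt_Suc split: prod.splits)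
  have fin: "finite ?S" using work_addresses_bound by simp
  have "card ?S \<le> card (work_addresses (n + 5)) + (card (G ` {..<n + 5}) + card (F ` {..n}))"
    using card_Un_le le_trans add_left_mono by meson
  also have "\<dots> \<le> 501 * (n + 10)\<^sup>2 + ((n + 5) + (n + 1))"
    using work_addresses_bound(2)[of "n + 5"] card_image_le[of "{..<n + 5}" G] card_image_le[of "{..n}" F]
    by (simp add: add.assoc)
  also have "\<dots> \<le> B"
    unfolding B size_bound_def by (simp add: power2_eq_square algebra_simps)
  finally have card: "card ?S \<le> B" .
  have m: "inside ?S B m" using assms(1) live_subset_work(1)[of "n + 5"]
    by (auto simp: invariant_def inside_def)
  have m1: "inside ?S B m1 \<and> operations m1 \<le> operations m + 5 * length [4..<n + 5]"
    unfolding m1_def by (rule exec_series_loop[OF fin card m]) auto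
  then have m2: "inside ?S B m2 \<and> operations m2 \<le> operations m1 + 5 * length [0..<n + 1]"
    unfolding m2_def by (intro exec_series_loop[OF fin card]) auto
  show "peak (exec (sphere_series n) m) \<le> B"
    using m2 unfolding e exec_traverse_load tick_simps inside_def by blast
  show "operations (exec (sphere_series n) m) \<le> operations m + 11 * (n + 1)"
    using m1 m2 unfolding e exec_traverse_load tick_simps by simp
qed

definition final_machine :: "nat \<Rightarrow> machine" where
  "final_machine n = fold (\<lambda>wt. exec (process_weight wt)) [2..<n + 5]
     (exec (store (Totals 2 start_state start_state) 1) initial_machine)"

lemma run_algorithm_B: "run_state (algorithm_B n) initial_machine = run_state (sphere_series n) (final_machine n)"
  unfolding algorithm_B_def final_machine_def exec_for_each[symmetric] exec_def
  by (simp del: upt_Suc add: case_prod_unfold)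

lemma invariant_final:
  "invariant (size_bound n) (n + 5) (final_machine n)"
  "operations (final_machine n) \<le> 1 + 300 * size_bound n * (n + 3)"
proof -
  have "501 * (n + 10)\<^sup>2 \<le> size_bound n" "1 \<le> size_bound n" by (simp_all add: size_bound_def)
  from invariant_loop[OF invariant_start(1)[OF this(2)] this(1), of "n + 5"] invariant_start(2)[OF this(2)]
  show "invariant (size_bound n) (n + 5) (final_machine n)"
    "operations (final_machine n) \<le> 1 + 300 * size_bound n * (n + 3)"
    by (simp_all add: final_machine_def add.commute[of n 3] del: upt_Suc)
qed

lemma space_B_le: "space_B n \<le> size_bound n"
  using exec_sphere_series(1)[OF invariant_final(1)]
  by (simp add: space_B_def run_algorithm_B exec_def)

text \<open>
  A weight costs at most 300 operations for each address that \<open>size_bound\<close> allows, and \<open>300 * 503 = 150900\<close>;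
  the rest is for the series at the end.
\<close>

lemma time_B_le: "time_B n \<le> 151000 * (n + 10) ^ 3"
proof -
  have "time_B n \<le> 1 + 300 * size_bound n * (n + 3) + 11 * (n + 1)"
    using exec_sphere_series(2)[OF invariant_final(1)[of n] HOL.refl] invariant_final(2)[of n]
    by (simp add: time_B_def run_algorithm_B exec_def)
  also have "\<dots> \<le> 151000 * (n + 10) ^ 3"
    by (simp add: size_bound_def power2_eq_square power3_eq_cube algebra_simps)
  finally show ?thesis .
qed

lemma bigo_shifted_power:
  assumes "\<And>n. f n \<le> c * (n + 10) ^ k"
  shows "(\<lambda>n. real (f n)) \<in> O(\<lambda>n. real n ^ k)"
proof (rule bigoI[of _ "real c * 11 ^ k"])
  show "\<forall>\<^sub>F n in at_top. norm (real (f n)) \<le> real c * 11 ^ k * norm (real n ^ k)"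
    using eventually_ge_at_top[of 1]
  proof eventually_elim
    case (elim n)
    have "real (f n) \<le> real (c * (n + 10) ^ k)" using assms of_nat_le_iff by blast
    also have "\<dots> = real c * (real n + 10) ^ k" by simp
    also have "\<dots> \<le> real c * (11 * real n) ^ k"
      using elim by (intro mult_left_mono power_mono) auto
    finally show ?case by (simp add: power_mult_distrib mult.assoc)
  qed
qed

lemma time_B_bigo: "(\<lambda>n. real (time_B n)) \<in> O(\<lambda>n. real n ^ 3)"
  by (rule bigo_shifted_power) (rule time_B_le)

lemma space_B_bigo: "(\<lambda>n. real (space_B n)) \<in> O(\<lambda>n. real n ^ 2)"
  by (rule bigo_shifted_power) (use space_B_le in \<open>simp add: size_bound_def\<close>)

section \<open>The numbers returned\<close>

lemma run_sphere_series:
  fixes m :: machine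
  defines "h \<equiv> \<lambda>i. if 4 \<le> i then stored_value m (H i) else 0"
  shows "fst (run_state (sphere_series n) m)
    = map (\<lambda>k. h (k + 4) - 2 * h (k + 2) + h k) [0..<n + 1]"
proof -
  define m1 where "m1 = snd (run_state (for_each [4..<n + 5] (\<lambda>i. do {
      v \<leftarrow> times_one_minus_q2 H (i + 0); store (G i) v })) m)"
  define m2 where "m2 = snd (run_state (for_each [0..<n + 1] (\<lambda>i. do {
      v \<leftarrow> times_one_minus_q2 G (i + 4); store (F i) v })) m1)"
  have "fst (run_state (sphere_series n) m) = map (\<lambda>k. stored_value m2 (F k)) [0..<n + 1]"
    unfolding m1_def m2_def sphere_series_def
    by (simp add: run_traverse_load[symmetric] del: upt_Suc split: prod.splits)
  moreover have "stored_value m2 (F k) = h (k + 4) - 2 * h (k + 2) + h k"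
    if k: "k \<in> set [0..<n + 1]" for k
  proof -
    have 2: "stored_value m2 (F k) = stored_value m1 (G (k + 4))
        - (if k < 2 then 0 else stored_value m1 (G (k + 2)))"
      using run_series_loop(2)[of F G k "[0..<n + 1]" 4 m1] k
      by (simp add: m2_def run_times_one_minus_q2 inj_def del: upt_Suc)
    have 1: "stored_value m1 (G i) = stored_value m (H i)
        - (if i < 6 then 0 else stored_value m (H (i - 2)))" if "i \<in> set [4..<n + 5]" for i
      using run_series_loop(2)[of G H i "[4..<n + 5]" 0 m] that
      by (simp add: m1_def run_times_one_minus_q2 inj_def del: upt_Suc)
    show ?thesis using k by (auto simp: 2 1 h_def)
  qed
  ultimately show ?thesis by (simp del: upt_Suc)
qed

text \<open>
  The number of reduced pairs of total weight \<open>j\<close>.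
\<close>

definition num_pairs :: "nat \<Rightarrow> nat" where
  "num_pairs j = completions (j + 2) (start_state, start_state)"

lemma output_B_eq:
  "output_B n = map (\<lambda>k. int (num_pairs k) - 2 * (if 2 \<le> k then int (num_pairs (k - 2)) else 0)
      + (if 4 \<le> k then int (num_pairs (k - 4)) else 0)) [0..<n + 1]"
proof -
  let ?m = "final_machine n"
  have H: "stored_value ?m (H i) = int (num_pairs (i - 4))" if "4 \<le> i" "i < n + 5" for i
  proof -
    have "i - 4 + 2 = i - 2" using that by simp
    then show ?thesis using invariant_final(1)[of n] that by (simp add: invariant_def num_pairs_def)
  qed
  have "output_B n = fst (run_state (sphere_series n) ?m)"
    by (simp add: output_B_def run_algorithm_B)
  also have "\<dots> = map (\<lambda>k. int (num_pairs k) - 2 * (if 2 \<le> k then int (num_pairs (k - 2)) else 0)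
      + (if 4 \<le> k then int (num_pairs (k - 4)) else 0)) [0..<n + 1]"
    unfolding run_sphere_series
    by (intro map_cong HOL.refl) (auto simp: H)
  finally show ?thesis .
qed

section \<open>Minimal pairs and spheres\<close>

fun columns :: "forest \<times> forest \<Rightarrow> column list" where
  "columns (P, Q) = zip (gap_labels P) (gap_labels Q)"

definition pairs_of_weight :: "nat \<Rightarrow> (forest \<times> forest) set" where
  "pairs_of_weight j = {d. reduced d \<and> total_weight (columns d) = j}"

lemma card_pairs_of_weight: "finite (pairs_of_weight j) \<and> card (pairs_of_weight j) = num_pairs j"
proof -
  have "{(P, Q). reduced (P, Q) \<and> total_weight (zip (gap_labels P) (gap_labels Q)) + 2 = j + 2} = pairs_of_weight j"
  proof (rule Set.set_eqI)
    fix d :: "forest \<times> forest"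
    show "d \<in> {(P, Q). reduced (P, Q) \<and> total_weight (zip (gap_labels P) (gap_labels Q)) + 2 = j + 2}
        \<longleftrightarrow> d \<in> pairs_of_weight j"
      by (cases d) (simp add: pairs_of_weight_def)
  qed
  note b = bij_pairs_pair_walks[of "j + 2", unfolded this]
  show ?thesis
    using completions_eq_card_pair_walks[of "j + 2" "(start_state, start_state)"]
      bij_betw_finite[OF b] bij_betw_same_card[OF b] by (simp add: num_pairs_def)
qed

lemma columns_pad:
  "columns (pad_left_pair d) = LL # columns d"
  "reduced d \<Longrightarrow> columns (pad_right_pair d) = columns d @ [RR]"
proof -
  obtain P Q where d: "d = (P, Q)" by (cases d)
  show "columns (pad_left_pair d) = LL # columns d" by (simp add: d)
  assume "reduced d"
  then have "length (gap_labels P) = length (gap_labels Q)" by (simp add: d reduced_iff)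
  then show "columns (pad_right_pair d) = columns d @ [RR]" by (simp add: d)
qed

lemma pad_left_pair_inj: "pad_left_pair d = pad_left_pair d' \<Longrightarrow> d = d'"
proof -
  obtain P Q P' Q' where d: "d = (P, Q)" "d' = (P', Q')" by (cases d, cases d')
  assume "pad_left_pair d = pad_left_pair d'"
  then show ?thesis by (simp add: d pad_left_inj)
qed

lemma pad_right_pair_inj: "pad_right_pair d = pad_right_pair d' \<Longrightarrow> d = d'"
proof -
  obtain P Q P' Q' where d: "d = (P, Q)" "d' = (P', Q')" by (cases d, cases d')
  assume "pad_right_pair d = pad_right_pair d'"
  then show ?thesis by (simp add: d pad_right_inj)
qed

lemma gap_labels_hd_L:
  assumes "gap_labels P = LabL # a"
  shows "\<exists>P'. P = pad_left P'"
proof -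
  obtain ls t rs where P: "P = (ls, t, rs)" by (cases P)
  have "ls \<noteq> []"
  proof
    assume "ls = []"
    then have "LabL \<in> set (gaps t) \<union> set (right_gaps rs)"
      using assms by (metis P gap_labels.simps left_gaps.simps(1) append_Nil set_append list.set_intros(1))
    then show False using notin_labels by blast
  qed
  then obtain u ls' where ls: "ls = u # ls'" by (cases ls) auto
  have "gaps u = []"
  proof (rule ccontr)
    assume "gaps u \<noteq> []"
    then have "hd (gaps u) = LabL" using assms by (cases "gaps u") (auto simp: P ls)
    then show False using \<open>gaps u \<noteq> []\<close> notin_labels(5) hd_in_set by metis
  qed
  then have "P = pad_left (ls', t, rs)" by (simp add: P ls)
  then show ?thesis by blast
qed

lemma gap_labels_last_R:
  assumes "gap_labels P = a @ [LabR]"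
  shows "\<exists>P'. P = pad_right P'"
proof -
  obtain ls t rs where P: "P = (ls, t, rs)" by (cases P)
  have "rs \<noteq> []"
  proof
    assume "rs = []"
    then have "LabR \<in> set (left_gaps ls) \<union> set (gaps t)"
      using assms by (metis P gap_labels.simps right_gaps.simps(1) append_Nil2 set_append in_set_conv_decomp)
    then show False using notin_labels by blast
  qed
  then obtain u rs' where rs: "rs = rs' @ [u]" by (cases rs rule: rev_cases) auto
  have "u = Lf"
  proof (rule ccontr)
    assume "u \<noteq> Lf"
    then have "last (gap_labels P) = LabI" using last_gaps[of u] by (simp add: P rs right_gaps_append)
    then show False using assms by simp
  qed
  then have "P = pad_right (ls, t, rs')" by (simp add: P rs)
  then show ?thesis by blast
qed

lemma unpad_left:
  assumes "reduced d" "columns d = LL # cs"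
  shows "\<exists>d'. reduced d' \<and> d = pad_left_pair d'"
proof -
  obtain P Q where d: "d = (P, Q)" by (cases d)
  have "\<exists>a b. gap_labels P = LabL # a \<and> gap_labels Q = LabL # b"
    using assms(2) d by (cases "gap_labels P"; cases "gap_labels Q") auto
  then obtain P' Q' where PQ: "P = pad_left P'" "Q = pad_left Q'" using gap_labels_hd_L by metis
  then have "reduced (P', Q')" using assms(1) by (simp add: d reduced_iff no_common_pad)
  then show ?thesis using PQ d by (intro exI[of _ "(P', Q')"]) simp
qed

lemma unpad_right:
  assumes "reduced d" "columns d = cs @ [RR]"
  shows "\<exists>d'. reduced d' \<and> d = pad_right_pair d'"
proof -
  obtain P Q where d: "d = (P, Q)" by (cases d)
  have len: "length (gap_labels P) = length (gap_labels Q)" using assms(1) by (simp add: d reduced_iff)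
  have "map fst (columns d) = gap_labels P" "map snd (columns d) = gap_labels Q" using len by (simp_all add: d)
  then have "gap_labels P = map fst cs @ [LabR]" "gap_labels Q = map snd cs @ [LabR]" using assms(2) by auto
  then obtain P' Q' where PQ: "P = pad_right P'" "Q = pad_right Q'" using gap_labels_last_R by metis
  moreover from this have "length (gap_labels P') = length (gap_labels Q')" using len by simp
  ultimately have "reduced (P', Q')" using assms(1) by (simp add: d reduced_iff no_common_pad)
  then show ?thesis using PQ d by (intro exI[of _ "(P', Q')"]) simp
qed

definition left_minimal :: "forest \<times> forest \<Rightarrow> bool" where
  "left_minimal d \<longleftrightarrow> \<not> (\<exists>cs. columns d = LL # cs)"

definition right_minimal :: "forest \<times> forest \<Rightarrow> bool" where
  "right_minimal d \<longleftrightarrow> \<not> (\<exists>cs. columns d = cs @ [RR])"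

lemma card_split: "finite A \<Longrightarrow> card A = card {x \<in> A. p x} + card {x \<in> A. \<not> p x}"
proof -
  assume "finite A"
  moreover have "A = {x \<in> A. p x} \<union> {x \<in> A. \<not> p x}" by blast
  ultimately show ?thesis
    using card_Un_disjoint[of "{x \<in> A. p x}" "{x \<in> A. \<not> p x}"] by auto
qed

text \<open>
  A pair that is not minimal on the left arises from a unique pair by padding, which adds 2 to the weight.
\<close>

lemma card_left_minimal:
  "card (pairs_of_weight j) = card {d \<in> pairs_of_weight j. left_minimal d}
     + (if 2 \<le> j then card (pairs_of_weight (j - 2)) else 0)"
proof -
  let ?A = "pairs_of_weight j"
  have img: "{d \<in> ?A. \<not> left_minimal d} = (if 2 \<le> j then pad_left_pair ` pairs_of_weight (j - 2) else {})"
  proof (intro equalityI subsetI)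
    fix d assume "d \<in> {d \<in> ?A. \<not> left_minimal d}"
    then have d: "reduced d" "total_weight (columns d) = j" "\<exists>cs. columns d = LL # cs"
      by (auto simp: pairs_of_weight_def left_minimal_def)
    then obtain d' where d': "reduced d'" "d = pad_left_pair d'" using unpad_left by blast
    have "j = 2 + total_weight (columns d')" using d(2) columns_pad(1)[of d'] d'(2) by simp
    then show "d \<in> (if 2 \<le> j then pad_left_pair ` pairs_of_weight (j - 2) else {})"
      using d' by (auto simp: pairs_of_weight_def)
  next
    fix d assume "d \<in> (if 2 \<le> j then pad_left_pair ` pairs_of_weight (j - 2) else {})"
    then obtain d' where "2 \<le> j" "reduced d'" "total_weight (columns d') = j - 2" "d = pad_left_pair d'"
      by (auto simp: pairs_of_weight_def split: if_splits)
    then show "d \<in> {d \<in> ?A. \<not> left_minimal d}"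
      using columns_pad(1) pad_left_pair(1) by (auto simp: pairs_of_weight_def left_minimal_def)
  qed
  have "card ?A = card {d \<in> ?A. left_minimal d} + card {d \<in> ?A. \<not> left_minimal d}"
    by (rule card_split) (simp add: card_pairs_of_weight)
  also have "card {d \<in> ?A. \<not> left_minimal d} = (if 2 \<le> j then card (pairs_of_weight (j - 2)) else 0)"
    unfolding img by (simp add: card_image[OF inj_onI[OF pad_left_pair_inj]])
  finally show ?thesis .
qed

lemma pad_right_left_minimal:
  "reduced d \<Longrightarrow> left_minimal (pad_right_pair d) \<longleftrightarrow> left_minimal d"
  by (cases "columns d") (auto simp: left_minimal_def columns_pad)

lemma card_right_minimal:
  "card {d \<in> pairs_of_weight j. left_minimal d}
     = card {d \<in> pairs_of_weight j. left_minimal d \<and> right_minimal d}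
     + (if 2 \<le> j then card {d \<in> pairs_of_weight (j - 2). left_minimal d} else 0)"
proof -
  let ?A = "\<lambda>j. {d \<in> pairs_of_weight j. left_minimal d}"
  have img: "{d \<in> ?A j. \<not> right_minimal d} = (if 2 \<le> j then pad_right_pair ` ?A (j - 2) else {})"
  proof (intro equalityI subsetI)
    fix d assume "d \<in> {d \<in> ?A j. \<not> right_minimal d}"
    then have d: "reduced d" "total_weight (columns d) = j" "left_minimal d" "\<exists>cs. columns d = cs @ [RR]"
      by (auto simp: pairs_of_weight_def right_minimal_def)
    then obtain d' where d': "reduced d'" "d = pad_right_pair d'" using unpad_right by blast
    have "j = 2 + total_weight (columns d')" using d(2) columns_pad(2)[OF d'(1)] d'(2) by simp
    moreover have "left_minimal d'" using d(3) d' pad_right_left_minimal by blast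
    ultimately show "d \<in> (if 2 \<le> j then pad_right_pair ` ?A (j - 2) else {})"
      using d' by (auto simp: pairs_of_weight_def)
  next
    fix d assume "d \<in> (if 2 \<le> j then pad_right_pair ` ?A (j - 2) else {})"
    then obtain d' where "2 \<le> j" "reduced d'" "total_weight (columns d') = j - 2" "left_minimal d'"
      "d = pad_right_pair d'"
      by (auto simp: pairs_of_weight_def split: if_splits)
    then show "d \<in> {d \<in> ?A j. \<not> right_minimal d}"
      using columns_pad(2) pad_right_pair(1) pad_right_left_minimal
      by (auto simp: pairs_of_weight_def right_minimal_def)
  qed
  have "card (?A j) = card {d \<in> ?A j. right_minimal d} + card {d \<in> ?A j. \<not> right_minimal d}"
    by (rule card_split) (simp add: card_pairs_of_weight)
  also have "{d \<in> ?A j. right_minimal d} = {d \<in> pairs_of_weight j. left_minimal d \<and> right_minimal d}"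
    by blast
  also have "card {d \<in> ?A j. \<not> right_minimal d} = (if 2 \<le> j then card (?A (j - 2)) else 0)"
    unfolding img by (simp add: card_image[OF inj_onI[OF pad_right_pair_inj]])
  finally show ?thesis .
qed

definition minimal_pairs :: "nat \<Rightarrow> (forest \<times> forest) set" where
  "minimal_pairs k = {d \<in> pairs_of_weight k. left_minimal d \<and> right_minimal d}"

text \<open>
  In terms of generating functions, padding on either side contributes a factor \<open>1 / (1 - q\<^sup>2)\<close>.
\<close>

lemma card_minimal_pairs:
  "int (card (minimal_pairs k)) = int (num_pairs k) - 2 * (if 2 \<le> k then int (num_pairs (k - 2)) else 0)
     + (if 4 \<le> k then int (num_pairs (k - 4)) else 0)"
  using card_left_minimal[of k] card_left_minimal[of "k - 2"] card_right_minimal[of k]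
  by (auto simp: card_pairs_of_weight minimal_pairs_def diff_diff_left split: if_splits)

lemma columns_pad_funpow:
  assumes "reduced d"
  shows "columns (pad i j d) = replicate i LL @ columns d @ replicate j RR"
proof -
  have 1: "reduced ((pad_right_pair ^^ j) d) \<and> columns ((pad_right_pair ^^ j) d) = columns d @ replicate j RR"
    using assms
    by (induction j) (auto simp: pad_right_pair columns_pad replicate_append_same[symmetric])
  have "reduced (pad i j d) \<and> columns (pad i j d) = replicate i LL @ columns d @ replicate j RR"
    unfolding pad_def using 1 by (induction i) (auto simp: pad_left_pair columns_pad)
  then show ?thesis ..
qed

lemma pad_inj: "pad i j d = pad i j d' \<Longrightarrow> d = d'"
proof -
  have "inj pad_left_pair" "inj pad_right_pair"
    using pad_left_pair_inj pad_right_pair_inj by (auto intro: injI)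
  then have "inj (pad_left_pair ^^ i)" "inj (pad_right_pair ^^ j)" by (simp_all add: inj_fn)
  moreover assume "pad i j d = pad i j d'"
  ultimately show ?thesis unfolding pad_def by (auto dest: injD)
qed

lemma leading_minimal: "left_minimal d \<Longrightarrow> leading (columns d @ replicate j RR) = 0"
  by (cases "columns d"; cases j) (auto simp: left_minimal_def leading_Cons)

lemma trailing_minimal: "right_minimal d \<Longrightarrow> trailing (replicate i LL @ columns d) = 0"
  by (cases "columns d" rule: rev_cases)
     (auto simp: right_minimal_def trailing_append trailing_single intro!: trailing_0)

text \<open>
  The numbers of padding columns can be read off from the columns of the padded pair.
\<close>

lemma minimal_unique:
  assumes "reduced d" "reduced d'" "pair_elt d = pair_elt d'"
    "left_minimal d" "right_minimal d" "left_minimal d'" "right_minimal d'"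
  shows "d = d'"
proof -
  obtain i j i' j' where eq: "pad i j d = pad i' j' d'"
    using reduced_unique_up_to_padding assms(1-3) by blast
  have "leading (columns (pad i j d)) = i" if "reduced d" "left_minimal d" for i j d
    using that leading_minimal[of d j] by (simp add: columns_pad_funpow leading_append set_replicate_conv_if)
  then have "i = i'" using assms eq by metis
  moreover have "trailing (columns (pad i j d)) = j" if "reduced d" "right_minimal d" for i j d
    using that trailing_minimal[of d i] trailing_append[of "replicate i LL @ columns d" "replicate j RR"]
    by (simp add: columns_pad_funpow set_replicate_conv_if)
  then have "j = j'" using assms eq by metis
  ultimately show ?thesis using eq pad_inj by blast
qed

lemma pair_weight_minimal:
  assumes "left_minimal d" "right_minimal d"
  shows "pair_weight d = int (total_weight (columns d))"
  using leading_minimal[OF assms(1), of 0] trailing_minimal[OF assms(2), of 0]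
  by (cases d) (simp add: net_weight_def)

lemma minimal_exists:
  "reduced d \<Longrightarrow> \<exists>d'. reduced d' \<and> left_minimal d' \<and> right_minimal d' \<and> pair_elt d' = pair_elt d"
proof (induction "length (columns d)" arbitrary: d rule: less_induct)
  case less
  consider "left_minimal d" "right_minimal d" | "\<not> left_minimal d" | "\<not> right_minimal d" by blast
  then show ?case
  proof cases
    case 1
    then show ?thesis using less.prems by blast
  next
    case 2
    then obtain d' where d': "reduced d'" "d = pad_left_pair d'"
      using unpad_left less.prems unfolding left_minimal_def by blast
    then have "length (columns d') < length (columns d)" using columns_pad(1) by simp
    from less.hyps[OF this d'(1)] show ?thesis using pad_left_pair(2)[OF d'(1)] d'(2) by simp
  next
    case 3
    then obtain d' where d': "reduced d'" "d = pad_right_pair d'"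
      using unpad_right less.prems unfolding right_minimal_def by blast
    then have "length (columns d') < length (columns d)" using columns_pad(2) by simp
    from less.hyps[OF this d'(1)] show ?thesis using pad_right_pair(2)[OF d'(1)] d'(2) by simp
  qed
qed

definition element_class :: "thompson \<Rightarrow> generator word set" where
  "element_class g = {w. abs_thompson w = g}"

lemma element_class_abs: "element_class (abs_thompson w) = word_class thompson_relators w"
  unfolding element_class_def word_class_def by (auto simp: thompson.abs_eq_iff intro: word_eq.sym)

lemma bij_minimal_pairs_sphere:
  "bij_betw (\<lambda>d. element_class (pair_elt d)) (minimal_pairs k) (sphere_F k)"
proof (rule bij_betw_imageI)
  have word: "\<exists>w. abs_thompson w = pair_elt d \<and> element_class (pair_elt d) = word_class thompson_relators w"
    if d: "reduced d" for d
    using pair_to_word[OF d] element_class_abs by metis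
  have min: "reduced d" "left_minimal d" "right_minimal d" "pair_weight d = int k" if "d \<in> minimal_pairs k" for d
    using that pair_weight_minimal[of d] by (auto simp: minimal_pairs_def pairs_of_weight_def)
  show "inj_on (\<lambda>d. element_class (pair_elt d)) (minimal_pairs k)"
  proof (rule inj_onI)
    fix d d' assume d: "d \<in> minimal_pairs k" "d' \<in> minimal_pairs k"
      and eq: "element_class (pair_elt d) = element_class (pair_elt d')"
    obtain w where "abs_thompson w = pair_elt d" using word[OF min(1)[OF d(1)]] by blast
    then have "w \<in> element_class (pair_elt d')" unfolding eq[symmetric] by (simp add: element_class_def)
    then have "pair_elt d = pair_elt d'" using \<open>abs_thompson w = pair_elt d\<close> by (simp add: element_class_def)
    then show "d = d'" using minimal_unique min d by blast
  qed
  show "(\<lambda>d. element_class (pair_elt d)) ` minimal_pairs k = sphere_F k"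
  proof (intro equalityI subsetI)
    fix g assume "g \<in> (\<lambda>d. element_class (pair_elt d)) ` minimal_pairs k"
    then obtain d where d: "d \<in> minimal_pairs k" "g = element_class (pair_elt d)" by blast
    then obtain w where w: "abs_thompson w = pair_elt d" "g = word_class thompson_relators w"
      using word min(1) by metis
    then have "int (geodesic_length g) = int k"
      using geodesic_length_pair[OF min(1)[OF d(1)] w(1)[symmetric]] min(4)[OF d(1)] by simp
    then show "g \<in> sphere_F k"
      using w(2) by (simp add: sphere_F_def thompson_F_def carrier_presented_group)
  next
    fix g assume g: "g \<in> sphere_F k"
    then obtain w where w: "g = word_class thompson_relators w" "geodesic_length g = k"
      by (auto simp: sphere_F_def thompson_F_def carrier_presented_group)
    obtain d where "reduced d" "pair_elt d = abs_thompson w" using word_to_pair by blast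
    then obtain d' where d': "reduced d'" "left_minimal d'" "right_minimal d'" "pair_elt d' = abs_thompson w"
      using minimal_exists by metis
    then have "int (total_weight (columns d')) = int k"
      using geodesic_length_pair[OF d'(1,4)] pair_weight_minimal w by metis
    then have "d' \<in> minimal_pairs k" using d' by (simp add: minimal_pairs_def pairs_of_weight_def)
    moreover have "g = element_class (pair_elt d')" using w(1) d'(4) element_class_abs by simp
    ultimately show "g \<in> (\<lambda>d. element_class (pair_elt d)) ` minimal_pairs k" by blast
  qed
qed

theorem proposition9:
  shows "(\<forall>n. output_B n = map (\<lambda>k. int (card (sphere_F k))) [0..<n + 1])
       \<and> (\<lambda>n. real (time_B n)) \<in> O(\<lambda>n. real n ^ 3)
       \<and> (\<lambda>n. real (space_B n)) \<in> O(\<lambda>n. real n ^ 2)"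
proof (intro conjI allI)
  show "output_B n = map (\<lambda>k. int (card (sphere_F k))) [0..<n + 1]" for n
    unfolding output_B_eq card_minimal_pairs[symmetric]
    using bij_betw_same_card[OF bij_minimal_pairs_sphere] by simp
qed (rule time_B_bigo space_B_bigo)+

end
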